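(* For $R$ a restriction species, the Schmitt coalgebra of $R$ is the homotopy cardinality of the incidence coalgebra of the associated decomposition space $\mathbf{R}$. For a morphism of restriction species $R'\to R$, Schmitt's coalgebra homomorphism is the homotopy cardinality of the associated CULF functor $\mathbf{R}'\to\mathbf{R}$.
   Context: Conventions: functors into groupoids $\mathbf{Grpd}$ are pseudo-functors, transformations pseudo-natural; pullbacks and fibres of groupoids are homotopy pullbacks and fibres. $\mathbb{I}$ is the category of finite sets and injections. A restriction species is a pseudo-functor $R:\mathbb{I}^{\mathrm{op}}\to\mathbf{Grpd}$ whose values are locally finite groupoids (all automorphism groups finite); morphisms are pseudo-natural transformations. For $B\subset A$ and $X\in R[A]$, $X|B\in R[B]$ is the restriction. An isomorphism of $R$-structures $X\in R[A]$, $X'\in R[A']$ is a bijection $A\cong A'$ together with an isomorphism of structures over it. Schmitt coalgebra of $R$: the $\mathbb{Q}$-vector space spanned by isomorphism classes of $R$-structures, with $\Delta(X)=\sum_{A_1+A_2=A}X|A_1\otimes X|A_2$ for $X\in R[A]$ (sum over ordered pairs of disjoint subsets with union $A$), and counit sending $X\in R[\varnothing]$ to $1$ and other structures to $0$. A morphism $\phi:R'\to R$ induces the coalgebra homomorphism sending the class of $X$ to the class of $\phi(X)$. Associated decomposition space (a simplicial groupoid sending pushouts of endpoint-preserving maps along distance-preserving maps of $\Delta$ to pullbacks): $\mathbf{R}_n$ is the groupoid of triples $(A,p,X)$ with $A$ a finite set, $p:A\to\{1,\dots,n\}$ any function and $X\in R[A]$, with morphisms the isomorphisms of $R$-structures compatible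 with the functions $p$. Inner face maps join adjacent layers (fibres of $p$), degeneracy maps insert an empty layer, and the outer face maps $d_0$, $d_n:\mathbf{R}_n\to\mathbf{R}_{n-1}$ delete the first, resp. last, layer and restrict $X$ to the union of the remaining ones (for $n=1$ both restrict $X$ to $\varnothing$). A morphism $\phi$ induces a simplicial map $F:\mathbf{R}'\to\mathbf{R}$, $(A,p,X)\mapsto(A,p,\phi(X))$; it is CULF (its naturality squares on endpoint-preserving maps are pullbacks). Incidence coalgebra of a decomposition space $\mathbf{X}$: the slice $\mathbf{Grpd}_{/\mathbf{X}_1}$ with comultiplication $\mathbf{Grpd}_{/\mathbf{X}_1}\to\mathbf{Grpd}_{/\mathbf{X}_1\times\mathbf{X}_1}$ given by pullback along $d_1:\mathbf{X}_2\to\mathbf{X}_1$ followed by composition with $(d_2,d_0):\mathbf{X}_2\to\mathbf{X}_1\times\mathbf{X}_1$, and counit $\mathbf{Grpd}_{/\mathbf{X}_1}\to\mathbf{Grpd}$ given by pullback along $s_0:\mathbf{X}_0\to\mathbf{X}_1$ followed by composition with $\mathbf{X}_0\to1$. A CULF functor $F:\mathbf{X}'\to\mathbf{X}$ induces the homomorphism given by composition with $F_1:\mathbf{X}'_1\to\mathbf{X}_1$. Homotopy cardinality: for a finite groupoid $Y$, $|Y|=\sum_{y\in\pi_0Y}1/|\mathrm{Aut}(y)|$. $\mathbf{Grpd}_{/S}$ corresponds to the vector space $\mathbb{Q}_{\pi_0S}$ with basis symbols $\delta_s$; the cardinality of an object $Y\to S$ (with $Y$ finite) is $\sum_{s\in\pi_0S}\frac{|Y_s|}{|\mathrm{Aut}(s)|}\delta_s$,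 where $Y_s$ is the homotopy fibre; in particular $\delta_s$ is the cardinality of the map $1\to S$ picking out $s$. The cardinality of a functor between slices given by pullback along a map with finite homotopy fibres followed by composition is the linear map sending $\delta_s$ to the cardinality of the image of $1\xrightarrow{s}S$. *)

theory Defs
  imports Complex_Main "HOL-Library.FuncSet" "HOL-Library.Infinite_Typeclass"
    "HOL-Library.Poly_Mapping"
begin

section \<open>Categories, groupoids and functors\<close>

record ('o, 'm) cat =
  obj :: "'o set"
  arr :: "'m set"
  src :: "'m \<Rightarrow> 'o"
  tgt :: "'m \<Rightarrow> 'o"
  ide :: "'o \<Rightarrow> 'm"
  cmp :: "'m \<Rightarrow> 'm \<Rightarrow> 'm"  \<comment> \<open>\<open>cmp C g f\<close> is \<open>g \<circ> f\<close>\<close>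

definition hom :: "('o, 'm) cat \<Rightarrow> 'o \<Rightarrow> 'o \<Rightarrow> 'm set" where
  "hom C x y = {f \<in> arr C. src C f = x \<and> tgt C f = y}"

locale category =
  fixes C :: "('o, 'm) cat"
  assumes src_obj: "f \<in> arr C \<Longrightarrow> src C f \<in> obj C"
    and tgt_obj: "f \<in> arr C \<Longrightarrow> tgt C f \<in> obj C"
    and ide_hom: "x \<in> obj C \<Longrightarrow> ide C x \<in> hom C x x"
    and cmp_hom: "f \<in> hom C x y \<Longrightarrow> g \<in> hom C y z \<Longrightarrow> cmp C g f \<in> hom C x z"
    and cmp_ide: "f \<in> hom C x y \<Longrightarrow> cmp C f (ide C x) = f"
    and ide_cmp: "f \<in> hom C x y \<Longrightarrow> cmp C (ide C y) f = f"
    and cmp_assoc: "f \<in> hom C x y \<Longrightarrow> g \<in> hom C y z \<Longrightarrow> h \<in> hom C z w \<Longrightarrow>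
      cmp C h (cmp C g f) = cmp C (cmp C h g) f"

definition inverse_in :: "('o, 'm) cat \<Rightarrow> 'm \<Rightarrow> 'm \<Rightarrow> bool" where
  "inverse_in C f g \<longleftrightarrow> g \<in> hom C (tgt C f) (src C f) \<and>
     cmp C g f = ide C (src C f) \<and> cmp C f g = ide C (tgt C f)"

locale groupoid = category +
  assumes has_inverse: "f \<in> arr C \<Longrightarrow> \<exists>g. inverse_in C f g"

definition inv_arr :: "('o, 'm) cat \<Rightarrow> 'm \<Rightarrow> 'm" where
  "inv_arr C f = (THE g. inverse_in C f g)"

record ('o, 'm, 'p, 'n) fctr =
  fob :: "'o \<Rightarrow> 'p"
  far :: "'m \<Rightarrow> 'n"

definition is_functor :: "('o, 'm) cat \<Rightarrow> ('p, 'n) cat \<Rightarrow> ('o, 'm, 'p, 'n) fctr \<Rightarrow> bool" where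
  "is_functor C D F \<longleftrightarrow>
     (\<forall>x\<in>obj C. fob F x \<in> obj D \<and> far F (ide C x) = ide D (fob F x)) \<and>
     (\<forall>x y. \<forall>f\<in>hom C x y. far F f \<in> hom D (fob F x) (fob F y)) \<and>
     (\<forall>x y z. \<forall>f\<in>hom C x y. \<forall>g\<in>hom C y z. far F (cmp C g f) = cmp D (far F g) (far F f))"

definition fcomp :: "('p, 'n, 'q, 'k) fctr \<Rightarrow> ('o, 'm, 'p, 'n) fctr \<Rightarrow> ('o, 'm, 'q, 'k) fctr" where
  "fcomp G F = \<lparr>fob = fob G \<circ> fob F, far = far G \<circ> far F\<rparr>"

definition id_fctr :: "('o, 'm, 'o, 'm) fctr" where
  "id_fctr = \<lparr>fob = id, far = id\<rparr>"

definition is_nat_trans ::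
  "('o, 'm) cat \<Rightarrow> ('p, 'n) cat \<Rightarrow> ('o, 'm, 'p, 'n) fctr \<Rightarrow> ('o, 'm, 'p, 'n) fctr \<Rightarrow> ('o \<Rightarrow> 'n) \<Rightarrow> bool"
  where
  "is_nat_trans C D F G \<eta> \<longleftrightarrow>
     (\<forall>x\<in>obj C. \<eta> x \<in> hom D (fob F x) (fob G x)) \<and>
     (\<forall>x y. \<forall>f\<in>hom C x y. cmp D (far G f) (\<eta> x) = cmp D (\<eta> y) (far F f))"

definition unit_cat :: "(unit, unit) cat" where
  "unit_cat = \<lparr>obj = UNIV, arr = UNIV, src = (\<lambda>_. ()), tgt = (\<lambda>_. ()),
     ide = (\<lambda>_. ()), cmp = (\<lambda>_ _. ())\<rparr>"

definition to_unit :: "('o, 'm, unit, unit) fctr" where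
  "to_unit = \<lparr>fob = (\<lambda>_. ()), far = (\<lambda>_. ())\<rparr>"

definition prod_cat :: "('o, 'm) cat \<Rightarrow> ('p, 'n) cat \<Rightarrow> ('o \<times> 'p, 'm \<times> 'n) cat" where
  "prod_cat C D = \<lparr>obj = obj C \<times> obj D, arr = arr C \<times> arr D,
     src = map_prod (src C) (src D), tgt = map_prod (tgt C) (tgt D),
     ide = map_prod (ide C) (ide D),
     cmp = (\<lambda>(g, g') (f, f'). (cmp C g f, cmp D g' f'))\<rparr>"

definition pair_fctr ::
  "('o, 'm, 'p, 'n) fctr \<Rightarrow> ('o, 'm, 'q, 'k) fctr \<Rightarrow> ('o, 'm, 'p \<times> 'q, 'n \<times> 'k) fctr" where
  "pair_fctr F G = \<lparr>fob = (\<lambda>x. (fob F x, fob G x)), far = (\<lambda>f. (far F f, far G f))\<rparr>"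

text \<open>In a groupoid every arrow is invertible, so this is the relation of being isomorphic.\<close>

definition iso_rel :: "('o, 'm) cat \<Rightarrow> ('o \<times> 'o) set" where
  "iso_rel G = {(x, y). x \<in> obj G \<and> y \<in> obj G \<and> hom G x y \<noteq> {}}"

definition pi0 :: "('o, 'm) cat \<Rightarrow> 'o set set" where
  "pi0 G = obj G // iso_rel G"

definition cls :: "('o, 'm) cat \<Rightarrow> 'o \<Rightarrow> 'o set" where
  "cls G x = iso_rel G `` {x}"

text \<open>The common value on a class of a function that respects isomorphism.\<close>

definition on_class :: "('o \<Rightarrow> 'b) \<Rightarrow> 'o set \<Rightarrow> 'b" where
  "on_class f c = the_elem (f ` c)"

definition aut :: "('o, 'm) cat \<Rightarrow> 'o \<Rightarrow> 'm set" where
  "aut G x = hom G x x"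

definition locally_finite :: "('o, 'm) cat \<Rightarrow> bool" where
  "locally_finite G \<longleftrightarrow> (\<forall>x\<in>obj G. finite (aut G x))"

text \<open>Finiteness of groupoids is invariant under equivalence: a finite groupoid may have
  infinitely many (isomorphic) objects.\<close>

definition finite_groupoid :: "('o, 'm) cat \<Rightarrow> bool" where
  "finite_groupoid G \<longleftrightarrow> groupoid G \<and> finite (pi0 G) \<and> locally_finite G"


section \<open>Pseudo-functors into groupoids\<close>

text \<open>Contravariant pseudo-functors. For \<open>f : A \<rightarrow> B\<close> and \<open>g : B \<rightarrow> C\<close> the compositor at \<open>Z\<close> is
  an arrow \<open>f\<^sup>* (g\<^sup>* Z) \<rightarrow> (g \<circ> f)\<^sup>* Z\<close>, and the unitor at \<open>X\<close> is an arrow \<open>X \<rightarrow> (id\<^sub>A)\<^sup>* X\<close>.\<close>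

record ('c, 'f, 'x, 'm) psfunctor =
  val :: "'c \<Rightarrow> ('x, 'm) cat"
  act :: "'f \<Rightarrow> ('x, 'm, 'x, 'm) fctr"
  compositor :: "'f \<Rightarrow> 'f \<Rightarrow> 'x \<Rightarrow> 'm"
  unitor :: "'c \<Rightarrow> 'x \<Rightarrow> 'm"

definition is_psfunctor :: "('c, 'f) cat \<Rightarrow> ('c, 'f, 'x, 'm) psfunctor \<Rightarrow> bool" where
  "is_psfunctor C P \<longleftrightarrow>
     (\<forall>A\<in>obj C. groupoid (val P A)) \<and>
     (\<forall>A B. \<forall>f\<in>hom C A B. is_functor (val P B) (val P A) (act P f)) \<and>
     (\<forall>A B D. \<forall>f\<in>hom C A B. \<forall>g\<in>hom C B D.
        is_nat_trans (val P D) (val P A) (fcomp (act P f) (act P g)) (act P (cmp C g f))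
          (compositor P f g)) \<and>
     (\<forall>A\<in>obj C. is_nat_trans (val P A) (val P A) id_fctr (act P (ide C A)) (unitor P A)) \<and>
     (\<forall>A B. \<forall>f\<in>hom C A B. \<forall>Y\<in>obj (val P B).
        cmp (val P A) (compositor P (ide C A) f Y) (unitor P A (fob (act P f) Y))
          = ide (val P A) (fob (act P f) Y) \<and>
        cmp (val P A) (compositor P f (ide C B) Y) (far (act P f) (unitor P B Y))
          = ide (val P A) (fob (act P f) Y)) \<and>
     (\<forall>A B D E. \<forall>f\<in>hom C A B. \<forall>g\<in>hom C B D. \<forall>h\<in>hom C D E. \<forall>W\<in>obj (val P E).
        cmp (val P A) (compositor P (cmp C g f) h W) (compositor P f g (fob (act P h) W))
          = cmp (val P A) (compositor P f (cmp C h g) W) (far (act P f) (compositor P g h W)))"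

text \<open>Pseudo-natural transformations \<open>\<phi> : P \<Rightarrow> Q\<close>. For \<open>f : A \<rightarrow> B\<close> the structure arrow at \<open>Y\<close> is
  \<open>\<phi>\<^sub>A (f\<^sup>* Y) \<rightarrow> f\<^sup>* (\<phi>\<^sub>B Y)\<close>.\<close>

record ('c, 'f, 'x, 'm, 'y, 'n) pstrans =
  component :: "'c \<Rightarrow> ('x, 'm, 'y, 'n) fctr"
  square :: "'f \<Rightarrow> 'x \<Rightarrow> 'n"

definition is_pstrans ::
  "('c, 'f) cat \<Rightarrow> ('c, 'f, 'x, 'm) psfunctor \<Rightarrow> ('c, 'f, 'y, 'n) psfunctor \<Rightarrow>
   ('c, 'f, 'x, 'm, 'y, 'n) pstrans \<Rightarrow> bool" where
  "is_pstrans C P Q \<phi> \<longleftrightarrow>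
     (\<forall>A\<in>obj C. is_functor (val P A) (val Q A) (component \<phi> A)) \<and>
     (\<forall>A B. \<forall>f\<in>hom C A B.
        is_nat_trans (val P B) (val Q A) (fcomp (component \<phi> A) (act P f))
          (fcomp (act Q f) (component \<phi> B)) (square \<phi> f)) \<and>
     (\<forall>A\<in>obj C. \<forall>X\<in>obj (val P A).
        cmp (val Q A) (square \<phi> (ide C A) X) (far (component \<phi> A) (unitor P A X))
          = unitor Q A (fob (component \<phi> A) X)) \<and>
     (\<forall>A B D. \<forall>f\<in>hom C A B. \<forall>g\<in>hom C B D. \<forall>Z\<in>obj (val P D).
        cmp (val Q A) (square \<phi> (cmp C g f) Z) (far (component \<phi> A) (compositor P f g Z))
          = cmp (val Q A) (compositor Q f g (fob (component \<phi> D) Z))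
              (cmp (val Q A) (far (act Q f) (square \<phi> g Z)) (square \<phi> f (fob (act P g) Z))))"


section \<open>Restriction species\<close>

text \<open>Finite sets are the finite subsets of an infinite type \<open>'e\<close>; an injection is recorded
  together with its domain and codomain.\<close>

type_synonym 'e injection = "'e set \<times> ('e \<Rightarrow> 'e) \<times> 'e set"

definition inj_cat :: "('e::infinite set, 'e injection) cat" where
  "inj_cat = \<lparr>obj = {A. finite A},
     arr = {(A, f, B). finite A \<and> finite B \<and> f \<in> A \<rightarrow>\<^sub>E B \<and> inj_on f A},
     src = (\<lambda>(A, f, B). A), tgt = (\<lambda>(A, f, B). B),
     ide = (\<lambda>A. (A, \<lambda>a\<in>A. a, A)),
     cmp = (\<lambda>(_, g, D) (A, f, _). (A, compose A g f, D))\<rparr>"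

definition incl :: "'e set \<Rightarrow> 'e set \<Rightarrow> 'e injection" where
  "incl B A = (B, \<lambda>b\<in>B. b, A)"

type_synonym ('e, 'x, 'm) species = "('e set, 'e injection, 'x, 'm) psfunctor"

type_synonym ('e, 'x, 'm, 'y, 'n) species_mor = "('e set, 'e injection, 'x, 'm, 'y, 'n) pstrans"

definition restriction_species :: "('e::infinite, 'x, 'm) species \<Rightarrow> bool" where
  "restriction_species R \<longleftrightarrow> is_psfunctor inj_cat R \<and> (\<forall>A. finite A \<longrightarrow> locally_finite (val R A))"

definition species_morphism ::
  "('e::infinite, 'x, 'm) species \<Rightarrow> ('e, 'y, 'n) species \<Rightarrow> ('e, 'x, 'm, 'y, 'n) species_mor \<Rightarrow> bool"
  where "species_morphism = is_pstrans inj_cat"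

definition restr :: "('e, 'x, 'm) species \<Rightarrow> 'e set \<Rightarrow> 'e set \<Rightarrow> 'x \<Rightarrow> 'x" where
  "restr R A B X = fob (act R (incl B A)) X"

text \<open>Isomorphisms of structures \<open>X \<in> R[A]\<close>, \<open>Y \<in> R[B]\<close>: a bijection \<open>s : A \<rightarrow> B\<close> and an arrow
  \<open>X \<rightarrow> s\<^sup>* Y\<close> of \<open>R[A]\<close>.\<close>

definition str_iso ::
  "('e::infinite, 'x, 'm) species \<Rightarrow> 'e set \<times> 'x \<Rightarrow> 'e set \<times> 'x \<Rightarrow> ('e injection \<times> 'm) set" where
  "str_iso R = (\<lambda>(A, X) (B, Y). {(s, u). s \<in> hom inj_cat A B \<and> bij_betw (fst (snd s)) A B \<and>
     u \<in> hom (val R A) X (fob (act R s) Y)})"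

definition str_ide :: "('e::infinite, 'x, 'm) species \<Rightarrow> 'e set \<times> 'x \<Rightarrow> 'e injection \<times> 'm" where
  "str_ide R = (\<lambda>(A, X). (ide inj_cat A, unitor R A X))"

text \<open>Composite of \<open>(s, u) : (A, X) \<rightarrow> (B, Y)\<close> and \<open>(t, v) : (B, Y) \<rightarrow> (D, Z)\<close>:
  \<open>X \<rightarrow> s\<^sup>* Y \<rightarrow> s\<^sup>* (t\<^sup>* Z) \<rightarrow> (t \<circ> s)\<^sup>* Z\<close>.\<close>

definition str_cmp ::
  "('e::infinite, 'x, 'm) species \<Rightarrow> 'x \<Rightarrow> 'e injection \<times> 'm \<Rightarrow> 'e injection \<times> 'm \<Rightarrow>
   'e injection \<times> 'm" where
  "str_cmp R Z = (\<lambda>(t, v) (s, u). (cmp inj_cat t s,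
     cmp (val R (fst s)) (compositor R s t Z) (cmp (val R (fst s)) (far (act R s) v) u)))"

definition structures ::
  "('e::infinite, 'x, 'm) species \<Rightarrow>
   ('e set \<times> 'x, ('e set \<times> 'x) \<times> ('e injection \<times> 'm) \<times> ('e set \<times> 'x)) cat" where
  "structures R = (let Ob = {(A, X). finite A \<and> X \<in> obj (val R A)} in
     \<lparr>obj = Ob,
      arr = {(x, w, y). x \<in> Ob \<and> y \<in> Ob \<and> w \<in> str_iso R x y},
      src = (\<lambda>(x, w, y). x), tgt = (\<lambda>(x, w, y). y),
      ide = (\<lambda>x. (x, str_ide R x, x)),
      cmp = (\<lambda>(_, w', z) (x, w, _). (x, str_cmp R (snd z) w' w, z))\<rparr>)"


section \<open>Rational vector spaces on a basis\<close>

text \<open>The vector space on a set \<open>B\<close> consists of the finitely supported functions with support in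
  \<open>B\<close>. The tensor product of the spaces on \<open>B\<close> and \<open>D\<close> is the space on \<open>B \<times> D\<close>.\<close>

definition in_span :: "'b set \<Rightarrow> ('b \<Rightarrow>\<^sub>0 rat) \<Rightarrow> bool" where
  "in_span B v \<longleftrightarrow> Poly_Mapping.keys v \<subseteq> B"

definition delta :: "'b \<Rightarrow> ('b \<Rightarrow>\<^sub>0 rat)" where
  "delta b = Poly_Mapping.single b 1"

definition lin_ext :: "('b \<Rightarrow> ('d \<Rightarrow>\<^sub>0 rat)) \<Rightarrow> ('b \<Rightarrow>\<^sub>0 rat) \<Rightarrow> ('d \<Rightarrow>\<^sub>0 rat)" where
  "lin_ext f v = (\<Sum>b\<in>Poly_Mapping.keys v.
     Poly_Mapping.map (\<lambda>q. Poly_Mapping.lookup v b * q) (f b))"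

definition lin_form :: "('b \<Rightarrow> rat) \<Rightarrow> ('b \<Rightarrow>\<^sub>0 rat) \<Rightarrow> rat" where
  "lin_form f v = (\<Sum>b\<in>Poly_Mapping.keys v. Poly_Mapping.lookup v b * f b)"

definition push :: "('b \<Rightarrow> 'd) \<Rightarrow> ('b \<Rightarrow>\<^sub>0 rat) \<Rightarrow> ('d \<Rightarrow>\<^sub>0 rat)" where
  "push g = lin_ext (\<lambda>b. delta (g b))"

record 'b coalg =
  basis :: "'b set"
  comult :: "('b \<Rightarrow>\<^sub>0 rat) \<Rightarrow> ('b \<times> 'b \<Rightarrow>\<^sub>0 rat)"
  counit :: "('b \<Rightarrow>\<^sub>0 rat) \<Rightarrow> rat"

definition coalg_iso_on_bases :: "('b \<Rightarrow> 'd) \<Rightarrow> 'b coalg \<Rightarrow> 'd coalg \<Rightarrow> bool" where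
  "coalg_iso_on_bases \<theta> C D \<longleftrightarrow> bij_betw \<theta> (basis C) (basis D) \<and>
     (\<forall>v. in_span (basis C) v \<longrightarrow>
        comult D (push \<theta> v) = push (map_prod \<theta> \<theta>) (comult C v) \<and>
        counit D (push \<theta> v) = counit C v)"


section \<open>The Schmitt coalgebra\<close>

definition schmitt_delta ::
  "('e::infinite, 'x, 'm) species \<Rightarrow> 'e set \<times> 'x \<Rightarrow>
   (('e set \<times> 'x) set \<times> ('e set \<times> 'x) set \<Rightarrow>\<^sub>0 rat)" where
  "schmitt_delta R = (\<lambda>(A, X). \<Sum>(A1, A2)\<in>{(A1, A2). A1 \<inter> A2 = {} \<and> A1 \<union> A2 = A}.
     delta (cls (structures R) (A1, restr R A A1 X), cls (structures R) (A2, restr R A A2 X)))"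

definition schmitt_epsilon :: "'e set \<times> 'x \<Rightarrow> rat" where
  "schmitt_epsilon = (\<lambda>(A, X). if A = {} then 1 else 0)"

definition schmitt_coalgebra :: "('e::infinite, 'x, 'm) species \<Rightarrow> ('e set \<times> 'x) set coalg" where
  "schmitt_coalgebra R = \<lparr>basis = pi0 (structures R),
     comult = lin_ext (on_class (schmitt_delta R)),
     counit = lin_form (on_class schmitt_epsilon)\<rparr>"

definition schmitt_image ::
  "('e::infinite, 'y, 'n) species \<Rightarrow> ('e, 'x, 'm, 'y, 'n) species_mor \<Rightarrow> 'e set \<times> 'x \<Rightarrow>
   (('e set \<times> 'y) set \<Rightarrow>\<^sub>0 rat)" where
  "schmitt_image R \<phi> = (\<lambda>(A, X). delta (cls (structures R) (A, fob (component \<phi> A) X)))"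

definition schmitt_hom ::
  "('e::infinite, 'y, 'n) species \<Rightarrow> ('e, 'x, 'm, 'y, 'n) species_mor \<Rightarrow>
   (('e set \<times> 'x) set \<Rightarrow>\<^sub>0 rat) \<Rightarrow> (('e set \<times> 'y) set \<Rightarrow>\<^sub>0 rat)" where
  "schmitt_hom R \<phi> = lin_ext (on_class (schmitt_image R \<phi>))"


section \<open>Slices and homotopy cardinality\<close>

text \<open>An object of the slice over \<open>S\<close> is a pair of a groupoid and a functor to \<open>S\<close>.\<close>

type_synonym ('y, 'n, 's, 'k) over = "('y, 'n) cat \<times> ('y, 'n, 's, 'k) fctr"

definition hpullback ::
  "('y, 'n) cat \<Rightarrow> ('y, 'n, 's, 'k) fctr \<Rightarrow> ('s, 'k) cat \<Rightarrow> ('t, 'l, 's, 'k) fctr \<Rightarrow> ('t, 'l) cat \<Rightarrow>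
   ('y \<times> 'k \<times> 't, ('y \<times> 'k \<times> 't) \<times> ('n \<times> 'l) \<times> ('y \<times> 'k \<times> 't)) cat" where
  "hpullback Y f S d T =
     (let Ob = {(y, k, t). y \<in> obj Y \<and> t \<in> obj T \<and> k \<in> hom S (fob f y) (fob d t)} in
     \<lparr>obj = Ob,
      arr = {((y, k, t), (u, v), (y', k', t')). (y, k, t) \<in> Ob \<and> (y', k', t') \<in> Ob \<and>
        u \<in> hom Y y y' \<and> v \<in> hom T t t' \<and> cmp S k' (far f u) = cmp S (far d v) k},
      src = (\<lambda>(x, w, x'). x), tgt = (\<lambda>(x, w, x'). x'),
      ide = (\<lambda>(y, k, t). ((y, k, t), (ide Y y, ide T t), (y, k, t))),
      cmp = (\<lambda>(_, (u', v'), z) (x, (u, v), _). (x, (cmp Y u' u, cmp T v' v), z))\<rparr>)"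

definition hpullback_proj ::
  "('y \<times> 'k \<times> 't, ('y \<times> 'k \<times> 't) \<times> ('n \<times> 'l) \<times> ('y \<times> 'k \<times> 't), 't, 'l) fctr" where
  "hpullback_proj = \<lparr>fob = (\<lambda>(y, k, t). t), far = (\<lambda>(_, (u, v), _). v)\<rparr>"

definition pull_along ::
  "('s, 'k) cat \<Rightarrow> ('t, 'l) cat \<Rightarrow> ('t, 'l, 's, 'k) fctr \<Rightarrow> ('y, 'n, 's, 'k) over \<Rightarrow>
   ('y \<times> 'k \<times> 't, ('y \<times> 'k \<times> 't) \<times> ('n \<times> 'l) \<times> ('y \<times> 'k \<times> 't), 't, 'l) over" where
  "pull_along S T d = (\<lambda>(Y, f). (hpullback Y f S d T, hpullback_proj))"

definition compose_with ::
  "('s, 'k, 't, 'l) fctr \<Rightarrow> ('y, 'n, 's, 'k) over \<Rightarrow> ('y, 'n, 't, 'l) over" where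
  "compose_with q = (\<lambda>(Y, f). (Y, fcomp q f))"

definition point :: "('s, 'k) cat \<Rightarrow> 's \<Rightarrow> (unit, unit, 's, 'k) over" where
  "point S s = (unit_cat, \<lparr>fob = (\<lambda>_. s), far = (\<lambda>_. ide S s)\<rparr>)"

definition hfibre ::
  "('y, 'n) cat \<Rightarrow> ('y, 'n, 's, 'k) fctr \<Rightarrow> ('s, 'k) cat \<Rightarrow> 's \<Rightarrow>
   ('y \<times> 'k \<times> unit, ('y \<times> 'k \<times> unit) \<times> ('n \<times> unit) \<times> ('y \<times> 'k \<times> unit)) cat" where
  "hfibre Y f S s = hpullback Y f S (snd (point S s)) unit_cat"

definition finite_hfibres :: "('y, 'n) cat \<Rightarrow> ('y, 'n, 's, 'k) fctr \<Rightarrow> ('s, 'k) cat \<Rightarrow> bool" where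
  "finite_hfibres Y f S \<longleftrightarrow> (\<forall>s\<in>obj S. finite_groupoid (hfibre Y f S s))"

definition gcard :: "('y, 'n) cat \<Rightarrow> rat" where
  "gcard Y = (\<Sum>c\<in>pi0 Y. on_class (\<lambda>y. 1 / of_nat (card (aut Y y))) c)"

text \<open>The support is finite whenever the total groupoid is finite.\<close>

definition card_over :: "('s, 'k) cat \<Rightarrow> ('y, 'n, 's, 'k) over \<Rightarrow> ('s set \<Rightarrow>\<^sub>0 rat)" where
  "card_over S = (\<lambda>(Y, f). Abs_poly_mapping (\<lambda>c. if c \<in> pi0 S
     then on_class (\<lambda>s. gcard (hfibre Y f S s) / of_nat (card (aut S s))) c else 0))"

text \<open>Cardinality of a functor \<open>\<Phi>\<close> from the slice over \<open>S\<close> to the slice over \<open>U\<close>. It depends only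
  on the values of \<open>\<Phi>\<close> at the points of \<open>S\<close>.\<close>

definition hcard ::
  "('s, 'k) cat \<Rightarrow> ('u, 'l) cat \<Rightarrow> ((unit, unit, 's, 'k) over \<Rightarrow> ('y, 'n, 'u, 'l) over) \<Rightarrow>
   ('s set \<Rightarrow>\<^sub>0 rat) \<Rightarrow> ('u set \<Rightarrow>\<^sub>0 rat)" where
  "hcard S U \<Phi> = lin_ext (on_class (\<lambda>s. card_over U (\<Phi> (point S s))))"


section \<open>Incidence coalgebras\<close>

text \<open>Levels \<open>X\<^sub>n\<close>, face maps \<open>face X n i : X\<^sub>n \<rightarrow> X\<^sub>n\<^sub>-\<^sub>1\<close> and degeneracies
  \<open>degen X n i : X\<^sub>n \<rightarrow> X\<^sub>n\<^sub>+\<^sub>1\<close>. The simplicial identities need only hold up to coherent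
  isomorphism; the coherence data do not enter the incidence coalgebra and are not recorded.\<close>

record ('o, 'm) simplicial_groupoid =
  lev :: "nat \<Rightarrow> ('o, 'm) cat"
  face :: "nat \<Rightarrow> nat \<Rightarrow> ('o, 'm, 'o, 'm) fctr"
  degen :: "nat \<Rightarrow> nat \<Rightarrow> ('o, 'm, 'o, 'm) fctr"

definition incidence_comult ::
  "('o, 'm) simplicial_groupoid \<Rightarrow> ('y, 'n, 'o, 'm) over \<Rightarrow>
   ('y \<times> 'm \<times> 'o, ('y \<times> 'm \<times> 'o) \<times> ('n \<times> 'm) \<times> ('y \<times> 'm \<times> 'o), 'o \<times> 'o, 'm \<times> 'm) over" where
  "incidence_comult X Y =
     compose_with (pair_fctr (face X 2 2) (face X 2 0)) (pull_along (lev X 1) (lev X 2) (face X 2 1) Y)"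

text \<open>The slice over the terminal groupoid is the category of groupoids.\<close>

definition incidence_counit ::
  "('o, 'm) simplicial_groupoid \<Rightarrow> ('y, 'n, 'o, 'm) over \<Rightarrow>
   ('y \<times> 'm \<times> 'o, ('y \<times> 'm \<times> 'o) \<times> ('n \<times> 'm) \<times> ('y \<times> 'm \<times> 'o), unit, unit) over" where
  "incidence_counit X Y = compose_with to_unit (pull_along (lev X 1) (lev X 0) (degen X 0 0) Y)"

text \<open>The cardinality of the comultiplication takes values in the space on \<open>\<pi>\<^sub>0 (X\<^sub>1 \<times> X\<^sub>1)\<close>. The
  class of a pair is the product of the two classes, so \<open>c \<mapsto> (fst ` c, snd ` c)\<close> is the canonical
  bijection to \<open>\<pi>\<^sub>0 X\<^sub>1 \<times> \<pi>\<^sub>0 X\<^sub>1\<close>. Similarly the space on \<open>\<pi>\<^sub>0 1 = {{()}}\<close> is the base field.\<close>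

definition incidence_coalgebra_card :: "('o, 'm) simplicial_groupoid \<Rightarrow> 'o set coalg" where
  "incidence_coalgebra_card X = \<lparr>basis = pi0 (lev X 1),
     comult = (\<lambda>v. push (\<lambda>c. (fst ` c, snd ` c))
       (hcard (lev X 1) (prod_cat (lev X 1) (lev X 1)) (incidence_comult X) v)),
     counit = (\<lambda>v. Poly_Mapping.lookup (hcard (lev X 1) unit_cat (incidence_counit X) v) {()})\<rparr>"

text \<open>The conditions under which the cardinality of the incidence coalgebra is defined.\<close>

definition incidence_finite :: "('o, 'm) simplicial_groupoid \<Rightarrow> bool" where
  "incidence_finite X \<longleftrightarrow>
     (\<forall>n. groupoid (lev X n)) \<and>
     (\<forall>n. \<forall>i\<le>Suc n. is_functor (lev X (Suc n)) (lev X n) (face X (Suc n) i)) \<and>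
     (\<forall>n. \<forall>i\<le>n. is_functor (lev X n) (lev X (Suc n)) (degen X n i)) \<and>
     locally_finite (lev X 1) \<and>
     finite_hfibres (lev X 2) (face X 2 1) (lev X 1) \<and>
     finite_hfibres (lev X 0) (degen X 0 0) (lev X 1)"


section \<open>The decomposition space of a restriction species\<close>

type_synonym ('e, 'x) layered = "'e set \<times> ('e \<Rightarrow> nat) \<times> 'x"

type_synonym ('e, 'x, 'm) layered_iso =
  "('e, 'x) layered \<times> ('e injection \<times> 'm) \<times> ('e, 'x) layered"

definition forget_layers :: "('e, 'x) layered \<Rightarrow> 'e set \<times> 'x" where
  "forget_layers = (\<lambda>(A, p, X). (A, X))"

definition layered_structures ::
  "('e::infinite, 'x, 'm) species \<Rightarrow> nat \<Rightarrow> (('e, 'x) layered, ('e, 'x, 'm) layered_iso) cat" where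
  "layered_structures R n =
     (let Ob = {(A, p, X). finite A \<and> p \<in> A \<rightarrow>\<^sub>E {1..n} \<and> X \<in> obj (val R A)} in
     \<lparr>obj = Ob,
      arr = {((A, p, X), (s, u), (B, q, Y)). (A, p, X) \<in> Ob \<and> (B, q, Y) \<in> Ob \<and>
        (s, u) \<in> str_iso R (A, X) (B, Y) \<and> (\<forall>a\<in>A. q (fst (snd s) a) = p a)},
      src = (\<lambda>(x, w, y). x), tgt = (\<lambda>(x, w, y). y),
      ide = (\<lambda>x. (x, str_ide R (forget_layers x), x)),
      cmp = (\<lambda>(_, w', z) (x, w, _). (x, str_cmp R (snd (snd z)) w' w, z))\<rparr>)"

text \<open>Restriction of an isomorphism \<open>(s, u) : (A, X) \<rightarrow> (A', X')\<close> to \<open>B \<subseteq> A\<close> and \<open>B' = s ` B\<close>. With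
  inclusions \<open>i : B \<rightarrow> A\<close>, \<open>i' : B' \<rightarrow> A'\<close> and \<open>t : B \<rightarrow> B'\<close> induced by \<open>s\<close>, it is
  \<open>i\<^sup>* X \<rightarrow> i\<^sup>* (s\<^sup>* X') \<rightarrow> (s \<circ> i)\<^sup>* X' = (i' \<circ> t)\<^sup>* X' \<rightarrow> t\<^sup>* (i'\<^sup>* X')\<close>.\<close>

definition restr_iso ::
  "('e::infinite, 'x, 'm) species \<Rightarrow> 'e set \<Rightarrow> 'e set \<Rightarrow> 'x \<Rightarrow> 'e injection \<times> 'm \<Rightarrow> 'e injection \<times> 'm"
  where
  "restr_iso R B B' X' = (\<lambda>((A, s, A'), u).
     let t = (B, restrict s B, B'); i = incl B A; i' = incl B' A' in
     (t, cmp (val R B) (inv_arr (val R B) (compositor R t i' X'))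
           (cmp (val R B) (compositor R i (A, s, A') X') (far (act R i) u))))"

definition kept :: "nat \<Rightarrow> nat \<Rightarrow> 'e set \<Rightarrow> ('e \<Rightarrow> nat) \<Rightarrow> 'e set" where
  "kept n i A p = {a \<in> A. \<not> (i = 0 \<and> p a = 1) \<and> \<not> (i = n \<and> p a = n)}"

text \<open>Renumbering of layers: for \<open>0 < i < n\<close> it joins layers \<open>i\<close> and \<open>i + 1\<close>; for \<open>i = 0\<close> and
  \<open>i = n\<close> it is applied after deletion of the first, resp. last, layer.\<close>

definition face_ob ::
  "('e, 'x, 'm) species \<Rightarrow> nat \<Rightarrow> nat \<Rightarrow> ('e, 'x) layered \<Rightarrow> ('e, 'x) layered" where
  "face_ob R n i = (\<lambda>(A, p, X). let B = kept n i A p in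
     (B, \<lambda>a\<in>B. if p a \<le> i then p a else p a - 1, if 0 < i \<and> i < n then X else restr R A B X))"

definition face_ar ::
  "('e::infinite, 'x, 'm) species \<Rightarrow> nat \<Rightarrow> nat \<Rightarrow> ('e, 'x, 'm) layered_iso \<Rightarrow>
   ('e, 'x, 'm) layered_iso" where
  "face_ar R n i = (\<lambda>((A, p, X), w, (A', p', X')).
     (face_ob R n i (A, p, X),
      if 0 < i \<and> i < n then w else restr_iso R (kept n i A p) (kept n i A' p') X' w,
      face_ob R n i (A', p', X')))"

text \<open>The empty layer inserted by the degeneracy is layer \<open>i + 1\<close>.\<close>

definition degen_ob :: "nat \<Rightarrow> ('e, 'x) layered \<Rightarrow> ('e, 'x) layered" where
  "degen_ob i = (\<lambda>(A, p, X). (A, \<lambda>a\<in>A. if p a \<le> i then p a else p a + 1, X))"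

definition decomp ::
  "('e::infinite, 'x, 'm) species \<Rightarrow> (('e, 'x) layered, ('e, 'x, 'm) layered_iso) simplicial_groupoid"
  where
  "decomp R = \<lparr>lev = layered_structures R,
     face = (\<lambda>n i. \<lparr>fob = face_ob R n i, far = face_ar R n i\<rparr>),
     degen = (\<lambda>n i. \<lparr>fob = degen_ob i, far = (\<lambda>(x, w, y). (degen_ob i x, w, degen_ob i y))\<rparr>)\<rparr>"

definition layered_map_ob ::
  "('e, 'x, 'm, 'y, 'n) species_mor \<Rightarrow> ('e, 'x) layered \<Rightarrow> ('e, 'y) layered" where
  "layered_map_ob \<phi> = (\<lambda>(A, p, X). (A, p, fob (component \<phi> A) X))"

text \<open>The component in degree \<open>n\<close> of the simplicial map induced by \<open>\<phi> : R' \<Rightarrow> R\<close>. An isomorphism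
  \<open>(s, u)\<close> goes to \<open>\<phi> X \<rightarrow> \<phi> (s\<^sup>* Y) \<rightarrow> s\<^sup>* (\<phi> Y)\<close> over \<open>s\<close>. The formula does not depend on \<open>n\<close>.\<close>

definition decomp_map ::
  "('e, 'y, 'n) species \<Rightarrow> ('e, 'x, 'm, 'y, 'n) species_mor \<Rightarrow> nat \<Rightarrow>
   (('e, 'x) layered, ('e, 'x, 'm) layered_iso, ('e, 'y) layered, ('e, 'y, 'n) layered_iso) fctr" where
  "decomp_map R \<phi> n = \<lparr>fob = layered_map_ob \<phi>,
     far = (\<lambda>((A, p, X), (s, u), (B, q, Y)).
       (layered_map_ob \<phi> (A, p, X),
        (s, cmp (val R A) (square \<phi> s Y) (far (component \<phi> A) u)),
        layered_map_ob \<phi> (B, q, Y)))\<rparr>"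

text \<open>The bijection from isomorphism classes of structures to \<open>\<pi>\<^sub>0 R\<^sub>1\<close> given by the unique layering
  in one layer.\<close>

definition one_layer :: "('e set \<times> 'x) set \<Rightarrow> ('e, 'x) layered set" where
  "one_layer c = (\<lambda>(A, X). (A, \<lambda>a\<in>A. 1, X)) ` c"

end

theory Submission
  imports Defs
begin

text \<open>Every arrow \<open>s \<rightarrow> d\<^sub>1 t\<close> of \<open>\<^bold>R\<^sub>1\<close> lifts uniquely along \<open>d\<^sub>1 : \<^bold>R\<^sub>2 \<rightarrow> \<^bold>R\<^sub>1\<close>, because a layering of the
  target is transported back along the underlying bijection. Hence the pullback of a point \<open>(A, X)\<close>
  along \<open>d\<^sub>1\<close> is equivalent to the finite set of splittings \<open>A\<^sub>1 + A\<^sub>2 = A\<close>, without automorphisms, so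
  that all symmetry factors cancel and its cardinality over \<open>\<^bold>R\<^sub>1 \<times> \<^bold>R\<^sub>1\<close> is the sum of the
  \<open>\<delta>\<close> of the classes of \<open>(X|A\<^sub>1, X|A\<^sub>2)\<close>. The counit is treated in the same way with \<open>s\<^sub>0\<close>, where the
  pullback is a point if \<open>A = {}\<close> and empty otherwise. Functoriality of the outer faces reduces to the
  category of elements of \<open>R\<close> over all injections: there every arrow is monic and cartesian, and the
  restriction of an isomorphism is its unique lift along an inclusion.\<close>


section \<open>Groupoids\<close>

text \<open>Two difficulties shape the development. First, \<open>R\<close> is only a
  pseudo-functor: a restricted isomorphism is a composite involving compositors and the inverse of a
  compositor, and checking directly that restriction preserves composition would mean a coherence
  computation at the outer faces. The coherence laws of \<open>R\<close> are instead spent once, on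
  associativity and units in the category of elements (the Grothendieck construction); identities
  between restricted isomorphisms are then proved by composing with a restriction arrow and
  cancelling it. Second, cardinalities over a base are homotopy fibres divided by automorphism
  groups. If \<open>Y\<close> is equivalent to a set \<open>I\<close>, the fibre of
  \<open>f : Y \<rightarrow> U\<close> over \<open>s\<close> is again a set, that of all arrows
  \<open>f (r i) \<rightarrow> s\<close>. Each index contributes \<open>card (aut U s)\<close> or
  nothing, and the division leaves an indicator. Comultiplication, counit and the map induced by a
  morphism are instances of this one count. The rest is invariance under isomorphism, since all
  operations are functions on classes evaluated at representatives.\<close>

lemma hom_arr: "f \<in> hom C x y \<Longrightarrow> f \<in> arr C"
  by (simp add: hom_def)

lemma (in category) hom_obj:
  assumes "f \<in> hom C x y"
  shows "x \<in> obj C" "y \<in> obj C"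
  using assms src_obj tgt_obj by (auto simp: hom_def)

context groupoid
begin

text \<open>\<open>inv_arr\<close> is a definite description, so uniqueness comes first: any other
  inverse \<open>h\<close> satisfies \<open>h = (g f) h = g (f h) = g\<close>.\<close>

lemma inv_arr:
  assumes f: "f \<in> hom C x y"
  shows "inv_arr C f \<in> hom C y x" "cmp C (inv_arr C f) f = ide C x"
    "cmp C f (inv_arr C f) = ide C y"
proof -
  have st: "src C f = x" "tgt C f = y"
    using f by (auto simp: hom_def)
  obtain g where g: "inverse_in C f g"
    using has_inverse f hom_arr by metis
  have "h = g" if h: "inverse_in C f h" for h
  proof -
    have gy: "g \<in> hom C y x" and hy: "h \<in> hom C y x"
      using g h st by (auto simp: inverse_in_def)
    have "h = cmp C (cmp C g f) h"
      using g st ide_cmp[OF hy] by (simp add: inverse_in_def)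
    also have "\<dots> = cmp C g (cmp C f h)"
      using cmp_assoc[OF hy f gy] by simp
    also have "\<dots> = g"
      using h st cmp_ide[OF gy] by (simp add: inverse_in_def)
    finally show ?thesis .
  qed
  with g have "inverse_in C f (inv_arr C f)"
    unfolding inv_arr_def by (metis theI)
  then show "inv_arr C f \<in> hom C y x" "cmp C (inv_arr C f) f = ide C x"
    "cmp C f (inv_arr C f) = ide C y"
    using st by (auto simp: inverse_in_def)
qed

text \<open>Equations in a groupoid can be solved for a factor. In this form lifts along arrows
  become explicit formulas together with their uniqueness.\<close>

lemma cmp_eq_iff:
  assumes f: "f \<in> hom C y z" and g: "g \<in> hom C x y" and h: "h \<in> hom C x z"
  shows "cmp C f g = h \<longleftrightarrow> g = cmp C (inv_arr C f) h"
proof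
  assume "cmp C f g = h"
  then have "cmp C (inv_arr C f) h = cmp C (cmp C (inv_arr C f) f) g"
    using cmp_assoc[OF g f inv_arr(1)[OF f]] by simp
  then show "g = cmp C (inv_arr C f) h"
    using inv_arr(2)[OF f] ide_cmp[OF g] by simp
next
  assume "g = cmp C (inv_arr C f) h"
  then have "cmp C f g = cmp C (cmp C f (inv_arr C f)) h"
    using cmp_assoc[OF h inv_arr(1)[OF f] f] by simp
  then show "cmp C f g = h"
    using inv_arr(3)[OF f] ide_cmp[OF h] by simp
qed

lemma cmp_left_cancel:
  assumes "f \<in> hom C y z" "g \<in> hom C x y" "h \<in> hom C x y" "cmp C f g = cmp C f h"
  shows "g = h"
  using assms cmp_eq_iff[OF assms(1,2)] cmp_eq_iff[OF assms(1,3)] cmp_hom by metis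

lemma cmp_right_cancel:
  assumes f: "f \<in> hom C x y" and g: "g \<in> hom C y z" and h: "h \<in> hom C y z"
    and eq: "cmp C g f = cmp C h f"
  shows "g = h"
proof -
  have "cmp C k (cmp C f (inv_arr C f)) = cmp C (cmp C k f) (inv_arr C f)" if "k \<in> hom C y z" for k
    using cmp_assoc[OF inv_arr(1)[OF f] f that] .
  then show ?thesis
    using eq g h cmp_ide inv_arr(3)[OF f] by metis
qed

lemma bij_betw_cmp_left:
  assumes f: "f \<in> hom C y z"
  shows "bij_betw (cmp C f) (hom C x y) (hom C x z)"
proof (rule bij_betwI[where g = "cmp C (inv_arr C f)"])
  show "cmp C f \<in> hom C x y \<rightarrow> hom C x z"
    "cmp C (inv_arr C f) \<in> hom C x z \<rightarrow> hom C x y"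
    using cmp_hom f inv_arr(1)[OF f] by auto
  show "cmp C (inv_arr C f) (cmp C f g) = g" if "g \<in> hom C x y" for g
    using cmp_eq_iff[OF f that cmp_hom[OF that f]] by simp
  show "cmp C f (cmp C (inv_arr C f) h) = h" if "h \<in> hom C x z" for h
    using cmp_eq_iff[OF f cmp_hom[OF that inv_arr(1)[OF f]] that] by simp
qed

text \<open>A nonempty hom set is a torsor under the automorphisms of its target. This is the count
  that cancels the denominator of \<open>card_over\<close>.\<close>

lemma card_hom:
  assumes "hom C x y \<noteq> {}"
  shows "card (hom C x y) = card (aut C y)"
proof -
  obtain f where f: "f \<in> hom C x y"
    using assms by auto
  have "bij_betw (\<lambda>g. cmp C g (inv_arr C f)) (hom C x y) (hom C y y)"
  proof (rule bij_betwI[where g = "\<lambda>g. cmp C g f"])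
    show "(\<lambda>g. cmp C g (inv_arr C f)) \<in> hom C x y \<rightarrow> hom C y y"
      "(\<lambda>g. cmp C g f) \<in> hom C y y \<rightarrow> hom C x y"
      using cmp_hom f inv_arr(1)[OF f] by auto
    show "cmp C (cmp C g (inv_arr C f)) f = g" if "g \<in> hom C x y" for g
      using cmp_assoc[OF f inv_arr(1)[OF f] that] inv_arr(2)[OF f] cmp_ide[OF that] by simp
    show "cmp C (cmp C g f) (inv_arr C f) = g" if "g \<in> hom C y y" for g
      using cmp_assoc[OF inv_arr(1)[OF f] f that] inv_arr(3)[OF f] cmp_ide[OF that] by simp
  qed
  then show ?thesis
    unfolding aut_def by (rule bij_betw_same_card)
qed

lemma finite_hom:
  assumes "finite (aut C x)"
  shows "finite (hom C x y)"
proof (cases "hom C x y = {}")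
  case False
  then obtain f where "f \<in> hom C x y"
    by auto
  from bij_betw_cmp_left[OF this, of x] show ?thesis
    using assms bij_betw_finite unfolding aut_def by blast
qed simp

lemma iso_rel_equiv: "equiv (obj C) (iso_rel C)"
proof (rule equivI)
  show "iso_rel C \<subseteq> obj C \<times> obj C"
    by (auto simp: iso_rel_def)
  show "refl_on (obj C) (iso_rel C)"
    using ide_hom by (auto simp: refl_on_def iso_rel_def)
  show "sym (iso_rel C)"
  proof (rule symI)
    fix x y assume xy: "(x, y) \<in> iso_rel C"
    then obtain f where "f \<in> hom C x y"
      by (auto simp: iso_rel_def)
    from inv_arr(1)[OF this] show "(y, x) \<in> iso_rel C"
      using xy by (auto simp: iso_rel_def)
  qed
  show "trans (iso_rel C)"
  proof (rule transI)
    fix x y z assume xyz: "(x, y) \<in> iso_rel C" "(y, z) \<in> iso_rel C"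
    then obtain f g where "f \<in> hom C x y" "g \<in> hom C y z"
      by (auto simp: iso_rel_def)
    from cmp_hom[OF this] show "(x, z) \<in> iso_rel C"
      using xyz by (auto simp: iso_rel_def)
  qed
qed

lemma cls_eq_iff: "x \<in> obj C \<Longrightarrow> y \<in> obj C \<Longrightarrow> cls C x = cls C y \<longleftrightarrow> hom C x y \<noteq> {}"
  unfolding cls_def using eq_equiv_class_iff[OF iso_rel_equiv] by (auto simp: iso_rel_def)

lemma mem_cls_iff: "x \<in> obj C \<Longrightarrow> y \<in> cls C x \<longleftrightarrow> y \<in> obj C \<and> hom C x y \<noteq> {}"
  by (auto simp: cls_def iso_rel_def)

lemma self_mem_cls: "x \<in> obj C \<Longrightarrow> x \<in> cls C x"
  using ide_hom by (auto simp: mem_cls_iff)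

text \<open>\<open>on_class\<close> is \<open>the_elem\<close> of an image, hence meaningful only if
  that image is a singleton; constancy on the class of \<open>x\<close> gives this.\<close>

lemma on_class_cls:
  assumes "x \<in> obj C" "\<And>y. y \<in> obj C \<Longrightarrow> hom C x y \<noteq> {} \<Longrightarrow> f y = f x"
  shows "on_class f (cls C x) = f x"
proof -
  have "f ` cls C x = {f x}"
  proof (rule equalityI)
    show "f ` cls C x \<subseteq> {f x}"
      using assms(2) mem_cls_iff[OF assms(1)] by blast
    show "{f x} \<subseteq> f ` cls C x"
      using self_mem_cls[OF assms(1)] by blast
  qed
  then show ?thesis
    by (simp add: on_class_def)
qed

lemma on_class_respects:
  assumes "f respects iso_rel C" "x \<in> obj C"
  shows "on_class f (cls C x) = f x"
  using assms(2)
proof (rule on_class_cls)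
  fix y assume "y \<in> obj C" "hom C x y \<noteq> {}"
  then have "(x, y) \<in> iso_rel C"
    using assms(2) by (simp add: iso_rel_def)
  then show "f y = f x"
    using congruentD[OF assms(1)] by metis
qed

end

lemma pi0_cls: "pi0 G = cls G ` obj G"
  by (auto simp: pi0_def cls_def quotient_def)

section \<open>Functors, products and the terminal groupoid\<close>

lemma functor_ob: "is_functor C D F \<Longrightarrow> x \<in> obj C \<Longrightarrow> fob F x \<in> obj D"
  and functor_ide: "is_functor C D F \<Longrightarrow> x \<in> obj C \<Longrightarrow> far F (ide C x) = ide D (fob F x)"
  and functor_hom: "is_functor C D F \<Longrightarrow> f \<in> hom C x y \<Longrightarrow> far F f \<in> hom D (fob F x) (fob F y)"
  and functor_cmp: "is_functor C D F \<Longrightarrow> f \<in> hom C x y \<Longrightarrow> g \<in> hom C y z \<Longrightarrow>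
    far F (cmp C g f) = cmp D (far F g) (far F f)"
  unfolding is_functor_def by blast+

lemma hom_prod_cat: "hom (prod_cat C D) x y = hom C (fst x) (fst y) \<times> hom D (snd x) (snd y)"
  by (auto simp: hom_def prod_cat_def)

lemma functor_fcomp:
  assumes F: "is_functor C D F" and G: "is_functor D E G"
  shows "is_functor C E (fcomp G F)"
  unfolding is_functor_def[of C E]
proof (intro conjI ballI allI)
  fix x assume x: "x \<in> obj C"
  show "fob (fcomp G F) x \<in> obj E"
    using functor_ob[OF G functor_ob[OF F x]] by (simp add: fcomp_def)
  show "far (fcomp G F) (ide C x) = ide E (fob (fcomp G F) x)"
    using functor_ide[OF F x] functor_ide[OF G functor_ob[OF F x]] by (simp add: fcomp_def)
next
  fix x y f assume f: "f \<in> hom C x y"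
  show "far (fcomp G F) f \<in> hom E (fob (fcomp G F) x) (fob (fcomp G F) y)"
    using functor_hom[OF G functor_hom[OF F f]] by (simp add: fcomp_def)
  fix z g assume g: "g \<in> hom C y z"
  show "far (fcomp G F) (cmp C g f) = cmp E (far (fcomp G F) g) (far (fcomp G F) f)"
    using functor_cmp[OF F f g] functor_cmp[OF G functor_hom[OF F f] functor_hom[OF F g]]
    by (simp add: fcomp_def)
qed

lemma functor_pair:
  assumes F: "is_functor C D F" and G: "is_functor C E G"
  shows "is_functor C (prod_cat D E) (pair_fctr F G)"
  unfolding is_functor_def[of C "prod_cat D E"]
proof (intro conjI ballI allI)
  fix x assume x: "x \<in> obj C"
  show "fob (pair_fctr F G) x \<in> obj (prod_cat D E)"
    using functor_ob[OF F x] functor_ob[OF G x] by (simp add: pair_fctr_def prod_cat_def)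
  show "far (pair_fctr F G) (ide C x) = ide (prod_cat D E) (fob (pair_fctr F G) x)"
    using functor_ide[OF F x] functor_ide[OF G x] by (simp add: pair_fctr_def prod_cat_def)
next
  fix x y f assume f: "f \<in> hom C x y"
  show "far (pair_fctr F G) f \<in> hom (prod_cat D E) (fob (pair_fctr F G) x) (fob (pair_fctr F G) y)"
    using functor_hom[OF F f] functor_hom[OF G f] by (simp add: pair_fctr_def hom_prod_cat)
  fix z g assume g: "g \<in> hom C y z"
  show "far (pair_fctr F G) (cmp C g f) =
    cmp (prod_cat D E) (far (pair_fctr F G) g) (far (pair_fctr F G) f)"
    using functor_cmp[OF F f g] functor_cmp[OF G f g] by (simp add: pair_fctr_def prod_cat_def)
qed

lemma hom_unit_cat: "hom unit_cat x y = {()}"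
  by (auto simp: hom_def unit_cat_def)

lemma groupoid_unit_cat: "groupoid unit_cat"
  by unfold_locales (auto simp: hom_def unit_cat_def inverse_in_def)

lemma functor_to_unit: "is_functor C unit_cat to_unit"
  by (auto simp: is_functor_def to_unit_def unit_cat_def hom_def)

lemma functor_point:
  assumes "groupoid S" "s \<in> obj S"
  shows "is_functor unit_cat S (snd (point S s))"
proof -
  interpret groupoid S by fact
  show ?thesis
    using assms(2) ide_hom cmp_ide[OF ide_hom]
    by (auto simp: is_functor_def point_def unit_cat_def)
qed

lemma groupoid_prod_cat:
  assumes "groupoid C" "groupoid D"
  shows "groupoid (prod_cat C D)"
proof -
  interpret C: groupoid C by fact
  interpret D: groupoid D by fact
  have hom_iff: "f \<in> hom (prod_cat C D) x y \<longleftrightarrow> fst f \<in> hom C (fst x) (fst y) \<and> snd f \<in> hom D (snd x) (snd y)"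
    for f x y by (cases f) (simp add: hom_prod_cat)
  have cmp: "cmp (prod_cat C D) g f = (cmp C (fst g) (fst f), cmp D (snd g) (snd f))" for f g
    by (simp add: prod_cat_def split: prod.split)
  have ide: "ide (prod_cat C D) x = (ide C (fst x), ide D (snd x))" for x
    by (cases x) (simp add: prod_cat_def)
  have obj: "x \<in> obj (prod_cat C D) \<longleftrightarrow> fst x \<in> obj C \<and> snd x \<in> obj D" for x
    by (cases x) (simp add: prod_cat_def)
  show ?thesis
  proof unfold_locales
    fix f assume "f \<in> arr (prod_cat C D)"
    then have f: "fst f \<in> hom C (src C (fst f)) (tgt C (fst f))"
      "snd f \<in> hom D (src D (snd f)) (tgt D (snd f))"
      by (auto simp: prod_cat_def hom_def)
    have st: "src (prod_cat C D) f = (src C (fst f), src D (snd f))"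
      "tgt (prod_cat C D) f = (tgt C (fst f), tgt D (snd f))"
      by (auto simp: prod_cat_def map_prod_def split: prod.split)
    show "src (prod_cat C D) f \<in> obj (prod_cat C D)" "tgt (prod_cat C D) f \<in> obj (prod_cat C D)"
      using C.hom_obj[OF f(1)] D.hom_obj[OF f(2)] by (auto simp: obj st)
    have "inverse_in (prod_cat C D) f (inv_arr C (fst f), inv_arr D (snd f))"
      using C.inv_arr[OF f(1)] D.inv_arr[OF f(2)]
      by (auto simp: inverse_in_def st hom_prod_cat cmp ide)
    then show "\<exists>g. inverse_in (prod_cat C D) f g" ..
  next
    fix x y z w f g h
    assume "f \<in> hom (prod_cat C D) x y" "g \<in> hom (prod_cat C D) y z" "h \<in> hom (prod_cat C D) z w"
    then show "cmp (prod_cat C D) h (cmp (prod_cat C D) g f) =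
      cmp (prod_cat C D) (cmp (prod_cat C D) h g) f"
      unfolding hom_iff cmp by (auto intro: C.cmp_assoc D.cmp_assoc)
  qed (auto simp: hom_iff cmp ide obj C.ide_hom D.ide_hom C.cmp_ide D.cmp_ide C.ide_cmp D.ide_cmp
      intro: C.cmp_hom D.cmp_hom)
qed

text \<open>Isomorphism in a product is componentwise, so classes of pairs are rectangles. This is
  what allows \<open>incidence_coalgebra_card\<close> to recover the two tensor factors by
  projection.\<close>

lemma cls_prod_cat: "x \<in> obj C \<Longrightarrow> y \<in> obj D \<Longrightarrow> cls (prod_cat C D) (x, y) = cls C x \<times> cls D y"
  by (auto simp: cls_def iso_rel_def hom_prod_cat) (auto simp: prod_cat_def)

lemma locally_finite_prod_cat:
  "locally_finite C \<Longrightarrow> locally_finite D \<Longrightarrow> locally_finite (prod_cat C D)"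
  by (auto simp: locally_finite_def aut_def hom_prod_cat) (auto simp: prod_cat_def)

text \<open>The common shape of the categories of structures, of layered structures and of homotopy
  pullbacks: arrows are triples of source, label and target.\<close>

definition labelled_cat ::
  "'o set \<Rightarrow> ('o \<Rightarrow> 'o \<Rightarrow> 'w set) \<Rightarrow> ('o \<Rightarrow> 'w) \<Rightarrow> ('o \<Rightarrow> 'w \<Rightarrow> 'w \<Rightarrow> 'w) \<Rightarrow> ('o, 'o \<times> 'w \<times> 'o) cat"
  where
  "labelled_cat Ob H I K = \<lparr>obj = Ob, arr = {(x, w, y). x \<in> Ob \<and> y \<in> Ob \<and> w \<in> H x y},
     src = (\<lambda>(x, w, y). x), tgt = (\<lambda>(x, w, y). y), ide = (\<lambda>x. (x, I x, x)),
     cmp = (\<lambda>(_, w', z) (x, w, _). (x, K z w' w, z))\<rparr>"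

lemma hom_labelled_cat:
  "f \<in> hom (labelled_cat Ob H I K) x y \<longleftrightarrow> (\<exists>w\<in>H x y. f = (x, w, y)) \<and> x \<in> Ob \<and> y \<in> Ob"
  by (auto simp: hom_def labelled_cat_def)

lemma labelled_cat_simps:
  "obj (labelled_cat Ob H I K) = Ob"
  "ide (labelled_cat Ob H I K) x = (x, I x, x)"
  "cmp (labelled_cat Ob H I K) (y', w', z) (x, w, y) = (x, K z w' w, z)"
  by (simp_all add: labelled_cat_def)

text \<open>Endpoints are stored in the arrow, so only labels have to be checked. \<open>K\<close>
  receives just the final object of a composite, because that is the only structure to which the
  compositor in \<open>str_cmp\<close> is applied.\<close>

lemma groupoid_labelled_cat:
  assumes ide: "\<And>x. x \<in> Ob \<Longrightarrow> I x \<in> H x x"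
    and cmp: "\<And>x y z u v. x \<in> Ob \<Longrightarrow> y \<in> Ob \<Longrightarrow> z \<in> Ob \<Longrightarrow> u \<in> H x y \<Longrightarrow> v \<in> H y z \<Longrightarrow> K z v u \<in> H x z"
    and unit: "\<And>x y u. x \<in> Ob \<Longrightarrow> y \<in> Ob \<Longrightarrow> u \<in> H x y \<Longrightarrow> K y u (I x) = u \<and> K y (I y) u = u"
    and assoc: "\<And>x y z t u v w. x \<in> Ob \<Longrightarrow> y \<in> Ob \<Longrightarrow> z \<in> Ob \<Longrightarrow> t \<in> Ob \<Longrightarrow>
      u \<in> H x y \<Longrightarrow> v \<in> H y z \<Longrightarrow> w \<in> H z t \<Longrightarrow> K t w (K z v u) = K t (K t w v) u"
    and inv: "\<And>x y u. x \<in> Ob \<Longrightarrow> y \<in> Ob \<Longrightarrow> u \<in> H x y \<Longrightarrow>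
      \<exists>v\<in>H y x. K x v u = I x \<and> K y u v = I y"
  shows "groupoid (labelled_cat Ob H I K)"
proof unfold_locales
  fix f assume "f \<in> arr (labelled_cat Ob H I K)"
  then obtain x y u where f: "f = (x, u, y)" "x \<in> Ob" "y \<in> Ob" "u \<in> H x y"
    by (auto simp: labelled_cat_def)
  then show "src (labelled_cat Ob H I K) f \<in> obj (labelled_cat Ob H I K)"
    "tgt (labelled_cat Ob H I K) f \<in> obj (labelled_cat Ob H I K)"
    by (auto simp: labelled_cat_def)
  obtain v where "v \<in> H y x" "K x v u = I x" "K y u v = I y"
    using inv f by blast
  then have "inverse_in (labelled_cat Ob H I K) f (y, v, x)"
    using f by (auto simp: inverse_in_def hom_labelled_cat) (auto simp: labelled_cat_def)
  then show "\<exists>g. inverse_in (labelled_cat Ob H I K) f g" ..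
next
  fix f g h x y z w
  assume "f \<in> hom (labelled_cat Ob H I K) x y" "g \<in> hom (labelled_cat Ob H I K) y z"
    "h \<in> hom (labelled_cat Ob H I K) z w"
  then show "cmp (labelled_cat Ob H I K) h (cmp (labelled_cat Ob H I K) g f) =
    cmp (labelled_cat Ob H I K) (cmp (labelled_cat Ob H I K) h g) f"
    by (auto simp: hom_labelled_cat labelled_cat_simps assoc)
qed (auto simp: hom_labelled_cat labelled_cat_simps ide unit intro: cmp)

text \<open>\<open>far F\<close> is described only on labels that lie in a hom set, hence the
  memberships bundled into the assumptions \<open>ide\<close> and \<open>cmp\<close>.\<close>

lemma functor_labelled_cat:
  assumes ob: "\<And>x. x \<in> Ob \<Longrightarrow> fob F x \<in> Ob'"
    and ar: "\<And>x u y. x \<in> Ob \<Longrightarrow> y \<in> Ob \<Longrightarrow> u \<in> H x y \<Longrightarrow> far F (x, u, y) = (fob F x, g x u y, fob F y)"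
    and hom: "\<And>x u y. x \<in> Ob \<Longrightarrow> y \<in> Ob \<Longrightarrow> u \<in> H x y \<Longrightarrow> g x u y \<in> H' (fob F x) (fob F y)"
    and ide: "\<And>x. x \<in> Ob \<Longrightarrow> I x \<in> H x x \<and> g x (I x) x = I' (fob F x)"
    and cmp: "\<And>x y z u v. x \<in> Ob \<Longrightarrow> y \<in> Ob \<Longrightarrow> z \<in> Ob \<Longrightarrow> u \<in> H x y \<Longrightarrow> v \<in> H y z \<Longrightarrow>
      K z v u \<in> H x z \<and> g x (K z v u) z = K' (fob F z) (g y v z) (g x u y)"
  shows "is_functor (labelled_cat Ob H I K) (labelled_cat Ob' H' I' K') F"
  unfolding is_functor_def
  by (auto simp: hom_labelled_cat labelled_cat_simps ob ar hom ide cmp)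


section \<open>Homotopy pullbacks\<close>

lemma hpullback_labelled_cat:
  "hpullback Y f S d T = labelled_cat
     {(y, k, t). y \<in> obj Y \<and> t \<in> obj T \<and> k \<in> hom S (fob f y) (fob d t)}
     (\<lambda>(y, k, t) (y', k', t'). {(u, v). u \<in> hom Y y y' \<and> v \<in> hom T t t' \<and>
        cmp S k' (far f u) = cmp S (far d v) k})
     (\<lambda>(y, k, t). (ide Y y, ide T t)) (\<lambda>_ (u', v') (u, v). (cmp Y u' u, cmp T v' v))"
  unfolding hpullback_def labelled_cat_def Let_def
  by (auto simp: fun_eq_iff)

lemma hom_hpullback:
  "g \<in> hom (hpullback Y f S d T) (y, k, t) (y', k', t') \<longleftrightarrow>
     (\<exists>u\<in>hom Y y y'. \<exists>v\<in>hom T t t'. g = ((y, k, t), (u, v), (y', k', t')) \<and>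
        cmp S k' (far f u) = cmp S (far d v) k) \<and>
     y \<in> obj Y \<and> t \<in> obj T \<and> k \<in> hom S (fob f y) (fob d t) \<and>
     y' \<in> obj Y \<and> t' \<in> obj T \<and> k' \<in> hom S (fob f y') (fob d t')"
  by (auto simp: hpullback_labelled_cat hom_labelled_cat)

lemma obj_hpullback:
  "(y, k, t) \<in> obj (hpullback Y f S d T) \<longleftrightarrow>
     y \<in> obj Y \<and> t \<in> obj T \<and> k \<in> hom S (fob f y) (fob d t)"
  by (auto simp: hpullback_labelled_cat labelled_cat_simps)

text \<open>An arrow is a pair of arrows over a commuting square in \<open>S\<close>. Composition
  pastes such squares and inversion reverses them; everything else is componentwise.\<close>

lemma groupoid_hpullback:
  assumes "groupoid Y" "groupoid S" "groupoid T" and f: "is_functor Y S f" and d: "is_functor T S d"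
  shows "groupoid (hpullback Y f S d T)"
proof -
  interpret Y: groupoid Y by fact
  interpret S: groupoid S by fact
  interpret T: groupoid T by fact
  have paste: "cmp S k3 (far f (cmp Y u' u)) = cmp S (far d (cmp T v' v)) k1"
    if u: "u \<in> hom Y y1 y2" "u' \<in> hom Y y2 y3" and v: "v \<in> hom T t1 t2" "v' \<in> hom T t2 t3"
      and k: "k1 \<in> hom S (fob f y1) (fob d t1)" "k2 \<in> hom S (fob f y2) (fob d t2)"
        "k3 \<in> hom S (fob f y3) (fob d t3)"
      and eq: "cmp S k2 (far f u) = cmp S (far d v) k1" "cmp S k3 (far f u') = cmp S (far d v') k2"
    for u u' v v' k1 k2 k3 y1 y2 y3 t1 t2 t3
  proof -
    note fu = functor_hom[OF f u(1)] functor_hom[OF f u(2)]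
    note dv = functor_hom[OF d v(1)] functor_hom[OF d v(2)]
    have "cmp S k3 (far f (cmp Y u' u)) = cmp S (cmp S k3 (far f u')) (far f u)"
      using functor_cmp[OF f u] S.cmp_assoc[OF fu k(3)] by simp
    also have "\<dots> = cmp S (far d v') (cmp S k2 (far f u))"
      using eq(2) S.cmp_assoc[OF fu(1) k(2) dv(2)] by simp
    also have "\<dots> = cmp S (far d (cmp T v' v)) k1"
      using eq(1) functor_cmp[OF d v] S.cmp_assoc[OF k(1) dv] by simp
    finally show ?thesis .
  qed
  have inv: "cmp S k (far f (inv_arr Y u)) = cmp S (far d (inv_arr T v)) k'"
    if u: "u \<in> hom Y y y'" and v: "v \<in> hom T t t'"
      and k: "k \<in> hom S (fob f y) (fob d t)" and k': "k' \<in> hom S (fob f y') (fob d t')"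
      and eq: "cmp S k' (far f u) = cmp S (far d v) k" for u v k k' y y' t t'
  proof -
    note iu = Y.inv_arr[OF u] and iv = T.inv_arr[OF v]
    note fu = functor_hom[OF f u] functor_hom[OF f iu(1)]
    note dv = functor_hom[OF d v] functor_hom[OF d iv(1)]
    \<comment> \<open>Both sides of the claim become \<open>k'\<close> after composition with
      \<open>far d v\<close>, which is then cancelled.\<close>
    have *: "cmp S (far d v) (cmp S k (far f (inv_arr Y u))) = k'"
      using eq S.cmp_assoc[OF fu(2) k dv(1)] S.cmp_assoc[OF fu(2) fu(1) k']
        functor_cmp[OF f iu(1) u] iu(3) functor_ide[OF f Y.hom_obj(2)[OF u]] S.cmp_ide[OF k'] by simp
    have "cmp S (far d v) (cmp S (far d (inv_arr T v)) k') = k'"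
      using S.cmp_assoc[OF k' dv(2) dv(1)] functor_cmp[OF d iv(1) v] iv(3)
        functor_ide[OF d T.hom_obj(2)[OF v]] S.ide_cmp[OF k'] by simp
    with * show ?thesis
      using S.cmp_left_cancel[OF dv(1) S.cmp_hom[OF fu(2) k] S.cmp_hom[OF k' dv(2)]] by simp
  qed
  show ?thesis
    unfolding hpullback_labelled_cat
  proof (rule groupoid_labelled_cat, goal_cases)
    case (1 x)
    then show ?case
      by (auto simp: Y.ide_hom T.ide_hom functor_ide[OF f] functor_ide[OF d] S.cmp_ide S.ide_cmp)
  next
    case (2 x y z u v)
    then show ?case
      using paste by (auto intro: Y.cmp_hom T.cmp_hom)
  next
    case (3 x y u)
    then show ?case
      by (auto simp: Y.cmp_ide Y.ide_cmp T.cmp_ide T.ide_cmp)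
  next
    case (4 x y z t u v w)
    then show ?case
      by (auto simp: Y.cmp_assoc T.cmp_assoc)
  next
    case (5 x y uv)
    obtain y1 k1 t1 y2 k2 t2 u v where eq: "x = (y1, k1, t1)" "y = (y2, k2, t2)" "uv = (u, v)"
      by (metis prod_cases3 surj_pair)
    have *: "u \<in> hom Y y1 y2" "v \<in> hom T t1 t2" "k1 \<in> hom S (fob f y1) (fob d t1)"
      "k2 \<in> hom S (fob f y2) (fob d t2)" "cmp S k2 (far f u) = cmp S (far d v) k1"
      using 5 by (auto simp: eq)
    show ?case
      using inv[OF *] Y.inv_arr[OF *(1)] T.inv_arr[OF *(2)]
      by (intro bexI[of _ "(inv_arr Y u, inv_arr T v)"]) (auto simp: eq)
  qed
qed

lemma functor_hpullback_proj: "is_functor (hpullback Y f S d T) T hpullback_proj"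
  unfolding is_functor_def hpullback_labelled_cat hpullback_proj_def
  by (auto simp: hom_labelled_cat labelled_cat_simps)


section \<open>The category of elements of a restriction species\<close>

lemma hom_inj_cat:
  "s \<in> hom inj_cat A B \<longleftrightarrow>
     (\<exists>f. s = (A, f, B) \<and> finite A \<and> finite B \<and> f \<in> A \<rightarrow>\<^sub>E B \<and> inj_on f A)"
  by (auto simp: hom_def inj_cat_def)

lemma obj_inj_cat: "A \<in> obj inj_cat \<longleftrightarrow> finite A"
  by (simp add: inj_cat_def)

lemma cmp_inj_cat: "cmp inj_cat (B', g, D) (A, f, B) = (A, compose A g f, D)"
  by (simp add: inj_cat_def)

lemma ide_inj_cat: "ide inj_cat A = (A, \<lambda>a\<in>A. a, A)"
  by (simp add: inj_cat_def)

lemma category_inj_cat: "category inj_cat"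
proof unfold_locales
  fix A B D and f g :: "'a injection"
  assume "f \<in> hom inj_cat A B" "g \<in> hom inj_cat B D"
  then show "cmp inj_cat g f \<in> hom inj_cat A D"
    by (auto simp: hom_inj_cat cmp_inj_cat compose_def inj_on_def PiE_iff)
next
  fix A B and f :: "'a injection"
  assume "f \<in> hom inj_cat A B"
  then obtain h where h: "f = (A, h, B)" "h \<in> A \<rightarrow>\<^sub>E B"
    by (auto simp: hom_inj_cat)
  then show "cmp inj_cat f (ide inj_cat A) = f" "cmp inj_cat (ide inj_cat B) f = f"
    by (auto simp: cmp_inj_cat ide_inj_cat compose_def PiE_iff extensional_def fun_eq_iff)
next
  fix A B D E and f g h :: "'a injection"
  assume "f \<in> hom inj_cat A B" "g \<in> hom inj_cat B D" "h \<in> hom inj_cat D E"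
  then show "cmp inj_cat h (cmp inj_cat g f) = cmp inj_cat (cmp inj_cat h g) f"
    by (auto simp: hom_inj_cat cmp_inj_cat compose_def PiE_iff fun_eq_iff)
next
  fix A :: "'a set"
  assume "A \<in> obj inj_cat"
  then show "ide inj_cat A \<in> hom inj_cat A A"
    by (auto simp: hom_inj_cat ide_inj_cat obj_inj_cat)
qed (auto simp: inj_cat_def)

interpretation inj_cat: category inj_cat
  by (rule category_inj_cat)

text \<open>Injectivity of the map underlying \<open>t\<close> gives equality at each point of
  \<open>A\<close>; outside \<open>A\<close> both functions are undefined by extensionality.\<close>

lemma inj_cat_mono:
  assumes "t \<in> hom inj_cat B D" "s \<in> hom inj_cat A B" "s' \<in> hom inj_cat A B"
    and eq: "cmp inj_cat t s = cmp inj_cat t s'"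
  shows "s = s'"
proof -
  obtain f g g' where f: "t = (B, f, D)" "inj_on f B"
    and g: "s = (A, g, B)" "g \<in> A \<rightarrow>\<^sub>E B" and g': "s' = (A, g', B)" "g' \<in> A \<rightarrow>\<^sub>E B"
    using assms by (auto simp: hom_inj_cat)
  have "f (g a) = f (g' a)" if "a \<in> A" for a
    using eq that by (auto simp: f g g' cmp_inj_cat compose_def dest!: fun_cong[of _ _ a])
  then have "g = g'"
    using g g' f(2) by (intro PiE_ext[OF g(2) g'(2)]) (auto simp: inj_on_def PiE_iff)
  with g g' show ?thesis
    by simp
qed

lemma incl_hom: "finite A \<Longrightarrow> B \<subseteq> A \<Longrightarrow> incl B A \<in> hom inj_cat B A"
  by (auto simp: hom_inj_cat incl_def finite_subset)

definition elt :: "('e::infinite, 'x, 'm) species \<Rightarrow> ('e set \<times> 'x) set" where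
  "elt R = {(A, X). finite A \<and> X \<in> obj (val R A)}"

text \<open>Unlike \<open>str_iso\<close>, this allows arbitrary injections of the underlying sets; in the resulting
  category the restrictions are arrows, all arrows are monic and cartesian, and functoriality of
  restriction follows from a universal property.\<close>

definition elt_hom ::
  "('e::infinite, 'x, 'm) species \<Rightarrow> 'e set \<times> 'x \<Rightarrow> 'e set \<times> 'x \<Rightarrow> ('e injection \<times> 'm) set" where
  "elt_hom R = (\<lambda>(A, X) (B, Y). {(s, u). s \<in> hom inj_cat A B \<and>
     u \<in> hom (val R A) X (fob (act R s) Y)})"

lemma str_iso_elt_hom:
  "(s, u) \<in> str_iso R x y \<longleftrightarrow> (s, u) \<in> elt_hom R x y \<and> bij_betw (fst (snd s)) (fst x) (fst y)"
  by (auto simp: str_iso_def elt_hom_def split: prod.splits)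

section \<open>Category laws, lifts and inverses in the category of elements\<close>

locale species =
  fixes R :: "('e::infinite, 'x, 'm) species"
  assumes psfunctor: "is_psfunctor inj_cat R"
begin

lemmas psfunctor_axioms = psfunctor[unfolded is_psfunctor_def]

lemma groupoid_val: "finite A \<Longrightarrow> groupoid (val R A)"
  using psfunctor by (simp add: is_psfunctor_def obj_inj_cat)

lemma functor_act: "s \<in> hom inj_cat A B \<Longrightarrow> is_functor (val R B) (val R A) (act R s)"
  using conjunct1[OF conjunct2[OF psfunctor_axioms]] by simp

lemmas act_ob = functor_ob[OF functor_act]
  and act_ide = functor_ide[OF functor_act]
  and act_hom = functor_hom[OF functor_act]
  and act_cmp = functor_cmp[OF functor_act]

lemma compositor_trans:
  assumes "f \<in> hom inj_cat A B" "g \<in> hom inj_cat B D"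
  shows "is_nat_trans (val R D) (val R A) (fcomp (act R f) (act R g)) (act R (cmp inj_cat g f))
    (compositor R f g)"
  using conjunct1[OF conjunct2[OF conjunct2[OF psfunctor_axioms]]] assms by simp

lemma compositor_hom:
  assumes "f \<in> hom inj_cat A B" "g \<in> hom inj_cat B D" "Z \<in> obj (val R D)"
  shows "compositor R f g Z \<in> hom (val R A) (fob (act R f) (fob (act R g) Z))
    (fob (act R (cmp inj_cat g f)) Z)"
  using compositor_trans[OF assms(1,2)] assms(3) by (auto simp: is_nat_trans_def fcomp_def)

lemma compositor_natural:
  assumes "f \<in> hom inj_cat A B" "g \<in> hom inj_cat B D" "w \<in> hom (val R D) Z W"
  shows "cmp (val R A) (far (act R (cmp inj_cat g f)) w) (compositor R f g Z) =
    cmp (val R A) (compositor R f g W) (far (act R f) (far (act R g) w))"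
  using compositor_trans[OF assms(1,2)] assms(3) unfolding is_nat_trans_def fcomp_def
  by (metis comp_apply fctr.select_convs(2))

lemma unitor_trans:
  "finite A \<Longrightarrow> is_nat_trans (val R A) (val R A) id_fctr (act R (ide inj_cat A)) (unitor R A)"
  using psfunctor by (simp add: is_psfunctor_def obj_inj_cat)

lemma unitor_hom:
  "finite A \<Longrightarrow> X \<in> obj (val R A) \<Longrightarrow> unitor R A X \<in> hom (val R A) X (fob (act R (ide inj_cat A)) X)"
  using unitor_trans by (auto simp: is_nat_trans_def id_fctr_def)

lemma unitor_natural:
  assumes "finite A" "w \<in> hom (val R A) Z W"
  shows "cmp (val R A) (far (act R (ide inj_cat A)) w) (unitor R A Z) =
    cmp (val R A) (unitor R A W) w"
  using unitor_trans[OF assms(1)] assms(2) unfolding is_nat_trans_def id_fctr_def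
  by (metis fctr.select_convs(2) id_apply)

lemma compositor_unit:
  assumes "f \<in> hom inj_cat A B" "Y \<in> obj (val R B)"
  shows "cmp (val R A) (compositor R (ide inj_cat A) f Y) (unitor R A (fob (act R f) Y)) =
      ide (val R A) (fob (act R f) Y)"
    and "cmp (val R A) (compositor R f (ide inj_cat B) Y) (far (act R f) (unitor R B Y)) =
      ide (val R A) (fob (act R f) Y)"
  using conjunct1[OF conjunct2[OF conjunct2[OF conjunct2[OF conjunct2[OF psfunctor_axioms]]]]] assms
  by simp_all

lemma compositor_assoc:
  assumes "f \<in> hom inj_cat A B" "g \<in> hom inj_cat B D" "h \<in> hom inj_cat D E" "W \<in> obj (val R E)"
  shows "cmp (val R A) (compositor R (cmp inj_cat g f) h W) (compositor R f g (fob (act R h) W)) =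
    cmp (val R A) (compositor R f (cmp inj_cat h g) W) (far (act R f) (compositor R g h W))"
  using conjunct2[OF conjunct2[OF conjunct2[OF conjunct2[OF conjunct2[OF psfunctor_axioms]]]]] assms
  by simp

lemma elt_homD:
  assumes "(s, u) \<in> elt_hom R x y" "x \<in> elt R" "y \<in> elt R"
  shows "s \<in> hom inj_cat (fst x) (fst y)" "fst s = fst x" "finite (fst x)" "finite (fst y)"
    "u \<in> hom (val R (fst x)) (snd x) (fob (act R s) (snd y))"
    "snd x \<in> obj (val R (fst x))" "snd y \<in> obj (val R (fst y))"
  using assms by (auto simp: elt_hom_def elt_def hom_inj_cat split: prod.splits)

lemma elt_homI:
  "s \<in> hom inj_cat (fst x) (fst y) \<Longrightarrow> u \<in> hom (val R (fst x)) (snd x) (fob (act R s) (snd y)) \<Longrightarrow>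
    (s, u) \<in> elt_hom R x y"
  by (auto simp: elt_hom_def split: prod.splits)

lemma str_ide_hom: "x \<in> elt R \<Longrightarrow> str_ide R x \<in> elt_hom R x x"
  using inj_cat.ide_hom unitor_hom
  by (auto simp: elt_def str_ide_def elt_hom_def obj_inj_cat split: prod.splits)

lemma str_cmp_hom:
  assumes su: "(s, u) \<in> elt_hom R x y" and tv: "(t, v) \<in> elt_hom R y z"
    and ob: "x \<in> elt R" "y \<in> elt R" "z \<in> elt R"
  shows "str_cmp R (snd z) (t, v) (s, u) \<in> elt_hom R x z"
proof -
  note s = elt_homD[OF su ob(1,2)] and t = elt_homD[OF tv ob(2,3)]
  interpret A: groupoid "val R (fst x)"
    using s(3) by (rule groupoid_val)
  show ?thesis
    unfolding str_cmp_def using s(2)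
    by (auto intro!: elt_homI inj_cat.cmp_hom[OF s(1) t(1)] A.cmp_hom[OF s(5)]
        A.cmp_hom[OF act_hom[OF s(1) t(5)]] compositor_hom s(1) t(1) t(7)
        A.cmp_hom[OF A.cmp_hom[OF s(5) act_hom[OF s(1) t(5)]]])
qed

text \<open>Each unit law is one triangle law of the pseudo-functor. Precomposition with the
  identity first needs naturality of the unitor, which moves \<open>u\<close> past it; on the other
  side the unitor already stands next to the compositor.\<close>

lemma str_cmp_ide:
  assumes su: "(s, u) \<in> elt_hom R x y" and ob: "x \<in> elt R" "y \<in> elt R"
  shows "str_cmp R (snd y) (s, u) (str_ide R x) = (s, u)"
    and "str_cmp R (snd y) (str_ide R y) (s, u) = (s, u)"
proof -
  note s = elt_homD[OF su ob]
  obtain A X B Y where xy: "x = (A, X)" "y = (B, Y)"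
    by fastforce
  interpret A: groupoid "val R A"
    using s(3) by (intro groupoid_val) (simp add: xy)
  note s' = s[unfolded xy fst_conv snd_conv]
  note idA = inj_cat.ide_hom[of A, unfolded obj_inj_cat, OF s'(3)]
    and idB = inj_cat.ide_hom[of B, unfolded obj_inj_cat, OF s'(4)]
  have uX: "unitor R A X \<in> hom (val R A) X (fob (act R (ide inj_cat A)) X)"
    by (rule unitor_hom[OF s'(3,6)])
  have uS: "unitor R A (fob (act R s) Y) \<in> hom (val R A) (fob (act R s) Y)
      (fob (act R (ide inj_cat A)) (fob (act R s) Y))"
    by (rule unitor_hom[OF s'(3) act_ob[OF s'(1,7)]])
  have c: "compositor R (ide inj_cat A) s Y \<in> hom (val R A)
      (fob (act R (ide inj_cat A)) (fob (act R s) Y)) (fob (act R s) Y)"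
    using compositor_hom[OF idA s'(1,7)] inj_cat.cmp_ide[OF s'(1)] by simp
  have "cmp (val R A) (compositor R (ide inj_cat A) s Y)
      (cmp (val R A) (far (act R (ide inj_cat A)) u) (unitor R A X)) = u"
    using unitor_natural[OF s'(3,5)] A.cmp_assoc[OF s'(5) uS c] compositor_unit(1)[OF s'(1,7)]
      A.ide_cmp[OF s'(5)] by simp
  then show "str_cmp R (snd y) (s, u) (str_ide R x) = (s, u)"
    using inj_cat.cmp_ide[OF s'(1)] by (simp add: str_cmp_def str_ide_def xy ide_inj_cat)
  have d: "compositor R s (ide inj_cat B) Y \<in> hom (val R A)
      (fob (act R s) (fob (act R (ide inj_cat B)) Y)) (fob (act R s) Y)"
    using compositor_hom[OF s'(1) idB s'(7)] inj_cat.ide_cmp[OF s'(1)] by simp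
  have "cmp (val R A) (compositor R s (ide inj_cat B) Y)
      (cmp (val R A) (far (act R s) (unitor R B Y)) u) = u"
    using A.cmp_assoc[OF s'(5) act_hom[OF s'(1) unitor_hom[OF s'(4,7)]] d]
      compositor_unit(2)[OF s'(1,7)] A.ide_cmp[OF s'(5)] by simp
  then show "str_cmp R (snd y) (str_ide R y) (s, u) = (s, u)"
    using inj_cat.ide_cmp[OF s'(1)] s'(2) by (simp add: str_cmp_def str_ide_def xy)
qed

text \<open>The two bracketings differ by the associativity law of the compositor, after naturality
  has moved \<open>w\<close> past it. With this and \<open>str_cmp_ide\<close> the coherence laws of
  \<open>R\<close> are used up; what follows works with the resulting category.\<close>

lemma str_cmp_assoc:
  assumes fu: "(f, u) \<in> elt_hom R x y" and gv: "(g, v) \<in> elt_hom R y z"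
    and hw: "(h, w) \<in> elt_hom R z t"
    and ob: "x \<in> elt R" "y \<in> elt R" "z \<in> elt R" "t \<in> elt R"
  shows "str_cmp R (snd t) (h, w) (str_cmp R (snd z) (g, v) (f, u)) =
    str_cmp R (snd t) (str_cmp R (snd t) (h, w) (g, v)) (f, u)"
proof -
  obtain A X B Y C Z D W where eq: "x = (A, X)" "y = (B, Y)" "z = (C, Z)" "t = (D, W)"
    by (metis surj_pair)
  note f = elt_homD[OF fu ob(1,2), unfolded eq fst_conv snd_conv]
    and g = elt_homD[OF gv ob(2,3), unfolded eq fst_conv snd_conv]
    and h = elt_homD[OF hw ob(3,4), unfolded eq fst_conv snd_conv]
  interpret A: groupoid "val R A"
    using f(3) by (rule groupoid_val)
  interpret B: groupoid "val R B"
    using f(4) by (rule groupoid_val)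
  let ?gf = "cmp inj_cat g f" and ?hg = "cmp inj_cat h g"
  note gf = inj_cat.cmp_hom[OF f(1) g(1)] and hg = inj_cat.cmp_hom[OF g(1) h(1)]
  note fv = act_hom[OF f(1) g(5)]
  note fvu = A.cmp_hom[OF f(5) fv]
  note gw = act_hom[OF g(1) h(5)]
  note fgw = act_hom[OF f(1) gw]
  note cfg = compositor_hom[OF f(1) g(1) g(7)]
  note cfgh = compositor_hom[OF f(1) g(1) act_ob[OF h(1,7)]]
  note cgh = compositor_hom[OF g(1) h(1) h(7)]
  note c1 = compositor_hom[OF gf h(1) h(7)]
  note c2 = compositor_hom[OF f(1) hg h(7)]
  note gfw = act_hom[OF gf h(5)]
  have c2': "compositor R f ?hg W \<in> hom (val R A) (fob (act R f) (fob (act R ?hg) W))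
    (fob (act R (cmp inj_cat h ?gf)) W)"
    using c2 inj_cat.cmp_assoc[OF f(1) g(1) h(1)] by simp
  have "cmp (val R A) (compositor R ?gf h W) (cmp (val R A) (far (act R ?gf) w)
      (cmp (val R A) (compositor R f g Z) (cmp (val R A) (far (act R f) v) u))) =
    cmp (val R A) (compositor R ?gf h W) (cmp (val R A) (cmp (val R A) (far (act R ?gf) w)
      (compositor R f g Z)) (cmp (val R A) (far (act R f) v) u))"
    using A.cmp_assoc[OF fvu cfg gfw] by simp
  \<comment> \<open>Naturality of \<open>compositor R f g\<close> in \<open>w\<close> replaces the
    action of the composite injection by two successive actions.\<close>
  also have "\<dots> = cmp (val R A) (compositor R ?gf h W) (cmp (val R A)
      (compositor R f g (fob (act R h) W))
      (cmp (val R A) (far (act R f) (far (act R g) w)) (cmp (val R A) (far (act R f) v) u)))"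
    using compositor_natural[OF f(1) g(1) h(5)] A.cmp_assoc[OF fvu fgw cfgh] by simp
  \<comment> \<open>The cocycle law \<open>compositor_assoc\<close> now changes the order in which
    the three injections are composed; the remaining steps collect everything under
    \<open>act R f\<close>.\<close>
  also have "\<dots> = cmp (val R A) (cmp (val R A) (compositor R f ?hg W)
        (far (act R f) (compositor R g h W)))
      (cmp (val R A) (far (act R f) (far (act R g) w)) (cmp (val R A) (far (act R f) v) u))"
    using compositor_assoc[OF f(1) g(1) h(1) h(7)] A.cmp_assoc[OF A.cmp_hom[OF fvu fgw] cfgh c1]
    by simp
  also have "\<dots> = cmp (val R A) (compositor R f ?hg W) (cmp (val R A)
        (far (act R f) (compositor R g h W))
      (cmp (val R A) (cmp (val R A) (far (act R f) (far (act R g) w)) (far (act R f) v)) u))"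
    using A.cmp_assoc[OF A.cmp_hom[OF fvu fgw] act_hom[OF f(1) cgh] c2]
      A.cmp_assoc[OF f(5) fv fgw] by simp
  also have "\<dots> = cmp (val R A) (compositor R f ?hg W) (cmp (val R A)
      (cmp (val R A) (far (act R f) (compositor R g h W))
        (cmp (val R A) (far (act R f) (far (act R g) w)) (far (act R f) v))) u)"
    using A.cmp_assoc[OF f(5) A.cmp_hom[OF fv fgw] act_hom[OF f(1) cgh]] by simp
  also have "\<dots> = cmp (val R A) (compositor R f ?hg W) (cmp (val R A)
      (far (act R f) (cmp (val R B) (compositor R g h W) (cmp (val R B) (far (act R g) w) v))) u)"
    using act_cmp[OF f(1) g(5) gw] act_cmp[OF f(1) B.cmp_hom[OF g(5) gw] cgh] by simp
  finally show ?thesis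
    using inj_cat.cmp_assoc[OF f(1) g(1) h(1)] f(2) g(2) gf hg
    by (auto simp: str_cmp_def eq hom_inj_cat cmp_inj_cat)
qed

text \<open>Every arrow is cartesian, since the values of a species are groupoids.\<close>

lemma str_cmp_eq_iff:
  assumes su: "(s, u) \<in> elt_hom R x y" and hw: "(h, w) \<in> elt_hom R z y"
    and t: "t \<in> hom inj_cat (fst z) (fst x)" "cmp inj_cat s t = h"
    and tv: "v \<in> hom (val R (fst z)) (snd z) (fob (act R t) (snd x))"
    and ob: "x \<in> elt R" "y \<in> elt R" "z \<in> elt R"
  shows "str_cmp R (snd y) (s, u) (t, v) = (h, w) \<longleftrightarrow>
    v = cmp (val R (fst z)) (inv_arr (val R (fst z)) (cmp (val R (fst z))
      (compositor R t s (snd y)) (far (act R t) u))) w"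
proof -
  note s = elt_homD[OF su ob(1,2)] and h = elt_homD[OF hw ob(3,2)]
  interpret Z: groupoid "val R (fst z)"
    using h(3) by (rule groupoid_val)
  note c = compositor_hom[OF t(1) s(1) s(7)]
  have "str_cmp R (snd y) (s, u) (t, v) =
    (h, cmp (val R (fst z)) (cmp (val R (fst z)) (compositor R t s (snd y)) (far (act R t) u)) v)"
    using t Z.cmp_assoc[OF tv act_hom[OF t(1) s(5)] c]
    by (auto simp: str_cmp_def hom_inj_cat)
  then show ?thesis
    using Z.cmp_eq_iff[OF Z.cmp_hom[OF act_hom[OF t(1) s(5)] c] tv] h(5) t(2) by auto
qed

text \<open>The existence half of the cartesian property. The lift is kept as a formula because the
  explicit composite in \<open>restr_iso\<close> has to be recognised as an instance of it.\<close>

lemma str_lift: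
  assumes su: "(s, u) \<in> elt_hom R x y" and hw: "(h, w) \<in> elt_hom R z y"
    and t: "t \<in> hom inj_cat (fst z) (fst x)" "cmp inj_cat s t = h"
    and ob: "x \<in> elt R" "y \<in> elt R" "z \<in> elt R"
  defines "v \<equiv> cmp (val R (fst z)) (inv_arr (val R (fst z)) (cmp (val R (fst z))
      (compositor R t s (snd y)) (far (act R t) u))) w"
  shows "(t, v) \<in> elt_hom R z x" "str_cmp R (snd y) (s, u) (t, v) = (h, w)"
proof -
  note s = elt_homD[OF su ob(1,2)] and h = elt_homD[OF hw ob(3,2)]
  interpret Z: groupoid "val R (fst z)"
    using h(3) by (rule groupoid_val)
  have "cmp (val R (fst z)) (compositor R t s (snd y)) (far (act R t) u) \<in>
    hom (val R (fst z)) (fob (act R t) (snd x)) (fob (act R h) (snd y))"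
    using Z.cmp_hom[OF act_hom[OF t(1) s(5)] compositor_hom[OF t(1) s(1) s(7)]] t(2) by simp
  from Z.cmp_hom[OF h(5) Z.inv_arr(1)[OF this]]
  have v: "v \<in> hom (val R (fst z)) (snd z) (fob (act R t) (snd x))"
    by (simp add: v_def)
  with t show "(t, v) \<in> elt_hom R z x"
    by (intro elt_homI)
  show "str_cmp R (snd y) (s, u) (t, v) = (h, w)"
    using str_cmp_eq_iff[OF su hw t v ob] v_def by simp
qed

text \<open>The underlying injections agree because \<open>s\<close> is monic. Over a common
  injection, \<open>str_cmp_eq_iff\<close> leaves a single possible second component.\<close>

lemma str_mono:
  assumes su: "(s, u) \<in> elt_hom R x y" and tv: "(t, v) \<in> elt_hom R z x"
    and tv': "(t', v') \<in> elt_hom R z x"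
    and eq: "str_cmp R (snd y) (s, u) (t, v) = str_cmp R (snd y) (s, u) (t', v')"
    and ob: "x \<in> elt R" "y \<in> elt R" "z \<in> elt R"
  shows "(t, v) = (t', v')"
proof -
  note s = elt_homD[OF su ob(1,2)] and t = elt_homD[OF tv ob(3,1)] and t' = elt_homD[OF tv' ob(3,1)]
  have "cmp inj_cat s t = cmp inj_cat s t'"
    using eq by (auto simp: str_cmp_def)
  then have tt: "t = t'"
    by (rule inj_cat_mono[OF s(1) t(1) t'(1)])
  obtain w where w: "str_cmp R (snd y) (s, u) (t, v) = (cmp inj_cat s t, w)"
    by (auto simp: str_cmp_def)
  have hw: "(cmp inj_cat s t, w) \<in> elt_hom R z y"
    using str_cmp_hom[OF tv su ob(3,1,2)] w by simp
  have w': "str_cmp R (snd y) (s, u) (t, v') = (cmp inj_cat s t, w)"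
    using w eq tt by simp
  have "v' \<in> hom (val R (fst z)) (snd z) (fob (act R t) (snd x))"
    using t'(5) tt by simp
  from iffD1[OF str_cmp_eq_iff[OF su hw t(1) refl this ob] w']
    iffD1[OF str_cmp_eq_iff[OF su hw t(1) refl t(5) ob] w]
  show ?thesis
    by (metis tt)
qed

lemma str_iso_cmp:
  assumes "(s, u) \<in> str_iso R x y" "(t, v) \<in> str_iso R y z" "x \<in> elt R" "y \<in> elt R" "z \<in> elt R"
  shows "str_cmp R (snd z) (t, v) (s, u) \<in> str_iso R x z"
proof -
  have "str_cmp R (snd z) (t, v) (s, u) \<in> elt_hom R x z"
    using assms by (intro str_cmp_hom[where y = y]) (auto simp: str_iso_elt_hom)
  moreover have "bij_betw (compose (fst x) (fst (snd t)) (fst (snd s))) (fst x) (fst z)"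
    using assms by (intro bij_betw_compose) (auto simp: str_iso_elt_hom)
  moreover have "s = (fst x, fst (snd s), snd (snd s))"
    using assms elt_homD(2)[of s u x y] by (cases s) (auto simp: str_iso_elt_hom)
  then have "fst (snd (fst (str_cmp R (snd z) (t, v) (s, u)))) =
      compose (fst x) (fst (snd t)) (fst (snd s))"
    by (cases s; cases t) (auto simp: str_cmp_def cmp_inj_cat)
  ultimately show ?thesis
    by (cases "str_cmp R (snd z) (t, v) (s, u)") (auto simp: str_iso_elt_hom)
qed

lemma str_iso_ide: "x \<in> elt R \<Longrightarrow> str_ide R x \<in> str_iso R x x"
  using str_ide_hom[of x]
  by (auto simp: str_ide_def str_iso_elt_hom ide_inj_cat bij_betw_def inj_on_def split: prod.splits)

text \<open>The inverse is the lift of the identity of \<open>y\<close> along \<open>(s, u)\<close>,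
  taken over the inverse bijection. This gives a right inverse by construction; it is also a left
  inverse because \<open>(s, u)\<close> is monic.\<close>

lemma str_iso_inverse:
  assumes su: "(s, u) \<in> str_iso R x y" and ob: "x \<in> elt R" "y \<in> elt R"
  obtains t v where "(t, v) \<in> str_iso R y x" "str_cmp R (snd x) (t, v) (s, u) = str_ide R x"
    "str_cmp R (snd y) (s, u) (t, v) = str_ide R y"
proof -
  have su': "(s, u) \<in> elt_hom R x y"
    using su by (simp add: str_iso_elt_hom)
  note s = elt_homD[OF su' ob]
  obtain A X B Y where xy: "x = (A, X)" "y = (B, Y)"
    by fastforce
  obtain f where f: "s = (A, f, B)" "f \<in> A \<rightarrow>\<^sub>E B" "inj_on f A" "bij_betw f A B"
    using s(1) su by (auto simp: hom_inj_cat xy str_iso_elt_hom)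
  \<comment> \<open>The restriction to \<open>B\<close> makes the inverse map extensional, as arrows
    of \<open>inj_cat\<close> must be.\<close>
  define g where "g = (\<lambda>b\<in>B. inv_into A f b)"
  define t where "t = (B, g, A)"
  have g: "bij_betw g B A"
    using bij_betw_inv_into[OF f(4)] by (simp add: g_def cong: bij_betw_cong)
  have t: "t \<in> hom inj_cat B A"
    using g s(3,4) bij_betwE[OF g] by (auto simp: t_def hom_inj_cat xy bij_betw_def g_def)
  have st: "cmp inj_cat s t = ide inj_cat B"
    using f by (auto simp: t_def cmp_inj_cat ide_inj_cat compose_def g_def fun_eq_iff
        bij_betw_inv_into_right[OF f(4)])
  have idy: "str_ide R y = (ide inj_cat B, unitor R B Y)"
    by (simp add: str_ide_def xy)
  define v where "v = cmp (val R B) (inv_arr (val R B) (cmp (val R B)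
      (compositor R t s Y) (far (act R t) u))) (unitor R B Y)"
  have tv: "(t, v) \<in> elt_hom R y x" "str_cmp R (snd y) (s, u) (t, v) = str_ide R y"
    using str_lift[OF su' str_ide_hom[OF ob(2), unfolded idy] _ _ ob ob(2), of t] t st
    by (auto simp: xy v_def idy[unfolded xy])
  have "str_cmp R (snd y) (s, u) (str_cmp R (snd x) (t, v) (s, u)) =
    str_cmp R (snd y) (s, u) (str_ide R x)"
    using str_cmp_assoc[OF su' tv(1) su' ob ob] tv(2) str_cmp_ide[OF su' ob] by simp
  then have "str_cmp R (snd x) (t, v) (s, u) = str_ide R x"
    using str_mono[OF su' _ _ _ ob ob(1), of "fst (str_cmp R (snd x) (t, v) (s, u))"
        "snd (str_cmp R (snd x) (t, v) (s, u))" "fst (str_ide R x)" "snd (str_ide R x)"]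
      str_cmp_hom[OF su' tv(1) ob ob(1)] str_ide_hom[OF ob(1)] by simp
  moreover have "(t, v) \<in> str_iso R y x"
    using tv(1) g by (simp add: str_iso_elt_hom t_def xy)
  ultimately show thesis
    using that tv(2) by simp
qed

text \<open>The cartesian arrow over the inclusion; \<open>restr_iso\<close> is the lift along it.\<close>

definition restr_arr :: "'e set \<Rightarrow> 'e set \<times> 'x \<Rightarrow> 'e injection \<times> 'm" where
  "restr_arr B = (\<lambda>(A, X). (incl B A, ide (val R B) (restr R A B X)))"

lemma restr_ob: "(A, X) \<in> elt R \<Longrightarrow> B \<subseteq> A \<Longrightarrow> (B, restr R A B X) \<in> elt R"
  using act_ob[OF incl_hom] by (auto simp: elt_def restr_def finite_subset)

lemma restr_arr_hom:
  assumes "(A, X) \<in> elt R" "B \<subseteq> A"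
  shows "restr_arr B (A, X) \<in> elt_hom R (B, restr R A B X) (A, X)"
proof -
  interpret groupoid "val R B"
    using assms by (intro groupoid_val) (auto simp: elt_def finite_subset)
  show ?thesis
    using assms restr_ob[OF assms] incl_hom[of A B] ide_hom
    by (auto simp: restr_arr_def elt_def elt_hom_def restr_def)
qed

text \<open>The second conclusion is a commuting square whose other sides are the two restriction
  arrows. Since these are monic, it determines the restricted isomorphism, and functoriality can be
  derived without unfolding the composite that defines it.\<close>

lemma restr_iso:
  assumes su: "(s, u) \<in> str_iso R (A, X) (A', X')" and ob: "(A, X) \<in> elt R" "(A', X') \<in> elt R"
    and B: "B \<subseteq> A" "B' = fst (snd s) ` B"
  shows "restr_iso R B B' X' (s, u) \<in> str_iso R (B, restr R A B X) (B', restr R A' B' X')"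
    and "str_cmp R X' (restr_arr B' (A', X')) (restr_iso R B B' X' (s, u)) =
      str_cmp R X' (s, u) (restr_arr B (A, X))"
    and "fst (snd (fst (restr_iso R B B' X' (s, u)))) = restrict (fst (snd s)) B"
proof -
  have su': "(s, u) \<in> elt_hom R (A, X) (A', X')"
    using su by (simp add: str_iso_elt_hom)
  note s = elt_homD[OF su' ob, unfolded fst_conv snd_conv]
  obtain f where f: "s = (A, f, A')" "f \<in> A \<rightarrow>\<^sub>E A'" "inj_on f A" "bij_betw f A A'"
    using s(1) su by (auto simp: hom_inj_cat str_iso_elt_hom)
  have B': "B' \<subseteq> A'" and fB: "bij_betw f B B'"
    using B f by (auto simp: bij_betw_def intro: inj_on_subset)
  define t where "t = (B, restrict f B, B')"
  have finB: "finite B" "finite B'"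
    using B B' s(3,4) by (auto intro: finite_subset)
  have t: "t \<in> hom inj_cat B B'"
    using fB B finB by (auto simp: t_def hom_inj_cat bij_betw_def f)
  let ?i = "incl B A" and ?i' = "incl B' A'"
  note i = incl_hom[OF s(3) B(1)] and i' = incl_hom[OF s(4) B']
  interpret B: groupoid "val R B"
    using finB by (intro groupoid_val)
  interpret B': groupoid "val R B'"
    using finB by (intro groupoid_val)
  note r = restr_ob[OF ob(1) B(1)] and r' = restr_ob[OF ob(2) B']
  note ri = restr_arr_hom[OF ob(1) B(1)] and ri' = restr_arr_hom[OF ob(2) B']
  \<comment> \<open>Restricting and then including is the same injection as including and then
    applying \<open>s\<close>; over this equation the composite \<open>w\<close> is lifted.\<close>
  have it: "cmp inj_cat ?i' t = cmp inj_cat s ?i"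
    using B B' by (auto simp: t_def incl_def cmp_inj_cat f compose_def fun_eq_iff)
  define w where "w = cmp (val R B) (compositor R ?i s X') (far (act R ?i) u)"
  have iu: "far (act R ?i) u \<in> hom (val R B) (restr R A B X) (fob (act R ?i) (fob (act R s) X'))"
    using act_hom[OF i s(5)] by (simp add: restr_def)
  have cw: "str_cmp R X' (s, u) (restr_arr B (A, X)) = (cmp inj_cat s ?i, w)"
    using B.cmp_ide[OF iu] by (simp add: str_cmp_def restr_arr_def w_def incl_def)
  have w: "(cmp inj_cat s ?i, w) \<in> elt_hom R (B, restr R A B X) (A', X')"
    using str_cmp_hom[OF _ su' r ob, of ?i "ide (val R B) (restr R A B X)"] ri cw
    by (simp add: restr_arr_def)
  have ti: "far (act R t) (ide (val R B') (restr R A' B' X')) =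
      ide (val R B) (fob (act R t) (restr R A' B' X'))"
    using r' by (intro act_ide[OF t]) (simp add: elt_def)
  have c: "compositor R t ?i' X' \<in> hom (val R B) (fob (act R t) (restr R A' B' X'))
      (fob (act R (cmp inj_cat ?i' t)) X')"
    using compositor_hom[OF t i' s(7)] by (simp add: restr_def)
  \<comment> \<open>The formula of \<open>str_lift\<close> contains the action of \<open>t\<close>
    on the identity of the restricted structure. By \<open>ti\<close> this is an identity, and the
    compositor that remains is the one inverted in \<open>restr_iso\<close>.\<close>
  have eq: "restr_iso R B B' X' (s, u) = (t, cmp (val R B) (inv_arr (val R B) (cmp (val R B)
      (compositor R t ?i' X') (far (act R t) (ide (val R B') (restr R A' B' X'))))) w)"
    unfolding ti B.cmp_ide[OF c] by (simp add: restr_iso_def f Let_def t_def w_def)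
  note lift = str_lift[OF ri'[unfolded restr_arr_def prod.case] w _ _ r' ob(2) r, of t,
      unfolded fst_conv snd_conv, OF t it]
  have "bij_betw (restrict f B) B B'"
    using fB by (simp cong: bij_betw_cong)
  then show "restr_iso R B B' X' (s, u) \<in> str_iso R (B, restr R A B X) (B', restr R A' B' X')"
    unfolding str_iso_elt_hom eq using lift(1) by (simp add: t_def del: restrict_apply)
  show "str_cmp R X' (restr_arr B' (A', X')) (restr_iso R B B' X' (s, u)) =
      str_cmp R X' (s, u) (restr_arr B (A, X))"
    unfolding cw unfolding eq restr_arr_def prod.case by (rule lift(2))
  show "fst (snd (fst (restr_iso R B B' X' (s, u)))) = restrict (fst (snd s)) B"
    unfolding eq by (simp add: t_def f)
qed

end


section \<open>Cardinality of groupoids equivalent to finite sets\<close>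

text \<open>The \<open>r i\<close> represent each isomorphism class once and have no nontrivial automorphisms, so that
  the groupoid is equivalent to the finite set \<open>I\<close>.\<close>

definition discrete_reps :: "('o, 'm) cat \<Rightarrow> 'i set \<Rightarrow> ('i \<Rightarrow> 'o) \<Rightarrow> bool" where
  "discrete_reps Y I r \<longleftrightarrow> finite I \<and> (\<forall>i\<in>I. r i \<in> obj Y) \<and>
     (\<forall>y\<in>obj Y. \<exists>i\<in>I. hom Y (r i) y \<noteq> {}) \<and>
     (\<forall>y. \<forall>i\<in>I. \<forall>j\<in>I. \<forall>v\<in>hom Y (r i) y. \<forall>w\<in>hom Y (r j) y. i = j \<and> v = w)"

lemma discrete_repsD:
  assumes "discrete_reps Y I r"
  shows "finite I" "i \<in> I \<Longrightarrow> r i \<in> obj Y" "y \<in> obj Y \<Longrightarrow> \<exists>i\<in>I. \<exists>v. v \<in> hom Y (r i) y"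
    "i \<in> I \<Longrightarrow> j \<in> I \<Longrightarrow> v \<in> hom Y (r i) y \<Longrightarrow> w \<in> hom Y (r j) y \<Longrightarrow> i = j"
    "i \<in> I \<Longrightarrow> v \<in> hom Y (r i) y \<Longrightarrow> w \<in> hom Y (r i) y \<Longrightarrow> v = w"
  using assms unfolding discrete_reps_def by blast+

text \<open>For an automorphism \<open>v\<close> of \<open>y\<close> and an arrow \<open>w\<close>
  from a representative to \<open>y\<close>, the composite of \<open>v\<close> with \<open>w\<close>
  and \<open>w\<close> itself are parallel arrows from that representative, hence equal; cancel
  \<open>w\<close>.\<close>

lemma (in groupoid) aut_discrete_reps:
  assumes r: "discrete_reps C I r" and y: "y \<in> obj C"
  shows "aut C y = {ide C y}"
proof -
  obtain i w where w: "i \<in> I" "w \<in> hom C (r i) y"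
    using discrete_repsD(3)[OF r y] by auto
  have "v = ide C y" if v: "v \<in> hom C y y" for v
  proof (rule cmp_right_cancel[OF w(2) v ide_hom[OF y]])
    show "cmp C v w = cmp C (ide C y) w"
      using discrete_repsD(5)[OF r w(1) cmp_hom[OF w(2) v] w(2)] ide_cmp[OF w(2)] by simp
  qed
  then show ?thesis
    unfolding aut_def using ide_hom[OF y] by blast
qed

lemma (in groupoid) bij_betw_discrete_reps:
  assumes r: "discrete_reps C I r"
  shows "bij_betw (\<lambda>i. cls C (r i)) I (pi0 C)"
proof (rule bij_betw_imageI)
  show "inj_on (\<lambda>i. cls C (r i)) I"
  proof (rule inj_onI)
    fix i j assume ij: "i \<in> I" "j \<in> I" "cls C (r i) = cls C (r j)"
    then obtain v where "v \<in> hom C (r i) (r j)"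
      using cls_eq_iff discrete_repsD(2)[OF r] by blast
    \<comment> \<open>The arrow \<open>v\<close> and the identity of \<open>r j\<close> end at the
      same object, which forces the indices to agree.\<close>
    then show "i = j"
      using discrete_repsD(4)[OF r ij(1,2)] ide_hom discrete_repsD(2)[OF r ij(2)] by blast
  qed
  show "(\<lambda>i. cls C (r i)) ` I = pi0 C"
  proof (intro equalityI subsetI)
    fix c assume "c \<in> pi0 C"
    then obtain y where y: "y \<in> obj C" "c = cls C y"
      by (auto simp: pi0_cls)
    obtain i v where i: "i \<in> I" "v \<in> hom C (r i) y"
      using discrete_repsD(3)[OF r y(1)] by auto
    then have "cls C (r i) = c"
      using y cls_eq_iff discrete_repsD(2)[OF r] by blast
    with i show "c \<in> (\<lambda>i. cls C (r i)) ` I"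
      by blast
  qed (use discrete_repsD(2)[OF r] in \<open>auto simp: pi0_cls\<close>)
qed

lemma (in groupoid) finite_groupoid_discrete_reps:
  assumes r: "discrete_reps C I r"
  shows "finite_groupoid C"
  using bij_betw_finite[OF bij_betw_discrete_reps[OF r]] discrete_repsD(1)[OF r]
    aut_discrete_reps[OF r] groupoid_axioms
  by (auto simp: finite_groupoid_def locally_finite_def)

lemma (in groupoid) gcard_discrete_reps:
  assumes r: "discrete_reps C I r"
  shows "gcard C = of_nat (card I)"
proof -
  have "on_class (\<lambda>y. 1 / of_nat (card (aut C y))) c = (1 :: rat)" if c: "c \<in> pi0 C" for c
  proof -
    obtain x where x: "x \<in> obj C" "c = cls C x"
      using c by (auto simp: pi0_cls)
    show ?thesis
      unfolding x(2) by (subst on_class_cls) (simp_all add: x(1) aut_discrete_reps[OF r])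
  qed
  then have "gcard C = of_nat (card (pi0 C))"
    by (simp add: gcard_def)
  then show ?thesis
    using bij_betw_same_card[OF bij_betw_discrete_reps[OF r]] by simp
qed

section \<open>Homotopy fibres of discrete groupoids and cardinality over a base\<close>

lemma groupoid_hfibre:
  assumes "groupoid Y" "groupoid S" "is_functor Y S f" "s \<in> obj S"
  shows "groupoid (hfibre Y f S s)"
  unfolding hfibre_def
  using assms by (intro groupoid_hpullback groupoid_unit_cat functor_point)

text \<open>On the side of the point the square carries an identity, so it shrinks to a triangle
  over \<open>s\<close>.\<close>

lemma hom_hfibre:
  assumes "groupoid S" "s \<in> obj S"
  shows "g \<in> hom (hfibre Y f S s) (y, k, e) (y', k', e') \<longleftrightarrow>
     (\<exists>u\<in>hom Y y y'. g = ((y, k, ()), (u, ()), (y', k', ())) \<and> cmp S k' (far f u) = k) \<and>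
     y \<in> obj Y \<and> k \<in> hom S (fob f y) s \<and> y' \<in> obj Y \<and> k' \<in> hom S (fob f y') s"
proof -
  interpret groupoid S by fact
  have p: "fob (snd (point S s)) e = s" "far (snd (point S s)) e = ide S s" for e
    by (simp_all add: point_def)
  show ?thesis
    unfolding hfibre_def hom_hpullback by (auto simp: p hom_unit_cat ide_cmp) (auto simp: unit_cat_def)
qed

lemma obj_hfibre: "(y, k, e) \<in> obj (hfibre Y f S s) \<longleftrightarrow> y \<in> obj Y \<and> k \<in> hom S (fob f y) s"
  by (auto simp: hfibre_def obj_hpullback point_def unit_cat_def)

text \<open>An object \<open>(y, k)\<close> is reached from a representative only through the unique
  arrow \<open>v\<close> from some \<open>r i\<close> to \<open>y\<close>, and the triangle then
  forces \<open>cmp U k (far f v)\<close> at \<open>r i\<close>. So the fibre is again discrete,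
  with one point for each arrow from some \<open>fob f (r i)\<close> to \<open>s\<close>.\<close>

lemma discrete_reps_hfibre:
  assumes "groupoid Y" "groupoid U" "locally_finite U" and f: "is_functor Y U f"
    and r: "discrete_reps Y I r" and s: "s \<in> obj U"
  shows "discrete_reps (hfibre Y f U s) (SIGMA i:I. hom U (fob f (r i)) s) (\<lambda>(i, k). (r i, k, ()))"
proof -
  interpret Y: groupoid Y by fact
  interpret U: groupoid U by fact
  note homF = hom_hfibre[OF \<open>groupoid U\<close> s]
  have fr: "fob f (r i) \<in> obj U" if "i \<in> I" for i
    using functor_ob[OF f] discrete_repsD(2)[OF r] that by blast
  show ?thesis
    unfolding discrete_reps_def
  proof (intro conjI ballI allI)
    show "finite (SIGMA i:I. hom U (fob f (r i)) s)"
      using discrete_repsD(1)[OF r] fr U.finite_hom assms(3) by (auto simp: locally_finite_def)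
  next
    fix j assume "j \<in> (SIGMA i:I. hom U (fob f (r i)) s)"
    then show "(case j of (i, k) \<Rightarrow> (r i, k, ())) \<in> obj (hfibre Y f U s)"
      using discrete_repsD(2)[OF r] by (auto simp: obj_hfibre)
  next
    fix x assume "x \<in> obj (hfibre Y f U s)"
    then obtain y k where x: "x = (y, k, ())" "y \<in> obj Y" "k \<in> hom U (fob f y) s"
      by (cases x) (auto simp: obj_hfibre)
    obtain i v where i: "i \<in> I" "v \<in> hom Y (r i) y"
      using discrete_repsD(3)[OF r x(2)] by auto
    have "cmp U k (far f v) \<in> hom U (fob f (r i)) s"
      using U.cmp_hom[OF functor_hom[OF f i(2)] x(3)] .
    moreover from this have "((r i, cmp U k (far f v), ()), (v, ()), x) \<in>
        hom (hfibre Y f U s) (r i, cmp U k (far f v), ()) x"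
      using i x discrete_repsD(2)[OF r] by (auto simp: homF)
    ultimately show "\<exists>j\<in>SIGMA i:I. hom U (fob f (r i)) s.
        hom (hfibre Y f U s) (case j of (i, k) \<Rightarrow> (r i, k, ())) x \<noteq> {}"
      using i(1) by (intro bexI[of _ "(i, cmp U k (far f v))"]) auto
  next
    fix x j j' v w
    assume *: "j \<in> (SIGMA i:I. hom U (fob f (r i)) s)" "j' \<in> (SIGMA i:I. hom U (fob f (r i)) s)"
      "v \<in> hom (hfibre Y f U s) (case j of (i, k) \<Rightarrow> (r i, k, ())) x"
      "w \<in> hom (hfibre Y f U s) (case j' of (i, k) \<Rightarrow> (r i, k, ())) x"
    obtain y k where x: "x = (y, k, ())"
      by (cases x) auto
    obtain i a i' a' where j: "j = (i, a)" "j' = (i', a')"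
      by fastforce
    obtain v' w' where
      v: "v = ((r i, a, ()), (v', ()), x)" "v' \<in> hom Y (r i) y" "a = cmp U k (far f v')" and
      w: "w = ((r i', a', ()), (w', ()), x)" "w' \<in> hom Y (r i') y" "a' = cmp U k (far f w')"
      using *(3,4) unfolding j x prod.case homF by blast
    have "i \<in> I" "i' \<in> I"
      using *(1,2) j by auto
    then have "i = i'"
      using discrete_repsD(4)[OF r _ _ v(2) w(2)] by blast
    moreover from this have "v' = w'"
      using discrete_repsD(5)[OF r \<open>i \<in> I\<close> v(2)] w(2) by blast
    ultimately show "j = j'" "v = w"
      using v w j by auto
  qed
qed

lemma lookup_delta: "Poly_Mapping.lookup (delta b) c = (if c = b then 1 else 0)"
  by (simp add: delta_def lookup_single when_def)

text \<open>By \<open>card_hom\<close> an index contributes \<open>card (aut U s)\<close> to the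
  fibre over \<open>s\<close> if its image is isomorphic to \<open>s\<close>, and nothing otherwise.
  Division by \<open>card (aut U s)\<close> leaves the coefficient of a sum of basis
  vectors.\<close>

lemma card_over_discrete_reps:
  assumes Y: "groupoid Y" and U: "groupoid U" "locally_finite U" and f: "is_functor Y U f"
    and r: "discrete_reps Y I r"
  shows "card_over U (Y, f) = (\<Sum>i\<in>I. delta (cls U (fob f (r i))))"
proof -
  interpret U: groupoid U by fact
  define h where "h = (\<lambda>s. gcard (hfibre Y f U s) / of_nat (card (aut U s)))"
  have fr: "fob f (r i) \<in> obj U" if "i \<in> I" for i
    using functor_ob[OF f] discrete_repsD(2)[OF r] that by blast
  have h: "h s = (\<Sum>i\<in>I. if cls U s = cls U (fob f (r i)) then 1 else 0)" if s: "s \<in> obj U" for s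
  proof -
    interpret F: groupoid "hfibre Y f U s"
      using groupoid_hfibre[OF Y U(1) f s] .
    have fin: "finite (hom U (fob f (r i)) s)" if "i \<in> I" for i
      using U.finite_hom U(2) fr[OF that] by (auto simp: locally_finite_def)
    have "gcard (hfibre Y f U s) = (\<Sum>i\<in>I. of_nat (card (hom U (fob f (r i)) s)))"
      using F.gcard_discrete_reps[OF discrete_reps_hfibre[OF Y U f r s]] discrete_repsD(1)[OF r] fin
      by simp
    also have "\<dots> = (\<Sum>i\<in>I. of_nat (card (aut U s)) * (if cls U s = cls U (fob f (r i)) then 1 else 0))"
    proof (intro sum.cong refl)
      fix i assume i: "i \<in> I"
      show "of_nat (card (hom U (fob f (r i)) s)) =
          of_nat (card (aut U s)) * (if cls U s = cls U (fob f (r i)) then 1 else (0 :: rat))"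
        using U.cls_eq_iff[OF fr[OF i] s] U.card_hom[of "fob f (r i)" s] by auto
    qed
    finally have "gcard (hfibre Y f U s) =
        of_nat (card (aut U s)) * (\<Sum>i\<in>I. if cls U s = cls U (fob f (r i)) then 1 else 0)"
      by (simp add: sum_distrib_left)
    \<comment> \<open>The automorphism group is finite and contains the identity, so the division is
      legitimate.\<close>
    moreover have "card (aut U s) \<noteq> 0"
      using U(2) U.ide_hom s by (auto simp: locally_finite_def aut_def)
    ultimately show ?thesis
      by (simp add: h_def)
  qed
  \<comment> \<open>\<open>Abs_poly_mapping\<close> can be evaluated once its argument is exhibited
    as the \<open>lookup\<close> of a vector; finiteness of the support comes for free.\<close>
  have "(\<lambda>c. if c \<in> pi0 U then on_class h c else 0) =
      Poly_Mapping.lookup (\<Sum>i\<in>I. delta (cls U (fob f (r i))))"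
  proof
    fix c
    show "(if c \<in> pi0 U then on_class h c else 0) =
      Poly_Mapping.lookup (\<Sum>i\<in>I. delta (cls U (fob f (r i)))) c"
    proof (cases "c \<in> pi0 U")
      case True
      then obtain s where s: "s \<in> obj U" "c = cls U s"
        by (auto simp: pi0_cls)
      have "on_class h c = h s"
        unfolding s(2)
      proof (rule U.on_class_cls[OF s(1)])
        fix t assume t: "t \<in> obj U" "hom U s t \<noteq> {}"
        then show "h t = h s"
          using h[OF s(1)] h[OF t(1)] U.cls_eq_iff[OF s(1) t(1)] by simp
      qed
      then show ?thesis
        using True h[OF s(1)] s(2) by (simp add: lookup_sum lookup_delta)
    next
      case False
      then have "c \<noteq> cls U (fob f (r i))" if "i \<in> I" for i
        using fr[OF that] by (auto simp: pi0_cls)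
      then show ?thesis
        using False by (simp add: lookup_sum lookup_delta)
    qed
  qed
  then show ?thesis
    unfolding card_over_def prod.case h_def[symmetric] by simp
qed

text \<open>A unique lifting property of \<open>d : T \<rightarrow> S\<close> over \<open>s\<close>, as for a discrete fibration: every
  arrow \<open>s \<rightarrow> d t\<close> has exactly one lift with codomain \<open>t\<close>, and its domain is some \<open>\<tau> i\<close>.\<close>

definition unique_lifts ::
  "('t, 'l) cat \<Rightarrow> ('t, 'l, 's, 'k) fctr \<Rightarrow> ('s, 'k) cat \<Rightarrow> 's \<Rightarrow> 'i set \<Rightarrow> ('i \<Rightarrow> 't) \<Rightarrow> bool" where
  "unique_lifts T d S s I \<tau> \<longleftrightarrow> finite I \<and> (\<forall>i\<in>I. \<tau> i \<in> obj T \<and> fob d (\<tau> i) = s) \<and>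
     (\<forall>t\<in>obj T. \<forall>k\<in>hom S s (fob d t). \<exists>i\<in>I. \<exists>v\<in>hom T (\<tau> i) t. far d v = k) \<and>
     (\<forall>t\<in>obj T. \<forall>i\<in>I. \<forall>j\<in>I. \<forall>v\<in>hom T (\<tau> i) t. \<forall>w\<in>hom T (\<tau> j) t.
        far d v = far d w \<longrightarrow> i = j \<and> v = w)"

lemma unique_liftsD:
  assumes "unique_lifts T d S s I \<tau>"
  shows "finite I" "i \<in> I \<Longrightarrow> \<tau> i \<in> obj T" "i \<in> I \<Longrightarrow> fob d (\<tau> i) = s"
    "t \<in> obj T \<Longrightarrow> k \<in> hom S s (fob d t) \<Longrightarrow> \<exists>i\<in>I. \<exists>v. v \<in> hom T (\<tau> i) t \<and> far d v = k"
    "t \<in> obj T \<Longrightarrow> i \<in> I \<Longrightarrow> j \<in> I \<Longrightarrow> v \<in> hom T (\<tau> i) t \<Longrightarrow> w \<in> hom T (\<tau> j) t \<Longrightarrow>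
      far d v = far d w \<Longrightarrow> i = j"
    "t \<in> obj T \<Longrightarrow> i \<in> I \<Longrightarrow> v \<in> hom T (\<tau> i) t \<Longrightarrow> w \<in> hom T (\<tau> i) t \<Longrightarrow>
      far d v = far d w \<Longrightarrow> v = w"
  using assms unfolding unique_lifts_def by blast+

lemma hom_pull_point:
  assumes S: "groupoid S" and s: "s \<in> obj S" and d: "is_functor T S d"
  shows "g \<in> hom (hpullback unit_cat (snd (point S s)) S d T) (e, k, t) (e', k', t') \<longleftrightarrow>
     (\<exists>v\<in>hom T t t'. g = (((), k, t), ((), v), ((), k', t')) \<and> k' = cmp S (far d v) k) \<and>
     t \<in> obj T \<and> k \<in> hom S s (fob d t) \<and> t' \<in> obj T \<and> k' \<in> hom S s (fob d t')"
proof -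
  interpret groupoid S by fact
  have p: "fob (snd (point S s)) e = s" "far (snd (point S s)) e = ide S s" for e
    by (simp_all add: point_def)
  show ?thesis
    unfolding hom_hpullback by (auto simp: p hom_unit_cat cmp_ide) (auto simp: unit_cat_def)
qed

text \<open>An object of the pullback is an arrow \<open>k : s \<rightarrow> d t\<close>, and an
  arrow into it from \<open>((), ide S s, \<tau> i)\<close> is a lift of \<open>k\<close> starting
  at \<open>\<tau> i\<close>. Existence and uniqueness of lifts thus become the two halves of
  discreteness.\<close>

lemma discrete_reps_pull_point:
  assumes S: "groupoid S" and d: "is_functor T S d" and s: "s \<in> obj S"
    and l: "unique_lifts T d S s I \<tau>"
  shows "discrete_reps (hpullback unit_cat (snd (point S s)) S d T) I (\<lambda>i. ((), ide S s, \<tau> i))"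
    (is "discrete_reps ?P _ _")
proof -
  interpret groupoid S by fact
  note homP = hom_pull_point[OF S s d]
  have ob: "(e, k, t) \<in> obj ?P \<longleftrightarrow> t \<in> obj T \<and> k \<in> hom S s (fob d t)" for e k t
    by (auto simp: obj_hpullback point_def unit_cat_def)
  have lift: "cmp S (far d v) (ide S s) = far d v" if "v \<in> hom T (\<tau> i) t" "i \<in> I" for v i t
    using functor_hom[OF d that(1)] unique_liftsD(3)[OF l that(2)] cmp_ide by metis
  show ?thesis
    unfolding discrete_reps_def
  proof (intro conjI ballI allI)
    show "finite I"
      using unique_liftsD(1)[OF l] .
  next
    fix i assume "i \<in> I"
    then show "((), ide S s, \<tau> i) \<in> obj ?P"
      using unique_liftsD(2,3)[OF l] ide_hom[OF s] by (auto simp: ob)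
  next
    fix x assume "x \<in> obj ?P"
    then obtain k t where x: "x = ((), k, t)" "t \<in> obj T" "k \<in> hom S s (fob d t)"
      by (cases x) (auto simp: ob)
    obtain i v where i: "i \<in> I" "v \<in> hom T (\<tau> i) t" "far d v = k"
      using unique_liftsD(4)[OF l x(2,3)] by auto
    then have "(((), ide S s, \<tau> i), ((), v), x) \<in> hom ?P ((), ide S s, \<tau> i) x"
      using x unique_liftsD(2,3)[OF l i(1)] ide_hom[OF s] lift[OF i(2,1)] by (auto simp: homP)
    with i(1) show "\<exists>i\<in>I. hom ?P ((), ide S s, \<tau> i) x \<noteq> {}"
      by blast
  next
    fix x i j v w
    assume ij: "i \<in> I" "j \<in> I"
      and vw: "v \<in> hom ?P ((), ide S s, \<tau> i) x" "w \<in> hom ?P ((), ide S s, \<tau> j) x"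
    obtain k t where x: "x = ((), k, t)"
      by (cases x) auto
    obtain v' where v: "v = (((), ide S s, \<tau> i), ((), v'), x)" "v' \<in> hom T (\<tau> i) t"
      "k = cmp S (far d v') (ide S s)" and t: "t \<in> obj T"
      using vw(1) unfolding x homP by auto
    obtain w' where w: "w = (((), ide S s, \<tau> j), ((), w'), x)" "w' \<in> hom T (\<tau> j) t"
      "k = cmp S (far d w') (ide S s)"
      using vw(2) unfolding x homP by auto
    have vw': "far d v' = far d w'"
      using v(3) w(3) lift[OF v(2) ij(1)] lift[OF w(2) ij(2)] by simp
    have eq: "i = j"
      using unique_liftsD(5)[OF l t ij v(2) w(2) vw'] .
    moreover have "v' = w'"
      using unique_liftsD(6)[OF l t ij(1) v(2)] w(2) vw' eq by simp
    ultimately show "i = j" "v = w"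
      using v(1) w(1) by auto
  qed
qed

text \<open>The common evaluation of comultiplication and counit: \<open>q\<close> will be the pair
  of outer faces in the first case and the map to the terminal groupoid in the second.\<close>

lemma card_over_pull_point:
  assumes S: "groupoid S" and T: "groupoid T" and U: "groupoid U" "locally_finite U"
    and d: "is_functor T S d" and q: "is_functor T U q" and s: "s \<in> obj S"
    and l: "unique_lifts T d S s I \<tau>"
  shows "card_over U (compose_with q (pull_along S T d (point S s))) =
    (\<Sum>i\<in>I. delta (cls U (fob q (\<tau> i))))"
proof -
  have "compose_with q (pull_along S T d (point S s)) =
      (hpullback unit_cat (snd (point S s)) S d T, fcomp q hpullback_proj)"
    by (simp add: compose_with_def pull_along_def point_def)
  then show ?thesis
    using card_over_discrete_reps[OF groupoid_hpullback[OF groupoid_unit_cat S T functor_point[OF S s] d]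
        U functor_fcomp[OF functor_hpullback_proj q] discrete_reps_pull_point[OF S d s l]]
    by (simp add: fcomp_def hpullback_proj_def)
qed

text \<open>In \<open>hfibre\<close> the comparison arrow runs \<open>d t \<rightarrow> s\<close>,
  opposite to the pullback of the point, so the arrows to be lifted are the inverses
  \<open>inv_arr S k\<close>.\<close>

lemma finite_hfibre_unique_lifts:
  assumes S: "groupoid S" and T: "groupoid T" and d: "is_functor T S d" and s: "s \<in> obj S"
    and l: "unique_lifts T d S s I \<tau>"
  shows "finite_groupoid (hfibre T d S s)"
proof -
  interpret S: groupoid S by fact
  interpret F: groupoid "hfibre T d S s"
    using groupoid_hfibre[OF T S d s] .
  note homF = hom_hfibre[OF S s]
  have lift: "cmp S k (far d v) = ide S s \<longleftrightarrow> far d v = inv_arr S k"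
    if "v \<in> hom T (\<tau> i) t" "i \<in> I" "k \<in> hom S (fob d t) s" for v i t k
  proof -
    have "far d v \<in> hom S s (fob d t)"
      using functor_hom[OF d that(1)] unique_liftsD(3)[OF l that(2)] by simp
    from S.cmp_eq_iff[OF that(3) this S.ide_hom[OF s]] show ?thesis
      using S.cmp_ide[OF S.inv_arr(1)[OF that(3)]] by simp
  qed
  have "discrete_reps (hfibre T d S s) I (\<lambda>i. (\<tau> i, ide S s, ()))"
    unfolding discrete_reps_def
  proof (intro conjI ballI allI)
    show "finite I"
      using unique_liftsD(1)[OF l] .
  next
    fix i assume "i \<in> I"
    then show "(\<tau> i, ide S s, ()) \<in> obj (hfibre T d S s)"
      using unique_liftsD(2,3)[OF l] S.ide_hom[OF s] by (auto simp: obj_hfibre)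
  next
    fix x assume "x \<in> obj (hfibre T d S s)"
    then obtain k t where x: "x = (t, k, ())" "t \<in> obj T" "k \<in> hom S (fob d t) s"
      by (cases x) (auto simp: obj_hfibre)
    obtain i v where i: "i \<in> I" "v \<in> hom T (\<tau> i) t" "far d v = inv_arr S k"
      using unique_liftsD(4)[OF l x(2) S.inv_arr(1)[OF x(3)]] by auto
    then have "((\<tau> i, ide S s, ()), (v, ()), x) \<in> hom (hfibre T d S s) (\<tau> i, ide S s, ()) x"
      using x unique_liftsD(2,3)[OF l i(1)] S.ide_hom[OF s] lift[OF i(2,1) x(3)]
      by (auto simp: homF)
    with i(1) show "\<exists>i\<in>I. hom (hfibre T d S s) (\<tau> i, ide S s, ()) x \<noteq> {}"
      by blast
  next
    fix x i j v w
    assume ij: "i \<in> I" "j \<in> I"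
      and vw: "v \<in> hom (hfibre T d S s) (\<tau> i, ide S s, ()) x"
        "w \<in> hom (hfibre T d S s) (\<tau> j, ide S s, ()) x"
    obtain k t where x: "x = (t, k, ())"
      by (cases x) auto
    obtain v' where v: "v = ((\<tau> i, ide S s, ()), (v', ()), x)" "v' \<in> hom T (\<tau> i) t"
      "cmp S k (far d v') = ide S s" and t: "t \<in> obj T" and k: "k \<in> hom S (fob d t) s"
      using vw(1) unfolding x homF by auto
    obtain w' where w: "w = ((\<tau> j, ide S s, ()), (w', ()), x)" "w' \<in> hom T (\<tau> j) t"
      "cmp S k (far d w') = ide S s"
      using vw(2) unfolding x homF by auto
    have vw': "far d v' = far d w'"
      using v(3) w(3) lift[OF v(2) ij(1) k] lift[OF w(2) ij(2) k] by simp
    have eq: "i = j"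
      using unique_liftsD(5)[OF l t ij v(2) w(2) vw'] .
    moreover have "v' = w'"
      using unique_liftsD(6)[OF l t ij(1) v(2)] w(2) vw' eq by simp
    ultimately show "i = j" "v = w"
      using v(1) w(1) by auto
  qed
  then show ?thesis
    by (rule F.finite_groupoid_discrete_reps)
qed

text \<open>Composition alone keeps the terminal groupoid as domain, which has one representative.
  This evaluates the functor induced by a morphism of species.\<close>

lemma card_over_point:
  assumes S: "groupoid S" and U: "groupoid U" "locally_finite U" and q: "is_functor S U q"
    and s: "s \<in> obj S"
  shows "card_over U (compose_with q (point S s)) = delta (cls U (fob q s))"
proof -
  have "discrete_reps unit_cat {()} (\<lambda>_. ())"
    by (simp add: discrete_reps_def hom_unit_cat) (simp add: unit_cat_def)
  from card_over_discrete_reps[OF groupoid_unit_cat U functor_fcomp[OF functor_point[OF S s] q] this]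
  show ?thesis
    by (simp add: compose_with_def point_def fcomp_def)
qed


section \<open>Linear extensions\<close>

text \<open>Summing over any finite superset of the support lets vectors with different supports
  share one index set.\<close>

lemma lookup_lin_ext:
  assumes "finite S" "Poly_Mapping.keys v \<subseteq> S"
  shows "Poly_Mapping.lookup (lin_ext f v) d =
    (\<Sum>b\<in>S. Poly_Mapping.lookup v b * Poly_Mapping.lookup (f b) d)"
proof -
  have "Poly_Mapping.lookup (lin_ext f v) d =
      (\<Sum>b\<in>Poly_Mapping.keys v. Poly_Mapping.lookup v b * Poly_Mapping.lookup (f b) d)"
    by (auto simp: lin_ext_def lookup_sum Poly_Mapping.map.rep_eq when_def intro!: sum.cong)
  also have "\<dots> = (\<Sum>b\<in>S. Poly_Mapping.lookup v b * Poly_Mapping.lookup (f b) d)"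
    using assms by (intro sum.mono_neutral_left) (auto simp: in_keys_iff)
  finally show ?thesis .
qed

lemma lin_ext_delta: "lin_ext f (delta b) = f b"
  by (rule poly_mapping_eqI) (simp add: lookup_lin_ext[of "{b}"] delta_def)

lemma lin_ext_sum: "lin_ext f (\<Sum>i\<in>I. v i) = (\<Sum>i\<in>I. lin_ext f (v i))"
proof (cases "finite I")
  case True
  define S where "S = (\<Union>i\<in>I. Poly_Mapping.keys (v i))"
  have S: "finite S" "Poly_Mapping.keys (\<Sum>i\<in>I. v i) \<subseteq> S" "\<And>i. i \<in> I \<Longrightarrow> Poly_Mapping.keys (v i) \<subseteq> S"
    using True keys_sum[of v I] by (auto simp: S_def)
  show ?thesis
  proof (rule poly_mapping_eqI)
    fix d
    have "Poly_Mapping.lookup (lin_ext f (\<Sum>i\<in>I. v i)) d =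
        (\<Sum>b\<in>S. \<Sum>i\<in>I. Poly_Mapping.lookup (v i) b * Poly_Mapping.lookup (f b) d)"
      by (simp add: lookup_lin_ext[OF S(1,2)] lookup_sum sum_distrib_right)
    also have "\<dots> = (\<Sum>i\<in>I. \<Sum>b\<in>S. Poly_Mapping.lookup (v i) b * Poly_Mapping.lookup (f b) d)"
      by (rule sum.swap)
    finally show "Poly_Mapping.lookup (lin_ext f (\<Sum>i\<in>I. v i)) d =
        Poly_Mapping.lookup (\<Sum>i\<in>I. lin_ext f (v i)) d"
      by (simp add: lookup_sum lookup_lin_ext[OF S(1) S(3)])
  qed
qed (simp add: lin_ext_def)

text \<open>An exchange of two finite sums, over the support of \<open>v\<close> and over a set
  containing the supports of all relevant \<open>f b\<close>. The rules that move
  \<open>push\<close> through \<open>lin_ext\<close> are special cases.\<close>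

lemma lin_ext_lin_ext: "lin_ext g (lin_ext f v) = lin_ext (\<lambda>b. lin_ext g (f b)) v"
proof (rule poly_mapping_eqI)
  fix d
  define K where "K = Poly_Mapping.keys v"
  define S where "S = (\<Union>b\<in>K. Poly_Mapping.keys (f b))"
  have K: "finite K" "Poly_Mapping.keys v \<subseteq> K"
    by (auto simp: K_def)
  have S: "finite S" "\<And>b. b \<in> K \<Longrightarrow> Poly_Mapping.keys (f b) \<subseteq> S"
    using K by (auto simp: S_def)
  have "Poly_Mapping.keys (lin_ext f v) \<subseteq> S"
  proof
    fix x assume "x \<in> Poly_Mapping.keys (lin_ext f v)"
    then have "(\<Sum>b\<in>K. Poly_Mapping.lookup v b * Poly_Mapping.lookup (f b) x) \<noteq> 0"
      by (simp add: in_keys_iff lookup_lin_ext[OF K])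
    then obtain b where "b \<in> K" "Poly_Mapping.lookup (f b) x \<noteq> 0"
      by (metis (no_types, lifting) mult_zero_right sum.neutral)
    then show "x \<in> S"
      using S(2)[of b] by (auto simp: in_keys_iff subset_eq)
  qed
  then have "Poly_Mapping.lookup (lin_ext g (lin_ext f v)) d =
      (\<Sum>x\<in>S. (\<Sum>b\<in>K. Poly_Mapping.lookup v b * Poly_Mapping.lookup (f b) x) *
        Poly_Mapping.lookup (g x) d)"
    by (simp add: lookup_lin_ext[OF S(1)] lookup_lin_ext[OF K])
  also have "\<dots> = (\<Sum>b\<in>K. \<Sum>x\<in>S. Poly_Mapping.lookup v b *
      (Poly_Mapping.lookup (f b) x * Poly_Mapping.lookup (g x) d))"
    by (simp add: sum_distrib_right mult.assoc) (rule sum.swap)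
  also have "\<dots> = Poly_Mapping.lookup (lin_ext (\<lambda>b. lin_ext g (f b)) v) d"
    by (simp add: lookup_lin_ext[OF K] lookup_lin_ext[OF S(1) S(2)] sum_distrib_left)
  finally show "Poly_Mapping.lookup (lin_ext g (lin_ext f v)) d =
      Poly_Mapping.lookup (lin_ext (\<lambda>b. lin_ext g (f b)) v) d" .
qed

lemma lin_ext_cong: "in_span B v \<Longrightarrow> (\<And>b. b \<in> B \<Longrightarrow> f b = g b) \<Longrightarrow> lin_ext f v = lin_ext g v"
  by (auto simp: lin_ext_def in_span_def intro!: sum.cong arg_cong2[where f = Poly_Mapping.map])

lemma push_sum_delta: "push g (\<Sum>i\<in>I. delta (h i)) = (\<Sum>i\<in>I. delta (g (h i)))"
  by (simp add: push_def lin_ext_sum lin_ext_delta)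

lemma lin_ext_push: "lin_ext f (push g v) = lin_ext (\<lambda>b. f (g b)) v"
  by (simp add: push_def lin_ext_lin_ext lin_ext_delta)

lemma push_lin_ext: "push g (lin_ext f v) = lin_ext (\<lambda>b. push g (f b)) v"
  by (simp add: push_def lin_ext_lin_ext)

text \<open>The counit of the incidence coalgebra is a coordinate of a vector, that of Schmitt a
  linear form; this identifies the two presentations.\<close>

lemma lookup_lin_ext_lin_form:
  "Poly_Mapping.lookup (lin_ext f v) d = lin_form (\<lambda>b. Poly_Mapping.lookup (f b) d) v"
  by (simp add: lookup_lin_ext[OF finite_keys subset_refl] lin_form_def)

lemma lin_form_cong: "in_span B v \<Longrightarrow> (\<And>b. b \<in> B \<Longrightarrow> f b = g b) \<Longrightarrow> lin_form f v = lin_form g v"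
  by (auto simp: lin_form_def in_span_def intro!: sum.cong)


section \<open>Structures and layered structures\<close>

abbreviation under :: "'e injection \<times> 'm \<Rightarrow> 'e \<Rightarrow> 'e" where
  "under w \<equiv> fst (snd (fst w))"

context species
begin

text \<open>Labels in \<open>labelled_cat\<close> are single variables rather than pairs; these are
  the preceding facts in that shape.\<close>

lemmas elt_cmp_hom = str_cmp_hom[where s = "fst w" and u = "snd w" and t = "fst w'" and v = "snd w'"
    for w w', unfolded prod.collapse]
  and elt_cmp_ide = str_cmp_ide[where s = "fst w" and u = "snd w" for w, unfolded prod.collapse]
  and elt_cmp_assoc = str_cmp_assoc[where f = "fst w" and u = "snd w" and g = "fst w'" and v = "snd w'"
    and h = "fst w''" and w = "snd w''" for w w' w'', unfolded prod.collapse]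
  and elt_mono = str_mono[where s = "fst w" and u = "snd w" and t = "fst w'" and v = "snd w'"
    and t' = "fst w''" and v' = "snd w''" for w w' w'', unfolded prod.collapse]
  and iso_cmp = str_iso_cmp[where s = "fst w" and u = "snd w" and t = "fst w'" and v = "snd w'"
    for w w', unfolded prod.collapse]
  and iso_inverse = str_iso_inverse[where s = "fst w" and u = "snd w" for w, unfolded prod.collapse]
  and iso_restr = restr_iso[where s = "fst w" and u = "snd w" for w, unfolded prod.collapse]

lemma iso_elt_hom: "w \<in> str_iso R x y \<Longrightarrow> w \<in> elt_hom R x y"
  by (cases w) (simp add: str_iso_elt_hom)

lemma under_bij: "w \<in> str_iso R x y \<Longrightarrow> bij_betw (under w) (fst x) (fst y)"
  by (cases w) (simp add: str_iso_elt_hom)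

lemma under_str_cmp:
  assumes "w \<in> elt_hom R x y" "a \<in> fst x"
  shows "under (str_cmp R Z w' w) a = under w' (under w a)"
proof -
  obtain f u where w: "w = ((fst x, f, fst y), u)"
    using assms(1) by (cases x; cases y) (auto simp: elt_hom_def hom_inj_cat)
  obtain B g D v where w': "w' = ((B, g, D), v)"
    by (cases w') auto
  show ?thesis
    using assms(2) by (simp add: w w' str_cmp_def inj_cat_def compose_def)
qed

lemma under_str_ide: "a \<in> fst x \<Longrightarrow> under (str_ide R x) a = a"
  by (auto simp: str_ide_def ide_inj_cat split: prod.splits)

text \<open>Both sides yield the restriction arrow itself when followed by it, and that arrow is
  monic.\<close>

lemma restr_iso_ide:
  assumes x: "(A, X) \<in> elt R" and B: "B \<subseteq> A"
  shows "restr_iso R B B X (str_ide R (A, X)) = str_ide R (B, restr R A B X)"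
proof -
  note r = restr_ob[OF x B] and ri = restr_arr_hom[OF x B]
  have im: "B = under (str_ide R (A, X)) ` B"
    using B by (auto simp: under_str_ide image_iff subset_eq)
  note rr = iso_restr[OF str_iso_ide[OF x] x x B im]
  show ?thesis
  proof (rule elt_mono[OF ri iso_elt_hom[OF rr(1)] str_ide_hom[OF r] _ r x r])
    show "str_cmp R (snd (A, X)) (restr_arr B (A, X)) (restr_iso R B B X (str_ide R (A, X))) =
        str_cmp R (snd (A, X)) (restr_arr B (A, X)) (str_ide R (B, restr R A B X))"
      using rr(2) elt_cmp_ide[OF ri r x] by simp
  qed
qed

text \<open>The squares of \<open>w\<close> and \<open>w'\<close> are pasted along the restriction
  arrow of \<open>B'\<close>. Both sides then have the same composite with the restriction arrow of
  \<open>B''\<close>, which is cancelled.\<close>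

lemma restr_iso_cmp:
  assumes w: "w \<in> str_iso R (A, X) (A', X')" and w': "w' \<in> str_iso R (A', X') (A'', X'')"
    and x: "(A, X) \<in> elt R" and x': "(A', X') \<in> elt R" and x'': "(A'', X'') \<in> elt R"
    and B: "B \<subseteq> A" "B' = under w ` B" "B'' = under w' ` B'"
  shows "restr_iso R B B'' X'' (str_cmp R X'' w' w) =
    str_cmp R (restr R A'' B'' X'') (restr_iso R B' B'' X'' w') (restr_iso R B B' X' w)"
proof -
  have B': "B' \<subseteq> A'"
    using under_bij[OF w] B by (auto simp: bij_betw_def)
  then have B'': "B'' \<subseteq> A''"
    using under_bij[OF w'] B by (auto simp: bij_betw_def)
  have im: "B'' = under (str_cmp R X'' w' w) ` B"
    unfolding B(2,3) image_image
  proof (rule image_cong[OF refl])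
    fix a assume "a \<in> B"
    with B(1) have "a \<in> fst (A, X)"
      by auto
    from under_str_cmp[OF iso_elt_hom[OF w] this]
    show "under w' (under w a) = under (str_cmp R X'' w' w) a"
      by metis
  qed
  have ww': "str_cmp R X'' w' w \<in> str_iso R (A, X) (A'', X'')"
    using iso_cmp[OF w w' x x' x''] by simp
  note r = restr_ob[OF x B(1)] and r' = restr_ob[OF x' B'] and r'' = restr_ob[OF x'' B'']
  note i = restr_arr_hom[OF x B(1)] and i' = restr_arr_hom[OF x' B'] and i'' = restr_arr_hom[OF x'' B'']
  note e = iso_restr[OF w x x' B(1,2)] and e' = iso_restr[OF w' x' x'' B' B(3)]
    and e'' = iso_restr[OF ww' x x'' B(1) im]
  note h = iso_elt_hom[OF w] iso_elt_hom[OF w'] iso_elt_hom[OF e(1)] iso_elt_hom[OF e'(1)]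
  let ?w = "restr_iso R B B' X' w" and ?w' = "restr_iso R B' B'' X'' w'"
  show ?thesis
  proof (rule elt_mono[OF i'' iso_elt_hom[OF e''(1)] _ _ r'' x'' r])
    show "str_cmp R (restr R A'' B'' X'') ?w' ?w \<in> elt_hom R (B, restr R A B X) (B'', restr R A'' B'' X'')"
      using elt_cmp_hom[OF h(3,4) r r' r''] by simp
    have "str_cmp R X'' (str_cmp R X'' w' w) (restr_arr B (A, X)) =
        str_cmp R X'' w' (str_cmp R X' w (restr_arr B (A, X)))"
      using elt_cmp_assoc[OF i h(1,2) r x x' x''] by simp
    also have "\<dots> = str_cmp R X'' w' (str_cmp R X' (restr_arr B' (A', X')) ?w)"
      using e(2) by simp
    also have "\<dots> = str_cmp R X'' (str_cmp R X'' w' (restr_arr B' (A', X'))) ?w"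
      using elt_cmp_assoc[OF h(3) i' h(2) r r' x' x''] by simp
    also have "\<dots> = str_cmp R X'' (str_cmp R X'' (restr_arr B'' (A'', X'')) ?w') ?w"
      using e'(2) by simp
    also have "\<dots> = str_cmp R X'' (restr_arr B'' (A'', X'')) (str_cmp R (restr R A'' B'' X'') ?w' ?w)"
      using elt_cmp_assoc[OF h(3,4) i'' r r' r'' x''] by simp
    finally show "str_cmp R (snd (A'', X'')) (restr_arr B'' (A'', X''))
        (restr_iso R B B'' X'' (str_cmp R X'' w' w)) =
      str_cmp R (snd (A'', X'')) (restr_arr B'' (A'', X'')) (str_cmp R (restr R A'' B'' X'') ?w' ?w)"
      using e''(2) by simp
  qed
qed

lemma structures_labelled_cat:
  "structures R = labelled_cat (elt R) (str_iso R) (str_ide R) (\<lambda>z. str_cmp R (snd z))"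
  by (auto simp: structures_def labelled_cat_def elt_def Let_def fun_eq_iff)

lemma groupoid_structures: "groupoid (structures R)"
  unfolding structures_labelled_cat
proof (rule groupoid_labelled_cat, goal_cases)
  case (3 x y u)
  then show ?case
    using elt_cmp_ide[OF iso_elt_hom] by blast
next
  case (4 x y z t u v w)
  then show ?case
    by (intro elt_cmp_assoc iso_elt_hom)
next
  case (5 x y u)
  then show ?case
    using iso_inverse[of u x y] by metis
qed (simp_all add: str_iso_ide iso_cmp)

lemma obj_structures: "obj (structures R) = elt R"
  by (simp add: structures_labelled_cat labelled_cat_simps)

lemma hom_structures_empty_iff:
  "hom (structures R) x y \<noteq> {} \<longleftrightarrow> str_iso R x y \<noteq> {} \<and> x \<in> elt R \<and> y \<in> elt R"
  using hom_labelled_cat[of _ "elt R" "str_iso R" "str_ide R" "\<lambda>z. str_cmp R (snd z)" x y]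
  unfolding structures_labelled_cat by blast

section \<open>Layered structures with their face and degeneracy functors\<close>

definition layered :: "nat \<Rightarrow> ('e, 'x) layered set" where
  "layered n = {(A, p, X). (A, X) \<in> elt R \<and> p \<in> A \<rightarrow>\<^sub>E {1..n}}"

definition layered_iso :: "('e, 'x) layered \<Rightarrow> ('e, 'x) layered \<Rightarrow> ('e injection \<times> 'm) set" where
  "layered_iso = (\<lambda>(A, p, X) (B, q, Y). {w \<in> str_iso R (A, X) (B, Y). \<forall>a\<in>A. q (under w a) = p a})"

lemma layered_labelled_cat:
  "layered_structures R n = labelled_cat (layered n) layered_iso
     (\<lambda>x. str_ide R (forget_layers x)) (\<lambda>z. str_cmp R (snd (snd z)))"
  by (auto simp: layered_structures_def labelled_cat_def layered_def layered_iso_def elt_def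
      Let_def fun_eq_iff)

lemma layered_isoD:
  assumes "w \<in> layered_iso x y" "x \<in> layered n" "y \<in> layered n"
  shows "w \<in> str_iso R (forget_layers x) (forget_layers y)" "forget_layers x \<in> elt R"
    "forget_layers y \<in> elt R" "a \<in> fst x \<Longrightarrow> fst (snd y) (under w a) = fst (snd x) a"
  using assms by (auto simp: layered_iso_def layered_def forget_layers_def)

lemma layered_isoI:
  "w \<in> str_iso R (forget_layers x) (forget_layers y) \<Longrightarrow>
    (\<And>a. a \<in> fst x \<Longrightarrow> fst (snd y) (under w a) = fst (snd x) a) \<Longrightarrow> w \<in> layered_iso x y"
  by (cases x; cases y) (auto simp: layered_iso_def forget_layers_def)

lemma fst_forget_layers: "fst (forget_layers x) = fst x" and
  snd_forget_layers: "snd (forget_layers x) = snd (snd x)"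
  by (simp_all add: forget_layers_def split: prod.split)

lemma layered_iso_ide: "x \<in> layered n \<Longrightarrow> str_ide R (forget_layers x) \<in> layered_iso x x"
  using str_iso_ide under_str_ide[of _ "forget_layers x"]
  by (intro layered_isoI) (auto simp: layered_def forget_layers_def)

lemma layered_iso_cmp:
  assumes u: "u \<in> layered_iso x y" and v: "v \<in> layered_iso y z"
    and ob: "x \<in> layered n" "y \<in> layered n" "z \<in> layered n"
  shows "str_cmp R (snd (snd z)) v u \<in> layered_iso x z"
proof (rule layered_isoI)
  note u = layered_isoD[OF u ob(1,2)] and v = layered_isoD[OF v ob(2,3)]
  show "str_cmp R (snd (snd z)) v u \<in> str_iso R (forget_layers x) (forget_layers z)"
    using iso_cmp[OF u(1) v(1) u(2,3) v(3)] by (simp add: snd_forget_layers)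
  fix a assume a: "a \<in> fst x"
  then have "under u a \<in> fst y"
    using bij_betwE[OF under_bij[OF u(1)]] by (simp add: fst_forget_layers)
  then show "fst (snd z) (under (str_cmp R (snd (snd z)) v u) a) = fst (snd x) a"
    using u(4)[OF a] v(4) under_str_cmp[OF iso_elt_hom[OF u(1)]] a by (simp add: fst_forget_layers)
qed

lemma groupoid_layered: "groupoid (layered_structures R n)"
  unfolding layered_labelled_cat
proof (rule groupoid_labelled_cat, goal_cases)
  case (1 x)
  then show ?case
    by (rule layered_iso_ide)
next
  case (2 x y z u v)
  then show ?case
    by (intro layered_iso_cmp)
next
  case (3 x y u)
  note u = layered_isoD[OF 3(3,1,2)]
  show ?case
    using elt_cmp_ide[OF iso_elt_hom[OF u(1)] u(2,3)] by (simp add: snd_forget_layers)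
next
  case (4 x y z t u v w)
  note u = layered_isoD[OF 4(5,1,2)] and v = layered_isoD[OF 4(6,2,3)] and w = layered_isoD[OF 4(7,3,4)]
  show ?case
    using elt_cmp_assoc[OF u(1)[THEN iso_elt_hom] v(1)[THEN iso_elt_hom] w(1)[THEN iso_elt_hom]
        u(2,3) v(3) w(3)] by (simp add: snd_forget_layers)
next
  case (5 x y u)
  note u = layered_isoD[OF 5(3,1,2)]
  obtain t v where v: "(t, v) \<in> str_iso R (forget_layers y) (forget_layers x)"
    "str_cmp R (snd (snd x)) (t, v) u = str_ide R (forget_layers x)"
    "str_cmp R (snd (snd y)) u (t, v) = str_ide R (forget_layers y)"
    using iso_inverse[OF u(1,2,3)] unfolding snd_forget_layers by blast
  have "(t, v) \<in> layered_iso y x"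
  proof (rule layered_isoI[OF v(1)])
    fix b assume b: "b \<in> fst y"
    have "under (t, v) b \<in> fst x"
      using bij_betwE[OF under_bij[OF v(1)]] b by (simp add: fst_forget_layers)
    \<comment> \<open>Compatibility with the layers is known for \<open>u\<close>; it is applied at
      \<open>under (t, v) b\<close>, which \<open>u\<close> sends back to \<open>b\<close> by
      \<open>v(3)\<close>.\<close>
    then have "fst (snd x) (under (t, v) b) = fst (snd y) (under u (under (t, v) b))"
      using u(4) by simp
    also have "under u (under (t, v) b) = under (str_ide R (forget_layers y)) b"
      using under_str_cmp[OF iso_elt_hom[OF v(1)], of b "snd (snd y)" u] b
      unfolding v(3) fst_forget_layers by simp
    finally show "fst (snd x) (under (t, v) b) = fst (snd y) b"
      using under_str_ide[of b "forget_layers y"] b by (simp add: fst_forget_layers)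
  qed
  with v(2,3) show ?case
    by blast
qed

lemma obj_layered: "obj (layered_structures R n) = layered n"
  by (simp add: layered_labelled_cat labelled_cat_simps)

lemma hom_layered:
  "f \<in> hom (layered_structures R n) x y \<longleftrightarrow>
    (\<exists>w\<in>layered_iso x y. f = (x, w, y)) \<and> x \<in> layered n \<and> y \<in> layered n"
  by (simp add: layered_labelled_cat hom_labelled_cat)

text \<open>Isomorphisms match layers, so they match what an outer face deletes. This supplies the
  image condition under which \<open>restr_iso\<close> is available.\<close>

lemma kept_iso:
  assumes w: "w \<in> layered_iso (A, p, X) (B, q, Y)" and x: "(A, p, X) \<in> layered n"
    and y: "(B, q, Y) \<in> layered n"
  shows "kept N i B q = under w ` kept N i A p"
proof -
  note w = layered_isoD[OF w x y]
  have "under w ` A = B"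
    using under_bij[OF w(1)] by (simp add: bij_betw_def fst_forget_layers)
  moreover have "q (under w a) = p a" if "a \<in> A" for a
    using w(4) that by simp
  ultimately show ?thesis
    unfolding kept_def by (auto simp: image_iff)
qed

lemma kept_inner: "0 < i \<Longrightarrow> i < n \<Longrightarrow> kept n i A p = A"
  by (auto simp: kept_def)

lemma kept_subset: "kept n i A p \<subseteq> A"
  by (auto simp: kept_def)

lemma face_layered:
  assumes "(A, p, X) \<in> layered (Suc n)" "i \<le> Suc n"
  shows "face_ob R (Suc n) i (A, p, X) \<in> layered n"
proof -
  have p: "1 \<le> p a" "p a \<le> Suc n" if "a \<in> A" for a
    using assms(1) that by (auto simp: layered_def PiE_iff)
  \<comment> \<open>For \<open>i = 0\<close> the kept layers start at 2 and shift down; for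
    \<open>i = Suc n\<close> they end at \<open>n\<close> and stay; in between only those above
    \<open>i\<close> shift. From one layer, either outer face leaves the empty set.\<close>
  have "(if p a \<le> i then p a else p a - 1) \<in> {1..n}" if "a \<in> kept (Suc n) i A p" for a
    using p[of a] that assms(2) by (auto simp: kept_def)
  moreover have "(kept (Suc n) i A p, if 0 < i \<and> i < Suc n then X else restr R A (kept (Suc n) i A p) X) \<in> elt R"
    using restr_ob[OF _ kept_subset] kept_inner[of i "Suc n" A p] assms(1)
    by (auto simp: layered_def)
  ultimately show ?thesis
    by (simp add: face_ob_def Let_def layered_def)
qed

text \<open>Inner faces leave labels alone and outer faces restrict them, so functoriality is either
  immediate or that of \<open>restr_iso\<close>.\<close>

lemma functor_face:
  assumes i: "i \<le> Suc n"
  shows "is_functor (layered_structures R (Suc n)) (layered_structures R n)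
    \<lparr>fob = face_ob R (Suc n) i, far = face_ar R (Suc n) i\<rparr>"
proof -
  define inner where "inner \<longleftrightarrow> 0 < i \<and> i < Suc n"
  let ?kept = "kept (Suc n) i"
  define g :: "('e, 'x) layered \<Rightarrow> 'e injection \<times> 'm \<Rightarrow> ('e, 'x) layered \<Rightarrow> 'e injection \<times> 'm"
    where "g = (\<lambda>(A, p, X) w (A', p', X'). if inner then w
    else restr_iso R (?kept A p) (?kept A' p') X' w)"
  have fob: "face_ob R (Suc n) i (A, p, X) = (?kept A p, \<lambda>a\<in>?kept A p. if p a \<le> i then p a else p a - 1,
      if inner then X else restr R A (?kept A p) X)" for A p X
    by (simp add: face_ob_def Let_def inner_def)
  \<comment> \<open>In both cases the new label has the old underlying map on the kept elements,
    which is all that compatibility with layers depends on.\<close>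
  have iso: "g x w y \<in> str_iso R (forget_layers (face_ob R (Suc n) i x)) (forget_layers (face_ob R (Suc n) i y)) \<and>
      (\<forall>a\<in>fst (face_ob R (Suc n) i x). under (g x w y) a = under w a)"
    if w: "w \<in> layered_iso x y" and x: "x \<in> layered (Suc n)" and y: "y \<in> layered (Suc n)" for x y w
  proof -
    obtain A p X B q Y where eq: "x = (A, p, X)" "y = (B, q, Y)"
      by (metis prod_cases3)
    note w' = layered_isoD[OF w x y, unfolded eq forget_layers_def prod.case]
    note k = kept_iso[OF w[unfolded eq] x[unfolded eq] y[unfolded eq], of "Suc n" i]
    show ?thesis
    proof (cases inner)
      case True
      then show ?thesis
        using w' by (simp add: eq fob forget_layers_def g_def kept_inner inner_def)
    next
      case False
      then show ?thesis
        using iso_restr[OF w'(1-3) kept_subset k] by (simp add: eq fob forget_layers_def g_def)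
    qed
  qed
  show ?thesis
    unfolding layered_labelled_cat
  proof (rule functor_labelled_cat[where g = g], goal_cases)
    case (1 x)
    then show ?case
      using face_layered[OF _ i] by (cases x) auto
  next
    case (2 x u y)
    then show ?case
      by (cases x; cases y) (simp add: face_ar_def g_def inner_def)
  next
    case (3 x u y)
    obtain A p X B q Y where eq: "x = (A, p, X)" "y = (B, q, Y)"
      by (metis prod_cases3)
    note u = layered_isoD[OF 3(3,1,2)]
    note k = kept_iso[OF 3(3,1,2)[unfolded eq], of "Suc n" i]
    show ?case
      unfolding fctr.select_convs
    proof (rule layered_isoI)
      show "g x u y \<in> str_iso R (forget_layers (face_ob R (Suc n) i x)) (forget_layers (face_ob R (Suc n) i y))"
        using iso[OF 3(3,1,2)] by simp
      fix a assume a: "a \<in> fst (face_ob R (Suc n) i x)"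
      then have "a \<in> ?kept A p" "under u a \<in> ?kept B q"
        using k by (auto simp: eq fob)
      moreover have "q (under u a) = p a"
        using u(4)[of a] subsetD[OF kept_subset \<open>a \<in> ?kept A p\<close>] by (simp add: eq)
      ultimately show "fst (snd (face_ob R (Suc n) i y)) (under (g x u y) a) =
          fst (snd (face_ob R (Suc n) i x)) a"
        using iso[OF 3(3,1,2)] a by (simp add: eq fob)
    qed
  next
    case (4 x)
    obtain A p X where eq: "x = (A, p, X)"
      by (metis prod_cases3)
    have "(A, X) \<in> elt R"
      using 4 by (auto simp: eq layered_def)
    then have "g x (str_ide R (forget_layers x)) x = str_ide R (forget_layers (face_ob R (Suc n) i x))"
      using restr_iso_ide[OF _ kept_subset]
      by (auto simp: eq fob g_def forget_layers_def kept_inner inner_def)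
    then show ?case
      using layered_iso_ide[OF 4] by simp
  next
    case (5 x y z u v)
    obtain A p X B q Y D r Z where eq: "x = (A, p, X)" "y = (B, q, Y)" "z = (D, r, Z)"
      by (metis prod_cases3)
    note u = layered_isoD[OF 5(4,1,2), unfolded eq forget_layers_def prod.case]
      and v = layered_isoD[OF 5(5,2,3), unfolded eq forget_layers_def prod.case]
    note k = kept_iso[OF 5(4,1,2)[unfolded eq], of "Suc n" i] kept_iso[OF 5(5,2,3)[unfolded eq], of "Suc n" i]
    show ?case
      using layered_iso_cmp[OF 5(4,5,1-3)] restr_iso_cmp[OF u(1) v(1) u(2,3) v(3) kept_subset k]
      by (simp add: eq fob g_def)
  qed
qed

lemma functor_degen:
  assumes i: "i \<le> n"
  shows "is_functor (layered_structures R n) (layered_structures R (Suc n))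
    \<lparr>fob = degen_ob i, far = (\<lambda>(x, w, y). (degen_ob i x, w, degen_ob i y))\<rparr>"
proof -
  have forget: "forget_layers (degen_ob i x) = forget_layers x" "fst (degen_ob i x) = fst x"
    "snd (snd (degen_ob i x)) = snd (snd x)" for x :: "('e, 'x) layered"
    by (simp_all add: degen_ob_def forget_layers_def split: prod.splits)
  have layer: "fst (snd (degen_ob i x)) a =
      (if fst (snd x) a \<le> i then fst (snd x) a else fst (snd x) a + 1)"
    if "a \<in> fst x" for x :: "('e, 'x) layered" and a
    using that by (cases x) (simp add: degen_ob_def)
  show ?thesis
    unfolding layered_labelled_cat
  proof (rule functor_labelled_cat[where g = "\<lambda>x w y. w"], goal_cases)
    case (1 x)
    then show ?case
      by (auto simp: layered_def degen_ob_def PiE_iff)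
  next
    case (3 x u y)
    note u = layered_isoD[OF 3(3,1,2)]
    show ?case
      unfolding fctr.select_convs
    proof (rule layered_isoI)
      fix a assume a: "a \<in> fst (degen_ob i x)"
      then have "under u a \<in> fst y"
        using bij_betwE[OF under_bij[OF u(1)]] by (simp add: fst_forget_layers forget)
      then show "fst (snd (degen_ob i y)) (under u a) = fst (snd (degen_ob i x)) a"
        using u(4)[of a] a by (simp add: layer forget)
    qed (simp add: u(1) forget)
  next
    case (5 x y z u v)
    then show ?case
      using layered_iso_cmp[OF 5(4,5,1-3)] by (simp add: forget)
  qed (simp_all add: forget layered_iso_ide)
qed

text \<open>An automorphism consists of a self-injection of a finite set and an arrow of the locally
  finite groupoid \<open>val R A\<close> out of \<open>X\<close>; there are finitely many of
  each.\<close>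

lemma locally_finite_layered:
  assumes "\<And>A. finite A \<Longrightarrow> locally_finite (val R A)"
  shows "locally_finite (layered_structures R n)"
  unfolding locally_finite_def
proof
  fix x assume "x \<in> obj (layered_structures R n)"
  then obtain A p X where x: "x = (A, p, X)" "finite A" "X \<in> obj (val R A)"
    by (auto simp: obj_layered layered_def elt_def)
  interpret groupoid "val R A"
    using x(2) by (rule groupoid_val)
  have "hom inj_cat A A \<subseteq> (\<lambda>f. (A, f, A)) ` (A \<rightarrow>\<^sub>E A)"
    by (auto simp: hom_inj_cat)
  then have "finite (hom inj_cat A A)"
    using x(2) by (meson finite_PiE finite_imageI finite_subset)
  moreover have "finite (hom (val R A) X Y)" for Y
    using finite_hom assms[OF x(2)] x(3) by (simp add: locally_finite_def)
  ultimately have "finite (SIGMA s:hom inj_cat A A. hom (val R A) X (fob (act R s) X))"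
    by blast
  moreover have "aut (layered_structures R n) x \<subseteq>
      (\<lambda>w. (x, w, x)) ` (SIGMA s:hom inj_cat A A. hom (val R A) X (fob (act R s) X))"
    by (auto simp: aut_def hom_layered layered_iso_def x(1) str_iso_def)
  ultimately show "finite (aut (layered_structures R n) x)"
    by (meson finite_imageI finite_subset)
qed

end


section \<open>The incidence coalgebra of the decomposition space\<close>

definition single_layer :: "'e set \<times> 'x \<Rightarrow> ('e, 'x) layered" where
  "single_layer = (\<lambda>(A, X). (A, \<lambda>a\<in>A. 1, X))"

definition splittings :: "'e set \<Rightarrow> ('e set \<times> 'e set) set" where
  "splittings A = {(A1, A2). A1 \<inter> A2 = {} \<and> A1 \<union> A2 = A}"

definition split_layers :: "'e set \<times> 'x \<Rightarrow> 'e set \<times> 'e set \<Rightarrow> ('e, 'x) layered" where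
  "split_layers = (\<lambda>(A, X) (A1, A2). (A, \<lambda>a\<in>A. if a \<in> A1 then 1 else 2, X))"

lemma forget_single_layer: "forget_layers (single_layer x) = x"
  by (simp add: forget_layers_def single_layer_def split: prod.split)

lemma congruent_compose: "f respects r \<Longrightarrow> (\<lambda>x. g (f x)) respects r"
  by (rule congruentI) (metis congruentD)

lemma inj_single_layer: "inj single_layer"
  by (metis forget_single_layer injI)

lemma finite_splittings: "finite A \<Longrightarrow> finite (splittings A)"
  by (rule finite_subset[of _ "Pow A \<times> Pow A"]) (auto simp: splittings_def)

lemma decomp_simps:
  "lev (decomp R) n = layered_structures R n"
  "face (decomp R) n i = \<lparr>fob = face_ob R n i, far = face_ar R n i\<rparr>"
  "degen (decomp R) n i = \<lparr>fob = degen_ob i, far = (\<lambda>(x, w, y). (degen_ob i x, w, degen_ob i y))\<rparr>"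
  by (simp_all add: decomp_def)

lemma cls_unit_cat: "cls unit_cat () = {()}"
  by (auto simp: cls_def iso_rel_def hom_unit_cat) (simp add: unit_cat_def)

lemma locally_finite_unit_cat: "locally_finite unit_cat"
  by (simp add: locally_finite_def aut_def hom_unit_cat)

context species
begin

sublocale Str: groupoid "structures R"
  by (rule groupoid_structures)

sublocale Lay: groupoid "layered_structures R n" for n
  by (rule groupoid_layered)

lemma single_layer_layered: "x \<in> elt R \<Longrightarrow> single_layer x \<in> layered 1"
  by (cases x) (auto simp: single_layer_def layered_def simp del: One_nat_def)

lemma single_layer_forget:
  assumes "x \<in> layered 1"
  shows "single_layer (forget_layers x) = x"
proof -
  obtain A p X where x: "x = (A, p, X)" "p \<in> A \<rightarrow>\<^sub>E {1..1}"
    using assms by (auto simp: layered_def)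
  then have "p = (\<lambda>a\<in>A. 1)"
    by (auto simp: PiE_iff extensional_def fun_eq_iff simp del: One_nat_def)
  with x show ?thesis
    by (simp add: single_layer_def forget_layers_def)
qed

lemma layered_one: "layered 1 = single_layer ` elt R"
proof (intro equalityI subsetI)
  fix x assume x: "x \<in> layered 1"
  then have "forget_layers x \<in> elt R"
    by (auto simp: layered_def forget_layers_def)
  then show "x \<in> single_layer ` elt R"
    using single_layer_forget[OF x] by (metis imageI)
next
  fix x assume "x \<in> single_layer ` elt R"
  then show "x \<in> layered 1"
    using single_layer_layered by blast
qed

text \<open>Both layer functions are constant on their carriers, so compatibility holds
  automatically.\<close>

lemma layered_iso_single_layer: "layered_iso (single_layer x) (single_layer y) = str_iso R x y"
proof -
  have "under w a \<in> fst y" if "w \<in> str_iso R x y" "a \<in> fst x" for w a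
    using bij_betwE[OF under_bij[OF that(1)]] that(2) by blast
  then show ?thesis
    by (cases x; cases y) (auto simp: layered_iso_def single_layer_def)
qed

lemma hom_single_layer_iff:
  assumes "x \<in> elt R" "y \<in> elt R"
  shows "hom (layered_structures R 1) (single_layer x) (single_layer y) \<noteq> {} \<longleftrightarrow> str_iso R x y \<noteq> {}"
proof -
  have "single_layer x \<in> layered 1" "single_layer y \<in> layered 1"
    using assms by (simp_all only: single_layer_layered)
  then show ?thesis
    using hom_layered[of _ 1 "single_layer x" "single_layer y"]
    unfolding layered_iso_single_layer by blast
qed

lemma one_layer_eq: "one_layer c = single_layer ` c"
  by (simp add: one_layer_def single_layer_def)

lemma one_layer_cls:
  assumes x: "x \<in> elt R"
  shows "one_layer (cls (structures R) x) = cls (layered_structures R 1) (single_layer x)"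
proof -
  have cls: "cls (structures R) x = {y \<in> elt R. str_iso R x y \<noteq> {}}"
    using Str.mem_cls_iff[of x] x unfolding obj_structures hom_structures_empty_iff by blast
  have "z \<in> cls (layered_structures R 1) (single_layer x) \<longleftrightarrow>
      z \<in> single_layer ` {y \<in> elt R. str_iso R x y \<noteq> {}}" for z
  proof -
    have "z \<in> cls (layered_structures R 1) (single_layer x) \<longleftrightarrow>
        z \<in> single_layer ` elt R \<and> hom (layered_structures R 1) (single_layer x) z \<noteq> {}"
      using Lay.mem_cls_iff[of "single_layer x" 1 z] single_layer_layered[OF x]
      unfolding obj_layered layered_one[symmetric] by blast
    also have "\<dots> \<longleftrightarrow> (\<exists>y\<in>elt R. z = single_layer y \<and> str_iso R x y \<noteq> {})"
      using hom_single_layer_iff[OF x] by blast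
    finally show ?thesis
      by blast
  qed
  then show ?thesis
    unfolding one_layer_eq cls by blast
qed

lemma bij_betw_one_layer:
  "bij_betw one_layer (pi0 (structures R)) (pi0 (layered_structures R 1))"
proof (rule bij_betw_imageI)
  show "inj_on one_layer (pi0 (structures R))"
    unfolding inj_on_def one_layer_eq using inj_image_eq_iff[OF inj_single_layer] by blast
  show "one_layer ` pi0 (structures R) = pi0 (layered_structures R 1)"
    unfolding pi0_cls obj_structures obj_layered layered_one image_image
    by (intro image_cong refl one_layer_cls)
qed

section \<open>Unique lifts along the inner face and the degeneracy\<close>

lemma split_layers_layered:
  "x \<in> elt R \<Longrightarrow> split_layers x i \<in> layered 2"
  by (auto simp: split_layers_def layered_def split: prod.splits)

lemma face_inner: "face_ob R 2 1 (A, p, X) = (A, \<lambda>a\<in>A. if p a \<le> 1 then p a else p a - 1, X)"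
  by (simp add: face_ob_def Let_def kept_inner)

lemma face_inner_layered:
  assumes "y \<in> layered 2"
  shows "face_ob R 2 1 y = single_layer (forget_layers y)"
proof -
  obtain A p X where y: "y = (A, p, X)" "p \<in> A \<rightarrow>\<^sub>E {1..2}"
    using assms by (auto simp: layered_def)
  have "(if p a \<le> 1 then p a else p a - 1) = 1" if "a \<in> A" for a
  proof -
    have "1 \<le> p a" "p a \<le> 2"
      using y(2) that by (auto simp: PiE_iff)
    then show ?thesis
      by auto
  qed
  then show ?thesis
    unfolding y(1) face_inner by (simp add: single_layer_def forget_layers_def cong: restrict_cong)
qed

lemma forget_split_layers: "forget_layers (split_layers x i) = x"
  by (simp add: split_layers_def forget_layers_def split: prod.split)

text \<open>The inner face keeps the label \<open>w\<close> of an arrow, so a lift can only carry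
  the same label. Compatibility with the layers of \<open>t\<close> then leaves one choice of layers
  on the domain, that is, one splitting.\<close>

lemma unique_lifts_face:
  assumes x: "x \<in> elt R"
  shows "unique_lifts (layered_structures R 2) \<lparr>fob = face_ob R 2 1, far = face_ar R 2 1\<rparr>
    (layered_structures R 1) (single_layer x) (splittings (fst x)) (split_layers x)"
proof -
  have far: "face_ar R 2 1 (y, w, z) = (face_ob R 2 1 y, w, face_ob R 2 1 z)" for y w z
    by (simp add: face_ar_def split: prod.split)
  have layer: "fst (snd (split_layers x i)) a = (if a \<in> fst i then 1 else 2)" if "a \<in> fst x" for i a
    using that by (cases x; cases i) (simp add: split_layers_def)
  have fst: "fst (split_layers x i) = fst x" for i
    by (simp add: split_layers_def split: prod.split)
  show ?thesis
    unfolding unique_lifts_def obj_layered fctr.select_convs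
  proof (intro conjI ballI impI)
    show "finite (splittings (fst x))"
      using x by (intro finite_splittings) (auto simp: elt_def)
  next
    fix i assume "i \<in> splittings (fst x)"
    show s: "split_layers x i \<in> layered 2"
      by (rule split_layers_layered[OF x])
    then show "face_ob R 2 1 (split_layers x i) = single_layer x"
      by (simp add: face_inner_layered forget_split_layers del: One_nat_def)
  next
    fix t k
    assume t: "t \<in> layered 2" and k: "k \<in> hom (layered_structures R 1) (single_layer x) (face_ob R 2 1 t)"
    obtain w where w: "k = (single_layer x, w, face_ob R 2 1 t)" "w \<in> str_iso R x (forget_layers t)"
      using k unfolding hom_layered face_inner_layered[OF t] layered_iso_single_layer by auto
    \<comment> \<open>The preimages of layer 1 and of its complement; the latter is layer 2, since
      the layers of \<open>t\<close> lie in \<open>{1..2}\<close>.\<close>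
    define i where "i = ({a \<in> fst x. fst (snd t) (under w a) = 1}, {a \<in> fst x. fst (snd t) (under w a) \<noteq> 1})"
    have i: "i \<in> splittings (fst x)"
      by (auto simp: i_def splittings_def)
    have "w \<in> layered_iso (split_layers x i) t"
    proof (rule layered_isoI)
      show "w \<in> str_iso R (forget_layers (split_layers x i)) (forget_layers t)"
        using w(2) by (simp add: forget_split_layers)
      fix a assume "a \<in> fst (split_layers x i)"
      then have a: "a \<in> fst x"
        by (simp add: fst)
      then have "under w a \<in> fst t"
        using bij_betwE[OF under_bij[OF w(2)]] by (simp add: fst_forget_layers)
      then have "fst (snd t) (under w a) \<in> {1..2}"
        using t by (auto simp: layered_def PiE_iff)
      then show "fst (snd t) (under w a) = fst (snd (split_layers x i)) a"
        unfolding layer[OF a] using a by (auto simp: i_def)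
    qed
    then have "(split_layers x i, w, t) \<in> hom (layered_structures R 2) (split_layers x i) t"
      using t split_layers_layered[OF x] by (simp add: hom_layered)
    moreover have "face_ar R 2 1 (split_layers x i, w, t) = k"
      unfolding far w(1) using face_inner_layered[OF split_layers_layered[OF x]]
      by (simp add: forget_split_layers)
    ultimately show "\<exists>i\<in>splittings (fst x). \<exists>v\<in>hom (layered_structures R 2) (split_layers x i) t.
        face_ar R 2 1 v = k"
      using i by blast
  next
    fix t i j v v'
    assume t: "t \<in> layered 2" and ij: "i \<in> splittings (fst x)" "j \<in> splittings (fst x)"
      and v: "v \<in> hom (layered_structures R 2) (split_layers x i) t"
      and v': "v' \<in> hom (layered_structures R 2) (split_layers x j) t"
      and eq: "face_ar R 2 1 v = face_ar R 2 1 v'"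
    obtain w where w: "v = (split_layers x i, w, t)" "w \<in> layered_iso (split_layers x i) t"
      using v by (auto simp: hom_layered)
    have w': "v' = (split_layers x j, w, t)" "w \<in> layered_iso (split_layers x j) t"
      using v' eq unfolding w(1) hom_layered by (auto simp: far simp del: One_nat_def)
    \<comment> \<open>The values 1 and 2 recover the first part of a splitting, and the second part
      is its complement.\<close>
    have "a \<in> fst i \<longleftrightarrow> a \<in> fst j" if a: "a \<in> fst x" for a
    proof -
      have "fst (snd (split_layers x i)) a = fst (snd (split_layers x j)) a"
        using layered_isoD(4)[OF w(2) split_layers_layered[OF x] t, of a]
          layered_isoD(4)[OF w'(2) split_layers_layered[OF x] t, of a] a unfolding fst by metis
      then show ?thesis
        unfolding layer[OF a] by (auto split: if_splits)
    qed
    moreover have sub: "fst k \<subseteq> fst x" "snd k = fst x - fst k" if "k \<in> splittings (fst x)" for k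
      using that by (auto simp: splittings_def)
    ultimately have "fst i = fst j"
      using sub(1)[OF ij(1)] sub(1)[OF ij(2)] by blast
    then show "i = j"
      using sub(2)[OF ij(1)] sub(2)[OF ij(2)] by (simp add: prod_eq_iff)
    then show "v = v'"
      using w w' by simp
  qed
qed

text \<open>A function into \<open>{1..0}\<close> has empty domain, so \<open>layered 0\<close>
  holds only structures on the empty set. If \<open>fst x = {}\<close>, the object
  \<open>single_layer x\<close> lies in both degrees and is fixed by the degeneracy; otherwise no
  bijection leads from \<open>x\<close> to an object in its image.\<close>

lemma unique_lifts_degen:
  assumes x: "x \<in> elt R"
  shows "unique_lifts (layered_structures R 0)
    \<lparr>fob = degen_ob 0, far = (\<lambda>(x, w, y). (degen_ob 0 x, w, degen_ob 0 y))\<rparr>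
    (layered_structures R 1) (single_layer x) (if fst x = {} then {()} else {}) (\<lambda>_. single_layer x)"
proof -
  have empty: "A = {}" if "(A, p, X) \<in> layered 0" for A p X
    using that by (auto simp: layered_def PiE_iff)
  have single: "degen_ob 0 t = single_layer (forget_layers t)" if "t \<in> layered 0" for t :: "('e, 'x) layered"
  proof (cases t)
    case (fields A p X)
    with that empty have "A = {}"
      by blast
    with fields show ?thesis
      by (simp add: degen_ob_def single_layer_def forget_layers_def fun_eq_iff)
  qed
  have x0: "single_layer x \<in> layered 0" if "fst x = {}"
    using that x by (cases x) (auto simp: single_layer_def layered_def)
  show ?thesis
    unfolding unique_lifts_def obj_layered fctr.select_convs
  proof (intro conjI ballI impI)
    fix i assume "i \<in> (if fst x = {} then {()} else {})"
    then show "single_layer x \<in> layered 0"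
      using x0 by (auto split: if_splits)
    then show "degen_ob 0 (single_layer x) = single_layer x"
      by (simp add: single forget_single_layer)
  next
    fix t k
    assume t: "t \<in> layered 0" and k: "k \<in> hom (layered_structures R 1) (single_layer x) (degen_ob 0 t)"
    obtain w where w: "k = (single_layer x, w, degen_ob 0 t)" "w \<in> str_iso R x (forget_layers t)"
      using k unfolding hom_layered single[OF t] layered_iso_single_layer by auto
    have t0: "fst t = {}"
      using empty t by (cases t) auto
    then have x1: "fst x = {}"
      using under_bij[OF w(2)] by (simp add: bij_betw_def fst_forget_layers)
    have "w \<in> layered_iso (single_layer x) t"
    proof (rule layered_isoI)
      show "w \<in> str_iso R (forget_layers (single_layer x)) (forget_layers t)"
        using w(2) by (simp add: forget_single_layer)
      show "fst (snd t) (under w a) = fst (snd (single_layer x)) a" if "a \<in> fst (single_layer x)" for a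
        using that x1 by (simp add: single_layer_def split: prod.splits)
    qed
    then have "(single_layer x, w, t) \<in> hom (layered_structures R 0) (single_layer x) t"
      using x0 x1 t by (simp add: hom_layered)
    moreover have "degen_ob 0 (single_layer x) = single_layer x"
      by (simp add: single x0[OF x1] forget_single_layer)
    ultimately show "\<exists>i\<in>if fst x = {} then {()} else {}. \<exists>v\<in>hom (layered_structures R 0) (single_layer x) t.
        (case v of (x, w, y) \<Rightarrow> (degen_ob 0 x, w, degen_ob 0 y)) = k"
      using x1 w(1) by (auto intro!: bexI[of _ "(single_layer x, w, t)"])
  next
    fix t i j v v'
    assume "v \<in> hom (layered_structures R 0) (single_layer x) t"
      "v' \<in> hom (layered_structures R 0) (single_layer x) t"
      "(case v of (x, w, y) \<Rightarrow> (degen_ob 0 x, w, degen_ob 0 y)) =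
        (case v' of (x, w, y) \<Rightarrow> (degen_ob 0 x, w, degen_ob 0 y))"
    then show "v = v'"
      by (auto simp: hom_layered)
  qed auto
qed

text \<open>The last face deletes layer 2 and keeps the first part; face 0 deletes layer 1 and
  renumbers the second part from 2 to 1. Hence the pair of faces gives the tensor factors in the
  order of Schmitt's formula.\<close>

lemma face_outer_split_layers:
  assumes "i \<in> splittings (fst x)"
  shows "face_ob R 2 2 (split_layers x i) = single_layer (fst i, restr R (fst x) (fst i) (snd x))"
    and "face_ob R 2 0 (split_layers x i) = single_layer (snd i, restr R (fst x) (snd i) (snd x))"
proof -
  obtain A X A1 A2 where eq: "x = (A, X)" "i = (A1, A2)"
    by fastforce
  have "kept 2 2 A (\<lambda>a\<in>A. if a \<in> A1 then 1 else 2) = A1" "kept 2 0 A (\<lambda>a\<in>A. if a \<in> A1 then 1 else 2) = A2"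
    using assms by (auto simp: eq kept_def splittings_def)
  then show "face_ob R 2 2 (split_layers x i) = single_layer (fst i, restr R (fst x) (fst i) (snd x))"
    "face_ob R 2 0 (split_layers x i) = single_layer (snd i, restr R (fst x) (snd i) (snd x))"
    using assms
    by (auto simp: eq split_layers_def single_layer_def face_ob_def Let_def splittings_def fun_eq_iff)
qed

lemma restr_splitting:
  assumes "x \<in> elt R" "i \<in> splittings (fst x)"
  shows "(fst i, restr R (fst x) (fst i) (snd x)) \<in> elt R" "(snd i, restr R (fst x) (snd i) (snd x)) \<in> elt R"
proof -
  have "fst i \<subseteq> fst x" "snd i \<subseteq> fst x"
    using assms(2) by (auto simp: splittings_def)
  then show "(fst i, restr R (fst x) (fst i) (snd x)) \<in> elt R"
    "(snd i, restr R (fst x) (snd i) (snd x)) \<in> elt R"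
    using restr_ob[of "fst x" "snd x"] assms(1) by simp_all
qed

section \<open>Invariance of the Schmitt operations under isomorphism\<close>

lemma schmitt_delta_splittings:
  "schmitt_delta R x = (\<Sum>i\<in>splittings (fst x).
     delta (cls (structures R) (fst i, restr R (fst x) (fst i) (snd x)),
       cls (structures R) (snd i, restr R (fst x) (snd i) (snd x))))"
  by (auto simp: schmitt_delta_def splittings_def case_prod_beta intro!: sum.cong split: prod.split)

text \<open>The bijection under an isomorphism carries splittings to splittings, and restricting the
  isomorphism to each part identifies the classes term by term.\<close>

lemma schmitt_delta_respects: "schmitt_delta R respects iso_rel (structures R)"
proof (rule congruentI)
  fix x y assume "(x, y) \<in> iso_rel (structures R)"
  then obtain w where w: "w \<in> str_iso R x y" and ob: "x \<in> elt R" "y \<in> elt R"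
    using hom_structures_empty_iff[of x y] unfolding iso_rel_def by blast
  define f g where "f = under w" and "g = inv_into (fst x) (under w)"
  have f: "bij_betw f (fst x) (fst y)" and g: "bij_betw g (fst y) (fst x)"
    using under_bij[OF w] bij_betw_inv_into by (auto simp: f_def g_def)
  have gf: "g (f a) = a" if "a \<in> fst x" for a
    using bij_betw_inv_into_left[OF under_bij[OF w] that] by (simp add: f_def g_def)
  have fg: "f (g b) = b" if "b \<in> fst y" for b
    using bij_betw_inv_into_right[OF under_bij[OF w] that] by (simp add: f_def g_def)
  have split: "map_prod ((`) h) ((`) h) i \<in> splittings B"
    if "bij_betw h A B" "i \<in> splittings A" for h :: "'e \<Rightarrow> 'e" and A B i
    using that by (cases i) (auto simp: splittings_def bij_betw_def inj_on_def)
  have inv: "map_prod ((`) k) ((`) k) (map_prod ((`) h) ((`) h) i) = i"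
    if "\<And>a. a \<in> A \<Longrightarrow> k (h a) = a" "i \<in> splittings A" for h k :: "'e \<Rightarrow> 'e" and A i
    using that by (cases i) (force simp: splittings_def image_image)
  have cls: "cls (structures R) (B, restr R (fst x) B (snd x)) =
      cls (structures R) (f ` B, restr R (fst y) (f ` B) (snd y))" if "B \<subseteq> fst x" for B
  proof -
    have "f ` B \<subseteq> fst y"
      using f that by (auto simp: bij_betw_def)
    then have "(B, restr R (fst x) B (snd x)) \<in> elt R" "(f ` B, restr R (fst y) (f ` B) (snd y)) \<in> elt R"
      using that ob restr_ob[of "fst x" "snd x"] restr_ob[of "fst y" "snd y"] by simp_all
    then show ?thesis
      using iso_restr(1)[of w "fst x" "snd x" "fst y" "snd y" B "f ` B"] w ob that
        Str.cls_eq_iff[unfolded obj_structures] hom_structures_empty_iff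
      by (auto simp: f_def)
  qed
  show "schmitt_delta R x = schmitt_delta R y"
    unfolding schmitt_delta_splittings
  proof (rule sum.reindex_bij_witness[of _ "map_prod ((`) g) ((`) g)" "map_prod ((`) f) ((`) f)"])
    fix i assume i: "i \<in> splittings (fst x)"
    show "map_prod ((`) g) ((`) g) (map_prod ((`) f) ((`) f) i) = i"
      using inv[of "fst x" g f i] gf i by blast
    show "map_prod ((`) f) ((`) f) i \<in> splittings (fst y)"
      by (rule split[OF f i])
    have "fst i \<subseteq> fst x" "snd i \<subseteq> fst x"
      using i by (auto simp: splittings_def)
    from this[THEN cls] show "delta
        (cls (structures R) (fst (map_prod ((`) f) ((`) f) i),
          restr R (fst y) (fst (map_prod ((`) f) ((`) f) i)) (snd y)),
         cls (structures R) (snd (map_prod ((`) f) ((`) f) i),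
          restr R (fst y) (snd (map_prod ((`) f) ((`) f) i)) (snd y))) =
      delta (cls (structures R) (fst i, restr R (fst x) (fst i) (snd x)),
         cls (structures R) (snd i, restr R (fst x) (snd i) (snd x)))"
      by simp
  next
    fix i assume i: "i \<in> splittings (fst y)"
    show "map_prod ((`) f) ((`) f) (map_prod ((`) g) ((`) g) i) = i"
      using inv[of "fst y" f g i] fg i by blast
    show "map_prod ((`) g) ((`) g) i \<in> splittings (fst x)"
      by (rule split[OF g i])
  qed
qed

lemma empty_carrier_respects: "(\<lambda>x. fst x = {}) respects iso_rel (structures R)"
proof (rule congruentI)
  fix x y assume "(x, y) \<in> iso_rel (structures R)"
  then obtain w where "w \<in> str_iso R x y"
    using hom_structures_empty_iff[of x y] unfolding iso_rel_def by blast
  from under_bij[OF this] show "(fst x = {}) = (fst y = {})"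
    by (auto simp: bij_betw_def)
qed

lemma on_class_single_layer:
  assumes x: "x \<in> elt R" and eq: "\<And>x. x \<in> elt R \<Longrightarrow> F (single_layer x) = G x"
    and G: "G respects iso_rel (structures R)"
  shows "on_class F (one_layer (cls (structures R) x)) = G x"
  unfolding one_layer_cls[OF x] eq[OF x, symmetric]
proof (rule Lay.on_class_cls)
  show "single_layer x \<in> obj (layered_structures R 1)"
    using single_layer_layered[OF x] by (simp add: obj_layered)
  fix y assume y: "y \<in> obj (layered_structures R 1)"
    "hom (layered_structures R 1) (single_layer x) y \<noteq> {}"
  then obtain z where z: "z \<in> elt R" "y = single_layer z"
    unfolding obj_layered layered_one by blast
  then have "(x, z) \<in> iso_rel (structures R)"
    using y(2) x hom_single_layer_iff[OF x z(1)] hom_structures_empty_iff[of x z]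
    by (simp add: iso_rel_def obj_structures)
  from congruentD[OF G this] show "F y = F (single_layer x)"
    using z eq x by simp
qed

end

section \<open>Comparison of the two coalgebras on basis vectors\<close>

locale locally_finite_species = species +
  assumes locally_finite_val: "\<And>A. finite A \<Longrightarrow> locally_finite (val R A)"
begin

lemma locally_finite_lev: "locally_finite (layered_structures R n)"
  using locally_finite_layered locally_finite_val by blast

lemma functor_face_two: "i \<le> 2 \<Longrightarrow> is_functor (layered_structures R 2) (layered_structures R 1)
    \<lparr>fob = face_ob R 2 i, far = face_ar R 2 i\<rparr>"
  using functor_face[of i 1] by (simp add: numeral_2_eq_2)

lemma functor_degen_zero: "is_functor (layered_structures R 0) (layered_structures R 1)
    \<lparr>fob = degen_ob 0, far = (\<lambda>(x, w, y). (degen_ob 0 x, w, degen_ob 0 y))\<rparr>"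
  using functor_degen[of 0 0] by simp

text \<open>The fibres are finite for the same reason that the cardinalities can be computed: lifts
  are unique and indexed by a finite set.\<close>

lemma incidence_finite_decomp: "incidence_finite (decomp R)"
  unfolding incidence_finite_def decomp_simps
proof (intro conjI allI impI)
  show "finite_hfibres (layered_structures R 2) \<lparr>fob = face_ob R 2 1, far = face_ar R 2 1\<rparr>
      (layered_structures R 1)"
    unfolding finite_hfibres_def obj_layered
  proof
    fix s assume "s \<in> layered 1"
    then obtain x where x: "x \<in> elt R" "s = single_layer x"
      unfolding layered_one by blast
    have s: "s \<in> obj (layered_structures R 1)"
      using \<open>s \<in> layered 1\<close> by (simp add: obj_layered)
    have "is_functor (layered_structures R 2) (layered_structures R 1)
        \<lparr>fob = face_ob R 2 1, far = face_ar R 2 1\<rparr>"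
      by (rule functor_face_two) simp
    from finite_hfibre_unique_lifts[OF groupoid_layered groupoid_layered this s
        unique_lifts_face[OF x(1), folded x(2)]]
    show "finite_groupoid (hfibre (layered_structures R 2) \<lparr>fob = face_ob R 2 1, far = face_ar R 2 1\<rparr>
      (layered_structures R 1) s)" .
  qed
  show "finite_hfibres (layered_structures R 0)
      \<lparr>fob = degen_ob 0, far = (\<lambda>(x, w, y). (degen_ob 0 x, w, degen_ob 0 y))\<rparr> (layered_structures R 1)"
    unfolding finite_hfibres_def obj_layered
  proof
    fix s assume "s \<in> layered 1"
    then obtain x where x: "x \<in> elt R" "s = single_layer x"
      unfolding layered_one by blast
    have s: "s \<in> obj (layered_structures R 1)"
      using \<open>s \<in> layered 1\<close> by (simp add: obj_layered)
    from finite_hfibre_unique_lifts[OF groupoid_layered groupoid_layered functor_degen_zero s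
        unique_lifts_degen[OF x(1), folded x(2)]]
    show "finite_groupoid (hfibre (layered_structures R 0)
      \<lparr>fob = degen_ob 0, far = (\<lambda>(x, w, y). (degen_ob 0 x, w, degen_ob 0 y))\<rparr> (layered_structures R 1) s)" .
  qed
qed (simp_all add: groupoid_layered functor_face functor_degen locally_finite_lev)

text \<open>Basis vectors appear as rectangles because the base is a product groupoid; they are
  separated into pairs only in \<open>comult_on_class\<close>.\<close>

lemma card_over_incidence_comult:
  assumes x: "x \<in> elt R"
  shows "card_over (prod_cat (layered_structures R 1) (layered_structures R 1))
      (incidence_comult (decomp R) (point (layered_structures R 1) (single_layer x))) =
    (\<Sum>i\<in>splittings (fst x).
      delta (one_layer (cls (structures R) (fst i, restr R (fst x) (fst i) (snd x))) \<times>
        one_layer (cls (structures R) (snd i, restr R (fst x) (snd i) (snd x)))))"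
proof -
  let ?L = "layered_structures R 1"
  let ?F = "\<lambda>i. \<lparr>fob = face_ob R 2 i, far = face_ar R 2 i\<rparr>"
  have s: "single_layer x \<in> obj ?L"
    using single_layer_layered[OF x] by (simp add: obj_layered)
  have "is_functor (layered_structures R 2) ?L (?F i)" if "i \<le> 2" for i
    using that by (rule functor_face_two)
  then have F: "is_functor (layered_structures R 2) ?L (?F 1)"
    "is_functor (layered_structures R 2) (prod_cat ?L ?L) (pair_fctr (?F 2) (?F 0))"
    by (auto intro: functor_pair)
  have "card_over (prod_cat ?L ?L) (incidence_comult (decomp R) (point ?L (single_layer x))) =
      (\<Sum>i\<in>splittings (fst x). delta (cls (prod_cat ?L ?L)
        (fob (pair_fctr (?F 2) (?F 0)) (split_layers x i))))"
    unfolding incidence_comult_def decomp_simps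
    by (rule card_over_pull_point[OF groupoid_layered groupoid_layered
          groupoid_prod_cat[OF groupoid_layered groupoid_layered]
          locally_finite_prod_cat[OF locally_finite_lev locally_finite_lev] F s unique_lifts_face[OF x]])
  also have "\<dots> = (\<Sum>i\<in>splittings (fst x).
      delta (one_layer (cls (structures R) (fst i, restr R (fst x) (fst i) (snd x))) \<times>
        one_layer (cls (structures R) (snd i, restr R (fst x) (snd i) (snd x)))))"
  proof (intro sum.cong refl arg_cong[where f = delta])
    fix i assume i: "i \<in> splittings (fst x)"
    note r = restr_splitting[OF x i]
    have "single_layer (fst i, restr R (fst x) (fst i) (snd x)) \<in> obj ?L"
      "single_layer (snd i, restr R (fst x) (snd i) (snd x)) \<in> obj ?L"
      using r[THEN single_layer_layered] by (simp_all only: obj_layered)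
    then show "cls (prod_cat ?L ?L) (fob (pair_fctr (?F 2) (?F 0)) (split_layers x i)) =
      one_layer (cls (structures R) (fst i, restr R (fst x) (fst i) (snd x))) \<times>
        one_layer (cls (structures R) (snd i, restr R (fst x) (snd i) (snd x)))"
      unfolding pair_fctr_def fctr.select_convs face_outer_split_layers[OF i] one_layer_cls[OF r(1)]
        one_layer_cls[OF r(2)] by (rule cls_prod_cat)
  qed
  finally show ?thesis .
qed

lemma card_over_incidence_counit:
  assumes x: "x \<in> elt R"
  shows "card_over unit_cat
      (incidence_counit (decomp R) (point (layered_structures R 1) (single_layer x))) =
    (if fst x = {} then delta {()} else 0)"
proof -
  have "single_layer x \<in> obj (layered_structures R 1)"
    using single_layer_layered[OF x] by (simp add: obj_layered)
  from card_over_pull_point[OF groupoid_layered groupoid_layered groupoid_unit_cat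
      locally_finite_unit_cat functor_degen_zero functor_to_unit this unique_lifts_degen[OF x]]
  show ?thesis
    unfolding incidence_counit_def decomp_simps by (simp add: cls_unit_cat)
qed

lemma comult_on_class:
  assumes x: "x \<in> elt R"
  shows "push (\<lambda>c. (fst ` c, snd ` c))
      (on_class (\<lambda>s. card_over (prod_cat (layered_structures R 1) (layered_structures R 1))
        (incidence_comult (decomp R) (point (layered_structures R 1) s)))
        (one_layer (cls (structures R) x))) =
    push (map_prod one_layer one_layer) (on_class (schmitt_delta R) (cls (structures R) x))"
proof -
  let ?G = "\<lambda>x. \<Sum>i\<in>splittings (fst x).
      delta (one_layer (cls (structures R) (fst i, restr R (fst x) (fst i) (snd x))) \<times>
        one_layer (cls (structures R) (snd i, restr R (fst x) (snd i) (snd x))))"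
  \<comment> \<open>Written as the image of \<open>schmitt_delta\<close> under a map of bases, the
    sum inherits its invariance.\<close>
  have G: "?G x = push (\<lambda>(c, c'). one_layer c \<times> one_layer c') (schmitt_delta R x)" for x
    by (simp add: schmitt_delta_splittings push_sum_delta)
  have "?G respects iso_rel (structures R)"
    unfolding G by (rule congruent_compose[OF schmitt_delta_respects])
  from on_class_single_layer[OF x card_over_incidence_comult this]
  have "push (\<lambda>c. (fst ` c, snd ` c))
      (on_class (\<lambda>s. card_over (prod_cat (layered_structures R 1) (layered_structures R 1))
        (incidence_comult (decomp R) (point (layered_structures R 1) s)))
        (one_layer (cls (structures R) x))) = push (\<lambda>c. (fst ` c, snd ` c)) (?G x)"
    by simp
  also have "\<dots> = (\<Sum>i\<in>splittings (fst x).
      delta (one_layer (cls (structures R) (fst i, restr R (fst x) (fst i) (snd x))),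
        one_layer (cls (structures R) (snd i, restr R (fst x) (snd i) (snd x)))))"
    unfolding push_sum_delta
  proof (intro sum.cong refl arg_cong[where f = delta])
    fix i assume "i \<in> splittings (fst x)"
    \<comment> \<open>A rectangle determines its sides only if both are nonempty; each class
      contains its representative.\<close>
    then have "one_layer (cls (structures R) (fst i, restr R (fst x) (fst i) (snd x))) \<noteq> {}"
      "one_layer (cls (structures R) (snd i, restr R (fst x) (snd i) (snd x))) \<noteq> {}"
      using restr_splitting[OF x] Str.self_mem_cls unfolding obj_structures one_layer_eq by blast+
    then show "(fst ` (one_layer (cls (structures R) (fst i, restr R (fst x) (fst i) (snd x))) \<times>
        one_layer (cls (structures R) (snd i, restr R (fst x) (snd i) (snd x)))),
      snd ` (one_layer (cls (structures R) (fst i, restr R (fst x) (fst i) (snd x))) \<times>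
        one_layer (cls (structures R) (snd i, restr R (fst x) (snd i) (snd x))))) =
      (one_layer (cls (structures R) (fst i, restr R (fst x) (fst i) (snd x))),
        one_layer (cls (structures R) (snd i, restr R (fst x) (snd i) (snd x))))"
      by simp
  qed
  also have "\<dots> = push (map_prod one_layer one_layer) (schmitt_delta R x)"
    by (simp add: schmitt_delta_splittings push_sum_delta)
  also have "schmitt_delta R x = on_class (schmitt_delta R) (cls (structures R) x)"
    using Str.on_class_respects[OF schmitt_delta_respects] x by (simp add: obj_structures)
  finally show ?thesis .
qed

lemma counit_on_class:
  assumes x: "x \<in> elt R"
  shows "Poly_Mapping.lookup
      (on_class (\<lambda>s. card_over unit_cat (incidence_counit (decomp R) (point (layered_structures R 1) s)))
        (one_layer (cls (structures R) x))) {()} =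
    on_class schmitt_epsilon (cls (structures R) x)"
proof -
  have "(\<lambda>x. if fst x = {} then delta {()} else 0) respects iso_rel (structures R)"
    using congruent_compose[OF empty_carrier_respects, of "\<lambda>b. if b then delta {()} else 0"] .
  from on_class_single_layer[OF x card_over_incidence_counit this]
  have "Poly_Mapping.lookup
      (on_class (\<lambda>s. card_over unit_cat (incidence_counit (decomp R) (point (layered_structures R 1) s)))
        (one_layer (cls (structures R) x))) {()} = schmitt_epsilon x"
    by (simp add: lookup_delta schmitt_epsilon_def split: prod.split)
  also have "schmitt_epsilon respects iso_rel (structures R)"
    using congruent_compose[OF empty_carrier_respects, of "\<lambda>b. if b then 1 else 0"]
    by (simp add: schmitt_epsilon_def case_prod_beta')
  then have "schmitt_epsilon x = on_class schmitt_epsilon (cls (structures R) x)"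
    using Str.on_class_respects[of schmitt_epsilon x] x by (simp add: obj_structures)
  finally show ?thesis .
qed

text \<open>Once \<open>push\<close> is absorbed, both sides are linear extensions from
  \<open>pi0 (structures R)\<close>; \<open>in_span\<close> confines the comparison to genuine
  classes, which have representatives.\<close>

lemma coalg_iso:
  "coalg_iso_on_bases one_layer (schmitt_coalgebra R) (incidence_coalgebra_card (decomp R))"
  unfolding coalg_iso_on_bases_def
proof (intro conjI allI impI)
  show "bij_betw one_layer (basis (schmitt_coalgebra R)) (basis (incidence_coalgebra_card (decomp R)))"
    using bij_betw_one_layer
    by (simp add: schmitt_coalgebra_def incidence_coalgebra_card_def decomp_simps)
next
  fix v assume v: "in_span (basis (schmitt_coalgebra R)) v"
  then have v: "in_span (pi0 (structures R)) v"
    by (simp add: schmitt_coalgebra_def)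
  show "comult (incidence_coalgebra_card (decomp R)) (push one_layer v) =
      push (map_prod one_layer one_layer) (comult (schmitt_coalgebra R) v)"
    unfolding incidence_coalgebra_card_def schmitt_coalgebra_def coalg.select_convs hcard_def
      lin_ext_push push_lin_ext decomp_simps
    using comult_on_class by (intro lin_ext_cong[OF v]) (auto simp: pi0_cls obj_structures)
  show "counit (incidence_coalgebra_card (decomp R)) (push one_layer v) =
      counit (schmitt_coalgebra R) v"
    unfolding incidence_coalgebra_card_def schmitt_coalgebra_def coalg.select_convs hcard_def
      lin_ext_push decomp_simps unfolding lookup_lin_ext_lin_form
    using counit_on_class by (intro lin_form_cong[OF v]) (auto simp: pi0_cls obj_structures)
qed

end


section \<open>Morphisms of restriction species\<close>

locale species_trans = P: species P + Q: species Q
  for P :: "('e::infinite, 'x, 'm) species" and Q :: "('e, 'y, 'n) species" +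
  fixes \<phi> :: "('e, 'x, 'm, 'y, 'n) species_mor"
  assumes pstrans: "is_pstrans inj_cat P Q \<phi>"
begin

lemmas pstrans_axioms = pstrans[unfolded is_pstrans_def]

lemma functor_component: "finite A \<Longrightarrow> is_functor (val P A) (val Q A) (component \<phi> A)"
  using conjunct1[OF pstrans_axioms] by (simp add: obj_inj_cat)

lemma square_trans:
  "f \<in> hom inj_cat A B \<Longrightarrow> is_nat_trans (val P B) (val Q A) (fcomp (component \<phi> A) (act P f))
    (fcomp (act Q f) (component \<phi> B)) (square \<phi> f)"
  using conjunct1[OF conjunct2[OF pstrans_axioms]] by simp

lemma square_hom:
  "f \<in> hom inj_cat A B \<Longrightarrow> Y \<in> obj (val P B) \<Longrightarrow>
    square \<phi> f Y \<in> hom (val Q A) (fob (component \<phi> A) (fob (act P f) Y))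
      (fob (act Q f) (fob (component \<phi> B) Y))"
  using square_trans by (auto simp: is_nat_trans_def fcomp_def)

lemma square_natural:
  assumes "f \<in> hom inj_cat A B" "w \<in> hom (val P B) Y Z"
  shows "cmp (val Q A) (far (act Q f) (far (component \<phi> B) w)) (square \<phi> f Y) =
    cmp (val Q A) (square \<phi> f Z) (far (component \<phi> A) (far (act P f) w))"
  using square_trans[OF assms(1)] assms(2) unfolding is_nat_trans_def fcomp_def
  by (metis comp_apply fctr.select_convs(2))

lemma square_ide:
  "finite A \<Longrightarrow> X \<in> obj (val P A) \<Longrightarrow>
    cmp (val Q A) (square \<phi> (ide inj_cat A) X) (far (component \<phi> A) (unitor P A X)) =
      unitor Q A (fob (component \<phi> A) X)"
  using conjunct1[OF conjunct2[OF conjunct2[OF pstrans_axioms]]] by (simp add: obj_inj_cat)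

lemma square_cmp:
  "f \<in> hom inj_cat A B \<Longrightarrow> g \<in> hom inj_cat B D \<Longrightarrow> Z \<in> obj (val P D) \<Longrightarrow>
    cmp (val Q A) (square \<phi> (cmp inj_cat g f) Z) (far (component \<phi> A) (compositor P f g Z)) =
      cmp (val Q A) (compositor Q f g (fob (component \<phi> D) Z))
        (cmp (val Q A) (far (act Q f) (square \<phi> g Z)) (square \<phi> f (fob (act P g) Z)))"
  using conjunct2[OF conjunct2[OF conjunct2[OF pstrans_axioms]]] by simp

text \<open>Together with \<open>elt_arr\<close>, the functor between categories of elements induced
  by \<open>\<phi>\<close>, lying over the identity of \<open>inj_cat\<close>.\<close>

definition elt_map :: "'e set \<times> 'x \<Rightarrow> 'e set \<times> 'y" where
  "elt_map x = (fst x, fob (component \<phi> (fst x)) (snd x))"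

definition elt_arr :: "'e set \<times> 'x \<Rightarrow> 'e injection \<times> 'm \<Rightarrow> 'e set \<times> 'x \<Rightarrow> 'e injection \<times> 'n" where
  "elt_arr x w y = (fst w, cmp (val Q (fst x)) (square \<phi> (fst w) (snd y))
     (far (component \<phi> (fst x)) (snd w)))"

lemma elt_map_elt: "x \<in> elt P \<Longrightarrow> elt_map x \<in> elt Q"
  using functor_ob[OF functor_component] by (auto simp: elt_def elt_map_def)

lemma elt_arr_hom:
  assumes w: "w \<in> elt_hom P x y" and ob: "x \<in> elt P" "y \<in> elt P"
  shows "elt_arr x w y \<in> elt_hom Q (elt_map x) (elt_map y)"
proof -
  note s = P.elt_homD[of "fst w" "snd w", unfolded prod.collapse, OF w ob]
  interpret A: groupoid "val Q (fst x)"
    using s(3) by (rule Q.groupoid_val)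
  show ?thesis
    unfolding elt_arr_def elt_map_def
    using s(1) A.cmp_hom[OF functor_hom[OF functor_component[OF s(3)] s(5)] square_hom[OF s(1,7)]]
    by (intro Q.elt_homI) simp_all
qed

lemma elt_arr_ide: "x \<in> elt P \<Longrightarrow> elt_arr x (str_ide P x) x = str_ide Q (elt_map x)"
  using square_ide by (auto simp: elt_def elt_arr_def elt_map_def str_ide_def)

text \<open>The compositor law of \<open>\<phi>\<close> splits the square over the composite
  injection into those over \<open>t\<close> and \<open>s\<close>; naturality of the square over
  \<open>s\<close> then exchanges it with \<open>v\<close>.\<close>

lemma elt_arr_cmp:
  assumes w: "w \<in> elt_hom P x y" and w': "w' \<in> elt_hom P y z"
    and ob: "x \<in> elt P" "y \<in> elt P" "z \<in> elt P"
  shows "elt_arr x (str_cmp P (snd z) w' w) z =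
    str_cmp Q (snd (elt_map z)) (elt_arr y w' z) (elt_arr x w y)"
proof -
  obtain A X B Y D Z s u t v where eq: "x = (A, X)" "y = (B, Y)" "z = (D, Z)" "w = (s, u)" "w' = (t, v)"
    by (metis surj_pair)
  note s = P.elt_homD[OF w[unfolded eq(4)] ob(1,2), unfolded eq fst_conv snd_conv]
    and t = P.elt_homD[OF w'[unfolded eq(5)] ob(2,3), unfolded eq fst_conv snd_conv]
  interpret A: groupoid "val Q A"
    using s(3) by (rule Q.groupoid_val)
  interpret B: groupoid "val Q B"
    using t(3) by (rule Q.groupoid_val)
  interpret PA: groupoid "val P A"
    using s(3) by (rule P.groupoid_val)
  note c = functor_component[OF s(3)] and cB = functor_component[OF t(3)]
    and cD = functor_component[OF t(4)]
  note sv = P.act_hom[OF s(1) t(5)]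
  note pc = P.compositor_hom[OF s(1) t(1) t(7)]
  note fu = functor_hom[OF c s(5)] and fsv = functor_hom[OF c sv] and fpc = functor_hom[OF c pc]
  note ts = inj_cat.cmp_hom[OF s(1) t(1)]
  note sq_ts = square_hom[OF ts t(7)] and sq_t = square_hom[OF t(1,7)] and sq_s = square_hom[OF s(1,7)]
    and sq_sZ = square_hom[OF s(1) P.act_ob[OF t(1,7)]]
  note qc = Q.compositor_hom[OF s(1) t(1) functor_ob[OF cD t(7)]]
  note q1 = Q.act_hom[OF s(1) sq_t] and q2 = Q.act_hom[OF s(1) functor_hom[OF cB t(5)]]
  let ?\<phi> = "far (component \<phi> A)"
  let ?c = "compositor Q s t (fob (component \<phi> D) Z)"
  have "cmp (val Q A) (square \<phi> (cmp inj_cat t s) Z)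
      (?\<phi> (cmp (val P A) (compositor P s t Z) (cmp (val P A) (far (act P s) v) u))) =
    cmp (val Q A) (cmp (val Q A) (square \<phi> (cmp inj_cat t s) Z) (?\<phi> (compositor P s t Z)))
      (cmp (val Q A) (?\<phi> (far (act P s) v)) (?\<phi> u))"
    using functor_cmp[OF c PA.cmp_hom[OF s(5) sv] pc] functor_cmp[OF c s(5) sv]
      A.cmp_assoc[OF A.cmp_hom[OF fu fsv] fpc sq_ts] by simp
  also have "\<dots> = cmp (val Q A) (cmp (val Q A) ?c (cmp (val Q A) (far (act Q s) (square \<phi> t Z))
      (square \<phi> s (fob (act P t) Z)))) (cmp (val Q A) (?\<phi> (far (act P s) v)) (?\<phi> u))"
    using square_cmp[OF s(1) t(1) t(7)] by simp
  also have "\<dots> = cmp (val Q A) ?c (cmp (val Q A) (far (act Q s) (square \<phi> t Z))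
      (cmp (val Q A) (cmp (val Q A) (square \<phi> s (fob (act P t) Z)) (?\<phi> (far (act P s) v))) (?\<phi> u)))"
    using A.cmp_assoc[OF A.cmp_hom[OF fu fsv] A.cmp_hom[OF sq_sZ q1] qc]
      A.cmp_assoc[OF A.cmp_hom[OF fu fsv] sq_sZ q1] A.cmp_assoc[OF fu fsv sq_sZ] by simp
  also have "\<dots> = cmp (val Q A) ?c (cmp (val Q A) (far (act Q s) (square \<phi> t Z))
      (cmp (val Q A) (cmp (val Q A) (far (act Q s) (far (component \<phi> B) v)) (square \<phi> s Y)) (?\<phi> u)))"
    using square_natural[OF s(1) t(5)] by simp
  also have "\<dots> = cmp (val Q A) ?c (cmp (val Q A) (far (act Q s) (cmp (val Q B) (square \<phi> t Z)
      (far (component \<phi> B) v))) (cmp (val Q A) (square \<phi> s Y) (?\<phi> u)))"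
    using A.cmp_assoc[OF fu sq_s q2] A.cmp_assoc[OF A.cmp_hom[OF fu sq_s] q2 q1]
      Q.act_cmp[OF s(1) functor_hom[OF cB t(5)] sq_t] by simp
  finally show ?thesis
    by (simp add: eq elt_arr_def str_cmp_def elt_map_def s(2))
qed

lemma elt_arr_iso:
  assumes w: "w \<in> str_iso P x y" and ob: "x \<in> elt P" "y \<in> elt P"
  shows "elt_arr x w y \<in> str_iso Q (elt_map x) (elt_map y)"
proof -
  have "bij_betw (under (elt_arr x w y)) (fst (elt_map x)) (fst (elt_map y))"
    using P.under_bij[OF w] by (simp add: elt_arr_def elt_map_def)
  then show ?thesis
    using elt_arr_hom[OF P.iso_elt_hom[OF w] ob]
    by (cases "elt_arr x w y") (simp add: str_iso_elt_hom)
qed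

lemma layered_map_ob: "layered_map_ob \<phi> x = (fst x, fst (snd x), snd (elt_map (forget_layers x)))"
  by (simp add: layered_map_ob_def elt_map_def forget_layers_def split: prod.split)

lemma forget_layered_map_ob: "forget_layers (layered_map_ob \<phi> x) = elt_map (forget_layers x)"
  by (simp add: layered_map_ob_def elt_map_def forget_layers_def split: prod.split)

text \<open>\<open>elt_arr\<close> leaves the underlying injection unchanged, so layers are
  respected and functoriality is that of the categories of elements.\<close>

lemma functor_decomp_map:
  "is_functor (layered_structures P n) (layered_structures Q n) (decomp_map Q \<phi> n)"
  unfolding P.layered_labelled_cat Q.layered_labelled_cat
proof (rule functor_labelled_cat[where g = "\<lambda>x w y. elt_arr (forget_layers x) w (forget_layers y)"],
    goal_cases)
  case (1 x)
  then show ?case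
    using elt_map_elt[of "forget_layers x"]
    by (auto simp: decomp_map_def P.layered_def Q.layered_def layered_map_ob elt_map_def forget_layers_def)
next
  case (2 x u y)
  then show ?case
    by (cases x; cases u; cases y) (simp add: decomp_map_def elt_arr_def forget_layers_def)
next
  case (3 x u y)
  note u = P.layered_isoD[OF 3(3,1,2)]
  have "elt_arr (forget_layers x) u (forget_layers y) \<in>
      Q.layered_iso (layered_map_ob \<phi> x) (layered_map_ob \<phi> y)"
  proof (rule Q.layered_isoI)
    show "elt_arr (forget_layers x) u (forget_layers y) \<in>
        str_iso Q (forget_layers (layered_map_ob \<phi> x)) (forget_layers (layered_map_ob \<phi> y))"
      using elt_arr_iso[OF u(1-3)] by (simp add: forget_layered_map_ob)
    show "fst (snd (layered_map_ob \<phi> y)) (under (elt_arr (forget_layers x) u (forget_layers y)) a) =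
        fst (snd (layered_map_ob \<phi> x)) a" if "a \<in> fst (layered_map_ob \<phi> x)" for a
      using u(4) that by (simp add: layered_map_ob elt_arr_def)
  qed
  then show ?case
    by (simp add: decomp_map_def)
next
  case (4 x)
  then have "forget_layers x \<in> elt P"
    by (auto simp: P.layered_def forget_layers_def)
  then show ?case
    using P.layered_iso_ide[OF 4] elt_arr_ide by (simp add: decomp_map_def forget_layered_map_ob)
next
  case (5 x y z u v)
  note u = P.layered_isoD[OF 5(4,1,2)] and v = P.layered_isoD[OF 5(5,2,3)]
  show ?case
    using P.layered_iso_cmp[OF 5(4,5,1-3)]
      elt_arr_cmp[OF P.iso_elt_hom[OF u(1)] P.iso_elt_hom[OF v(1)] u(2,3) v(3)]
    by (simp add: decomp_map_def layered_map_ob P.snd_forget_layers)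
qed

lemma schmitt_image_elt_map: "schmitt_image Q \<phi> x = delta (cls (structures Q) (elt_map x))"
  by (simp add: schmitt_image_def elt_map_def split: prod.split)

lemma schmitt_image_respects: "schmitt_image Q \<phi> respects iso_rel (structures P)"
proof (rule congruentI)
  fix x y assume "(x, y) \<in> iso_rel (structures P)"
  then obtain w where w: "w \<in> str_iso P x y" and ob: "x \<in> elt P" "y \<in> elt P"
    using P.hom_structures_empty_iff[of x y] unfolding iso_rel_def by blast
  note m = elt_map_elt[OF ob(1)] elt_map_elt[OF ob(2)]
  have "hom (structures Q) (elt_map x) (elt_map y) \<noteq> {}"
    unfolding Q.hom_structures_empty_iff using elt_arr_iso[OF w ob] m by auto
  then have "cls (structures Q) (elt_map x) = cls (structures Q) (elt_map y)"
    using Q.Str.cls_eq_iff[unfolded Q.obj_structures, OF m] by blast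
  then show "schmitt_image Q \<phi> x = schmitt_image Q \<phi> y"
    by (simp add: schmitt_image_elt_map)
qed

text \<open>No pullback occurs: the point at \<open>s\<close> becomes the point at its image, whose
  cardinality is a single basis vector, exactly as Schmitt prescribes.\<close>

lemma hcard_decomp_map:
  assumes Q: "locally_finite (layered_structures Q 1)" and v: "in_span (pi0 (structures P)) v"
  shows "hcard (layered_structures P 1) (layered_structures Q 1) (compose_with (decomp_map Q \<phi> 1))
      (push one_layer v) = push one_layer (schmitt_hom Q \<phi> v)"
  unfolding hcard_def schmitt_hom_def lin_ext_push push_lin_ext
proof (rule lin_ext_cong[OF v])
  fix c assume "c \<in> pi0 (structures P)"
  then obtain x where x: "x \<in> elt P" "c = cls (structures P) x"
    by (auto simp: pi0_cls P.obj_structures)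
  \<comment> \<open>Stated for every structure, since \<open>on_class_single_layer\<close> compares
    the values at different representatives.\<close>
  have card: "card_over (layered_structures Q 1)
      (compose_with (decomp_map Q \<phi> 1) (point (layered_structures P 1) (single_layer x))) =
    push one_layer (schmitt_image Q \<phi> x)" if x: "x \<in> elt P" for x
  proof -
    have s: "single_layer x \<in> obj (layered_structures P 1)"
      using P.single_layer_layered[OF x] by (simp add: P.obj_layered)
    have map: "fob (decomp_map Q \<phi> 1) (single_layer x) = single_layer (elt_map x)"
      by (simp add: decomp_map_def layered_map_ob_def single_layer_def elt_map_def split: prod.split)
    have "card_over (layered_structures Q 1)
        (compose_with (decomp_map Q \<phi> 1) (point (layered_structures P 1) (single_layer x))) =
      delta (cls (layered_structures Q 1) (single_layer (elt_map x)))"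
      using card_over_point[OF P.groupoid_layered Q.groupoid_layered Q functor_decomp_map s]
      unfolding map .
    then show ?thesis
      using Q.one_layer_cls[OF elt_map_elt[OF x]]
      by (simp add: schmitt_image_elt_map push_def lin_ext_delta)
  qed
  have "(\<lambda>x. push one_layer (schmitt_image Q \<phi> x)) respects iso_rel (structures P)"
    by (rule congruent_compose[OF schmitt_image_respects])
  from P.on_class_single_layer[OF x(1) card this]
  show "on_class (\<lambda>s. card_over (layered_structures Q 1)
      (compose_with (decomp_map Q \<phi> 1) (point (layered_structures P 1) s))) (one_layer c) =
    push one_layer (on_class (schmitt_image Q \<phi>) c)"
    using P.Str.on_class_respects[OF schmitt_image_respects] x by (simp add: P.obj_structures)
qed

end

text \<open>The conjuncts with \<open>respects\<close> and \<open>incidence_finite\<close> give the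
  equations their meaning: \<open>on_class\<close> and the cardinalities are total functions, with
  values also where the data are not invariant or not finite.\<close>

theorem proposition5p13:
  fixes R :: "('e::infinite, 'x, 'm) species"
  assumes "restriction_species R"
  shows
    "schmitt_delta R respects iso_rel (structures R) \<and>
     incidence_finite (decomp R) \<and>
     coalg_iso_on_bases one_layer (schmitt_coalgebra R) (incidence_coalgebra_card (decomp R)) \<and>
     (\<forall>(R' :: ('e, 'y, 'n) species) \<phi>.
        restriction_species R' \<and> species_morphism R' R \<phi> \<longrightarrow>
          schmitt_image R \<phi> respects iso_rel (structures R') \<and>
          (\<forall>n. is_functor (lev (decomp R') n) (lev (decomp R) n) (decomp_map R \<phi> n)) \<and>
          (\<forall>v. in_span (basis (schmitt_coalgebra R')) v \<longrightarrow>
             hcard (lev (decomp R') 1) (lev (decomp R) 1) (compose_with (decomp_map R \<phi> 1))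
               (push one_layer v)
             = push one_layer (schmitt_hom R \<phi> v)))"
proof -
  interpret R: locally_finite_species R
    by unfold_locales (use assms in \<open>auto simp: restriction_species_def\<close>)
  have "schmitt_image R \<phi> respects iso_rel (structures R') \<and>
      (\<forall>n. is_functor (lev (decomp R') n) (lev (decomp R) n) (decomp_map R \<phi> n)) \<and>
      (\<forall>v. in_span (basis (schmitt_coalgebra R')) v \<longrightarrow>
         hcard (lev (decomp R') 1) (lev (decomp R) 1) (compose_with (decomp_map R \<phi> 1))
           (push one_layer v)
         = push one_layer (schmitt_hom R \<phi> v))"
    if "restriction_species R'" "species_morphism R' R \<phi>"
    for R' :: "('e, 'y, 'n) species" and \<phi>
  proof -
    interpret species_trans R' R \<phi>
      by unfold_locales (use that in \<open>auto simp: restriction_species_def species_morphism_def\<close>)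
    show ?thesis
      using schmitt_image_respects functor_decomp_map hcard_decomp_map[OF R.locally_finite_lev]
      by (simp add: decomp_simps schmitt_coalgebra_def)
  qed
  then show ?thesis
    using R.schmitt_delta_respects R.incidence_finite_decomp R.coalg_iso by blast
qed

end
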